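(* Let $\mathcal{H}$ be a separable real Hilbert space and $V:\mathcal{H}\to\mathcal{H}$ a monotone and $L_V$-Lipschitz continuous operator with $\operatorname{zer}V=\{y\in\mathcal{H}:V(y)=0\}\neq\emptyset$. Let $\alpha>1$, $\beta>0$, $t_0\ge 0$ and $s_0>0$. Consider the dynamical system on $[t_0,+\infty)$ $$\text{(A)}\quad\begin{cases} dY(t)=X(t)\,dt\\ dV(Y(t))=H(t)\,dt\\ dX(t)=\left(-\frac{2(\alpha-1)}{\alpha}X(t)-\frac{2\beta s_0}{\alpha}\exp\left(\frac{2(t-t_0)}{\alpha}\right)H(t)-\frac{2\beta s_0}{\alpha}\exp\left(\frac{2(t-t_0)}{\alpha}\right)V(Y(t))\right)dt+\sigma_Y(t)\,dW(t)\\ Y(t_0)=Y_0,\ X(t_0)=X_0\end{cases}$$ and the dynamical system on $[s_0,+\infty)$ $$\text{(B)}\quad\begin{cases} dZ(s)=Q(s)\,ds\\ dV(Z(s))=K(s)\,ds\\ dQ(s)=\left(-\frac{\alpha}{s}Q(s)-\beta K(s)-\frac{\alpha\beta}{2s}V(Z(s))\right)ds+\sigma_Z(s)\,dW(s)\\ Z(s_0)=Z_0,\ Q(s_0)=Q_0.\end{cases}$$ Let $\tau(s):=t_0+\frac{\alpha}{2}\log\left(\frac{s}{s_0}\right)$ for $s\ge s_0$ and $\kappa(t):=s_0\exp\left(\frac{2(t-t_0)}{\alpha}\right)$ for $t\ge t_0$. Then: (i) If $(Y,X)$ is a trajectory solution of (A), then $(Z,Q)$ defined by $Z(s):=Y(\tau(s))$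 and $Q(s):=\frac{\alpha}{2s}X(\tau(s))$ is a trajectory solution of (B) (with respect to the time-changed filtration and Brownian motion, see context) with initial conditions $Z_0=Y_0$ and $Q_0=\frac{\alpha}{2s_0}X_0$ and diffusion term $$\sigma_Z(s)=(\dot\tau(s))^{3/2}\sigma_Y(\tau(s))=\left(\frac{\alpha}{2s}\right)^{3/2}\sigma_Y(\tau(s)).$$ (ii) If $(Z,Q)$ is a trajectory solution of (B), then $(Y,X)$ defined by $Y(t):=Z(\kappa(t))$ and $X(t):=\frac{2s_0}{\alpha}\exp\left(\frac{2(t-t_0)}{\alpha}\right)Q(\kappa(t))$ is a trajectory solution of (A) (with respect to the time-changed filtration and Brownian motion, see context) with initial conditions $Y_0=Z_0$ and $X_0=\frac{2s_0}{\alpha}Q_0$ and diffusion term $$\sigma_Y(t)=(\dot\kappa(t))^{3/2}\sigma_Z(\kappa(t))=\left(\frac{2s_0}{\alpha}\exp\left(\frac{2(t-t_0)}{\alpha}\right)\right)^{3/2}\sigma_Z(\kappa(t)).$$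
   Context: The systems are defined on a filtered probability space, $W$ is an $\mathcal{H}$-valued Brownian motion on the respective time interval, the diffusion terms $\sigma_Y:[t_0,+\infty)\to\mathcal{L}(\mathcal{H},\mathcal{H})$ and $\sigma_Z:[s_0,+\infty)\to\mathcal{L}(\mathcal{H},\mathcal{H})$ are measurable, and the initial data are elements of $\mathcal{H}$. $V$ monotone means $\langle V(y)-V(x),y-x\rangle\ge 0$ for all $x,y\in\mathcal{H}$. Time change: in (i), if $(Y,X)$ solves (A) with filtration $\{\mathcal{F}_t\}_{t\ge t_0}$ and Brownian motion $W$, then (B) is driven by the Brownian motion $\widetilde W(s)=\int_{t_0}^{\tau(s)}(\dot\kappa(r))^{1/2}dW(r)$, $s\ge s_0$, with filtration $\{\mathcal{F}_{\tau(s)}\}_{s\ge s_0}$ (so that $dW(\tau(s))=(\dot\tau(s))^{1/2}d\widetilde W(s)$). In (ii), symmetrically, if $(Z,Q)$ solves (B) with filtration $\{\mathcal{F}_s\}_{s\ge s_0}$ and Brownian motion $W$, then (A) is driven by $\widetilde W(t)=\int_{s_0}^{\kappa(t)}(\dot\tau(r))^{1/2}dW(r)$, $t\ge t_0$, with filtration $\{\mathcal{F}_{\kappa(t)}\}_{t\ge t_0}$. Trajectory solution of (A): $X(\cdot)$, $Y(\cdot)$ and $V(Y(\cdot))$ are adapted processes, $(Y,X)$ is continuous on $[t_0,+\infty)$ with values in $\mathcal{H}\times\mathcal{H}$, and there is a continuous adapted $\mathcal{H}$-valued process $H(\cdot)$ such that for every $t\ge t_0$ the integrated forms of the three equations of (A)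 on $[t_0,t]$, namely $Y(t)=Y_0+\int_{t_0}^tX(r)dr$, $V(Y(t))=V(Y_0)+\int_{t_0}^tH(r)dr$, and $X(t)=X_0+\int_{t_0}^t(\text{drift of }X)(r)\,dr+\int_{t_0}^t\sigma_Y(r)dW(r)$, hold almost surely. Trajectory solutions of (B) are defined in the same way, with $(Z,Q,K,\sigma_Z,s_0)$ in place of $(Y,X,H,\sigma_Y,t_0)$. *)

theory Defs
  imports "HOL-Probability.Probability"
begin

subsection \<open>Monotone operators and the time changes\<close>

definition monotone_operator :: "('h::real_inner \<Rightarrow> 'h) \<Rightarrow> bool" where
  "monotone_operator V \<longleftrightarrow> (\<forall>x y. 0 \<le> inner (V y - V x) (y - x))"

definition zer :: "('h \<Rightarrow> 'h::zero) \<Rightarrow> 'h set" where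
  "zer V = {y. V y = 0}"

definition tau :: "real \<Rightarrow> real \<Rightarrow> real \<Rightarrow> real \<Rightarrow> real" where
  "tau \<alpha> t0 s0 s = t0 + \<alpha> / 2 * ln (s / s0)"

definition kappa :: "real \<Rightarrow> real \<Rightarrow> real \<Rightarrow> real \<Rightarrow> real" where
  "kappa \<alpha> t0 s0 t = s0 * exp (2 * (t - t0) / \<alpha>)"


subsection \<open>Filtrations and adapted processes on a half-line\<close>

text \<open>
  A process on \<open>[a, \<infinity>)\<close> is a function of type \<^typ>\<open>real \<Rightarrow> 'w \<Rightarrow> 'h\<close> whose values at
  times before \<open>a\<close> are irrelevant; the same convention applies to filtrations. The usual
  conditions on filtrations are not required.
\<close>

definition filtration_on :: "'w measure \<Rightarrow> (real \<Rightarrow> 'w measure) \<Rightarrow> real \<Rightarrow> bool" where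
  "filtration_on M F a \<longleftrightarrow>
     (\<forall>t\<ge>a. subalgebra M (F t)) \<and> (\<forall>s t. a \<le> s \<and> s \<le> t \<longrightarrow> subalgebra (F t) (F s))"

definition adapted :: "(real \<Rightarrow> 'w measure) \<Rightarrow> real \<Rightarrow> (real \<Rightarrow> 'w \<Rightarrow> 'h::topological_space) \<Rightarrow> bool"
  where "adapted F a X \<longleftrightarrow> (\<forall>t\<ge>a. X t \<in> borel_measurable (F t))"

definition continuous_process ::
  "'w measure \<Rightarrow> real \<Rightarrow> (real \<Rightarrow> 'w \<Rightarrow> 'h::topological_space) \<Rightarrow> bool" where
  "continuous_process M a X \<longleftrightarrow> (AE \<omega> in M. continuous_on {a..} (\<lambda>t. X t \<omega>))"


subsection \<open>Hilbert-space-valued Brownian motion\<close>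

text \<open>
  The trace of a nonnegative operator. For an orthonormal basis \<open>(e_k)\<close> the sum of
  \<open>\<langle>T e_k, e_k\<rangle>\<close> does not depend on the basis and equals the supremum of the partial sums over
  all finite orthonormal systems.
\<close>

definition op_trace :: "('h::real_inner \<Rightarrow> 'h) \<Rightarrow> ennreal" where
  "op_trace T =
     (SUP B\<in>{B. finite B \<and> pairwise orthogonal B \<and> (\<forall>b\<in>B. norm b = 1)}.
        \<Sum>b\<in>B. ennreal (inner (T b) b))"

definition covariance_operator :: "('h::real_inner \<Rightarrow>\<^sub>L 'h) \<Rightarrow> bool" where
  "covariance_operator C \<longleftrightarrow>
     (\<forall>x y. inner (blinfun_apply C x) y = inner x (blinfun_apply C y)) \<and>
     (\<forall>x. 0 \<le> inner (blinfun_apply C x) x) \<and>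
     op_trace (blinfun_apply C) < \<infinity>"

text \<open>
  Centred Gaussian law \<open>N(0, C)\<close>: every one-dimensional projection is normal with the variance
  prescribed by \<open>C\<close>, variance \<open>0\<close> meaning the point mass at \<open>0\<close>.
\<close>

definition centred_gaussian ::
  "'w measure \<Rightarrow> ('h::real_inner \<Rightarrow>\<^sub>L 'h) \<Rightarrow> ('w \<Rightarrow> 'h) \<Rightarrow> bool" where
  "centred_gaussian M C \<xi> \<longleftrightarrow>
     \<xi> \<in> borel_measurable M \<and>
     (\<forall>h. if inner (blinfun_apply C h) h = 0
          then (AE \<omega> in M. inner (\<xi> \<omega>) h = 0)
          else distributed M lborel (\<lambda>\<omega>. inner (\<xi> \<omega>) h)
                 (normal_density 0 (sqrt (inner (blinfun_apply C h) h))))"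

text \<open>
  An \<open>H\<close>-valued Brownian motion on \<open>[a, \<infinity>)\<close> with (trace class) covariance operator \<open>C\<close>,
  relative to the filtration \<open>F\<close>. In finite dimension, \<open>C = id\<close> is the standard Brownian motion.
\<close>

definition brownian_motion ::
  "'w measure \<Rightarrow> (real \<Rightarrow> 'w measure) \<Rightarrow> real \<Rightarrow> ('h::real_inner \<Rightarrow>\<^sub>L 'h) \<Rightarrow>
   (real \<Rightarrow> 'w \<Rightarrow> 'h) \<Rightarrow> bool" where
  "brownian_motion M F a C W \<longleftrightarrow>
     covariance_operator C \<and>
     adapted F a W \<and>
     continuous_process M a W \<and>
     (AE \<omega> in M. W a \<omega> = 0) \<and>
     (\<forall>s t. a \<le> s \<and> s \<le> t \<longrightarrow>
        centred_gaussian M ((t - s) *\<^sub>R C) (\<lambda>\<omega>. W t \<omega> - W s \<omega>) \<and>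
        prob_space.indep_set M (sets (F s))
          (sets (vimage_algebra (space M) (\<lambda>\<omega>. W t \<omega> - W s \<omega>) borel)))"


subsection \<open>The stochastic integral\<close>

text \<open>
  The Ito integral over \<open>[a, b]\<close> of an operator-valued integrand with respect to a Brownian
  motion \<open>W\<close> with covariance \<open>C\<close>, as the mean-square limit of the integrals of elementary
  integrands. All integrands that occur are deterministic, and for these the Ito integral is
  already obtained from deterministic elementary integrands.

  Integrands are measured in the norm \<open>\<parallel>A C^(1/2)\<parallel>\<close> (Hilbert-Schmidt), the square of which is
  the trace of \<open>A C A*\<close>; this is the norm occurring in the Ito isometry.
\<close>

definition cov_norm2 :: "('h::real_inner \<Rightarrow>\<^sub>L 'h) \<Rightarrow> ('h \<Rightarrow>\<^sub>L 'h) \<Rightarrow> ennreal" where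
  "cov_norm2 C A =
     op_trace (\<lambda>h. blinfun_apply A (blinfun_apply C (adjoint (blinfun_apply A) h)))"

definition partition_of :: "real \<Rightarrow> real \<Rightarrow> nat \<Rightarrow> (nat \<Rightarrow> real) \<Rightarrow> bool" where
  "partition_of a b n p \<longleftrightarrow> p 0 = a \<and> p n = b \<and> (\<forall>i<n. p i \<le> p (Suc i))"

definition elementary ::
  "nat \<Rightarrow> (nat \<Rightarrow> real) \<Rightarrow> (nat \<Rightarrow> 'h \<Rightarrow>\<^sub>L 'h) \<Rightarrow> real \<Rightarrow> 'h::real_normed_vector \<Rightarrow>\<^sub>L 'h" where
  "elementary n p A r = (\<Sum>i<n. indicator {p i<..p (Suc i)} r *\<^sub>R A i)"

definition elementary_integral ::
  "nat \<Rightarrow> (nat \<Rightarrow> real) \<Rightarrow> (nat \<Rightarrow> 'h \<Rightarrow>\<^sub>L 'h) \<Rightarrow> (real \<Rightarrow> 'w \<Rightarrow> 'h) \<Rightarrow> 'w \<Rightarrow> 'h::real_normed_vector"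
  where
  "elementary_integral n p A W \<omega> = (\<Sum>i<n. blinfun_apply (A i) (W (p (Suc i)) \<omega> - W (p i) \<omega>))"

text \<open>
  The random variable \<open>I\<close> is a version of the integral of \<open>\<sigma>\<close> over \<open>[a, b]\<close>; in particular the
  integral exists. It is determined up to almost sure equality.
\<close>

definition has_stoch_integral ::
  "'w measure \<Rightarrow> ('h::real_inner \<Rightarrow>\<^sub>L 'h) \<Rightarrow> (real \<Rightarrow> 'w \<Rightarrow> 'h) \<Rightarrow> (real \<Rightarrow> 'h \<Rightarrow>\<^sub>L 'h) \<Rightarrow>
   real \<Rightarrow> real \<Rightarrow> ('w \<Rightarrow> 'h) \<Rightarrow> bool" where
  "has_stoch_integral M C W \<sigma> a b I \<longleftrightarrow>
     I \<in> borel_measurable M \<and>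
     (\<exists>n p A. (\<forall>k. partition_of a b (n k) (p k)) \<and>
        (\<lambda>k. \<integral>\<^sup>+ r\<in>{a..b}. cov_norm2 C (\<sigma> r - elementary (n k) (p k) (A k) r) \<partial>lborel)
          \<longlonglongrightarrow> 0 \<and>
        (\<lambda>k. \<integral>\<^sup>+ \<omega>. ennreal ((norm (I \<omega> - elementary_integral (n k) (p k) (A k) W \<omega>))\<^sup>2) \<partial>M)
          \<longlonglongrightarrow> 0)"

text \<open>The integral as a process in its upper limit: a continuous adapted version.\<close>

definition stoch_integral_process ::
  "'w measure \<Rightarrow> (real \<Rightarrow> 'w measure) \<Rightarrow> real \<Rightarrow> ('h::real_inner \<Rightarrow>\<^sub>L 'h) \<Rightarrow>
   (real \<Rightarrow> 'w \<Rightarrow> 'h) \<Rightarrow> (real \<Rightarrow> 'h \<Rightarrow>\<^sub>L 'h) \<Rightarrow> (real \<Rightarrow> 'w \<Rightarrow> 'h) \<Rightarrow> bool" where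
  "stoch_integral_process M F a C W \<sigma> J \<longleftrightarrow>
     adapted F a J \<and> continuous_process M a J \<and>
     (\<forall>t\<ge>a. has_stoch_integral M C W \<sigma> a t (J t))"


subsection \<open>Trajectory solutions\<close>

text \<open>
  Systems of the common form
  \<open>dY = X dt\<close>, \<open>dV(Y) = H dt\<close>, \<open>dX = drift(t, X, H, V(Y)) dt + \<sigma> dW\<close> on \<open>[a, \<infinity>)\<close>
  with \<open>Y(a) = Y0\<close> and \<open>X(a) = X0\<close>. The pathwise integrals have almost surely continuous
  integrands.
\<close>

definition trajectory_solution ::
  "'w measure \<Rightarrow> (real \<Rightarrow> 'w measure) \<Rightarrow> real \<Rightarrow>
   ('h::{real_inner, polish_space} \<Rightarrow>\<^sub>L 'h) \<Rightarrow> (real \<Rightarrow> 'w \<Rightarrow> 'h) \<Rightarrow>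
   (real \<Rightarrow> 'h \<Rightarrow>\<^sub>L 'h) \<Rightarrow> ('h \<Rightarrow> 'h) \<Rightarrow> (real \<Rightarrow> 'h \<Rightarrow> 'h \<Rightarrow> 'h \<Rightarrow> 'h) \<Rightarrow> 'h \<Rightarrow> 'h \<Rightarrow>
   (real \<Rightarrow> 'w \<Rightarrow> 'h) \<Rightarrow> (real \<Rightarrow> 'w \<Rightarrow> 'h) \<Rightarrow> bool" where
  "trajectory_solution M F a C W \<sigma> V drift Y0 X0 Y X \<longleftrightarrow>
     prob_space M \<and> filtration_on M F a \<and> brownian_motion M F a C W \<and>
     \<sigma> \<in> borel_measurable (restrict_space borel {a..}) \<and>
     adapted F a X \<and> adapted F a Y \<and> adapted F a (\<lambda>t \<omega>. V (Y t \<omega>)) \<and>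
     continuous_process M a (\<lambda>t \<omega>. (Y t \<omega>, X t \<omega>)) \<and>
     (\<exists>H. adapted F a H \<and> continuous_process M a H \<and>
        (\<forall>t\<ge>a.
           (AE \<omega> in M. Y t \<omega> = Y0 + integral {a..t} (\<lambda>r. X r \<omega>)) \<and>
           (AE \<omega> in M. V (Y t \<omega>) = V Y0 + integral {a..t} (\<lambda>r. H r \<omega>)) \<and>
           (\<exists>I. has_stoch_integral M C W \<sigma> a t I \<and>
              (AE \<omega> in M. X t \<omega> =
                 X0 + integral {a..t} (\<lambda>r. drift r (X r \<omega>) (H r \<omega>) (V (Y r \<omega>))) + I \<omega>))))"

definition drift_A ::
  "real \<Rightarrow> real \<Rightarrow> real \<Rightarrow> real \<Rightarrow> real \<Rightarrow> 'h \<Rightarrow> 'h \<Rightarrow> 'h \<Rightarrow> 'h::real_vector" where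
  "drift_A \<alpha> \<beta> t0 s0 t x h v =
     - (2 * (\<alpha> - 1) / \<alpha>) *\<^sub>R x
     - (2 * \<beta> * s0 / \<alpha> * exp (2 * (t - t0) / \<alpha>)) *\<^sub>R h
     - (2 * \<beta> * s0 / \<alpha> * exp (2 * (t - t0) / \<alpha>)) *\<^sub>R v"

definition drift_B :: "real \<Rightarrow> real \<Rightarrow> real \<Rightarrow> 'h \<Rightarrow> 'h \<Rightarrow> 'h \<Rightarrow> 'h::real_vector" where
  "drift_B \<alpha> \<beta> s q k v =
     - (\<alpha> / s) *\<^sub>R q - \<beta> *\<^sub>R k - (\<alpha> * \<beta> / (2 * s)) *\<^sub>R v"

definition solution_A ::
  "real \<Rightarrow> real \<Rightarrow> real \<Rightarrow> real \<Rightarrow> ('h \<Rightarrow> 'h) \<Rightarrow>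
   'w measure \<Rightarrow> (real \<Rightarrow> 'w measure) \<Rightarrow> ('h::{real_inner, polish_space} \<Rightarrow>\<^sub>L 'h) \<Rightarrow>
   (real \<Rightarrow> 'w \<Rightarrow> 'h) \<Rightarrow> (real \<Rightarrow> 'h \<Rightarrow>\<^sub>L 'h) \<Rightarrow> 'h \<Rightarrow> 'h \<Rightarrow>
   (real \<Rightarrow> 'w \<Rightarrow> 'h) \<Rightarrow> (real \<Rightarrow> 'w \<Rightarrow> 'h) \<Rightarrow> bool" where
  "solution_A \<alpha> \<beta> t0 s0 V M F C W \<sigma>Y Y0 X0 Y X \<longleftrightarrow>
     trajectory_solution M F t0 C W \<sigma>Y V (drift_A \<alpha> \<beta> t0 s0) Y0 X0 Y X"

definition solution_B ::
  "real \<Rightarrow> real \<Rightarrow> real \<Rightarrow> ('h \<Rightarrow> 'h) \<Rightarrow>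
   'w measure \<Rightarrow> (real \<Rightarrow> 'w measure) \<Rightarrow> ('h::{real_inner, polish_space} \<Rightarrow>\<^sub>L 'h) \<Rightarrow>
   (real \<Rightarrow> 'w \<Rightarrow> 'h) \<Rightarrow> (real \<Rightarrow> 'h \<Rightarrow>\<^sub>L 'h) \<Rightarrow> 'h \<Rightarrow> 'h \<Rightarrow>
   (real \<Rightarrow> 'w \<Rightarrow> 'h) \<Rightarrow> (real \<Rightarrow> 'w \<Rightarrow> 'h) \<Rightarrow> bool" where
  "solution_B \<alpha> \<beta> s0 V M F C W \<sigma>Z Z0 Q0 Z Q \<longleftrightarrow>
     trajectory_solution M F s0 C W \<sigma>Z V (drift_B \<alpha> \<beta>) Z0 Q0 Z Q"

text \<open>
  The integral over \<open>[a, \<cdot>]\<close> of \<open>(\<rho>')^(1/2)\<close> with respect to \<open>W\<close>; evaluated at the inverse of the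
  time change \<open>\<rho>\<close> it is the Brownian motion driving the time-changed system.
\<close>

definition driving_integral ::
  "'w measure \<Rightarrow> (real \<Rightarrow> 'w measure) \<Rightarrow> real \<Rightarrow> ('h::real_inner \<Rightarrow>\<^sub>L 'h) \<Rightarrow>
   (real \<Rightarrow> 'w \<Rightarrow> 'h) \<Rightarrow> (real \<Rightarrow> real) \<Rightarrow> (real \<Rightarrow> 'w \<Rightarrow> 'h) \<Rightarrow> bool" where
  "driving_integral M F a C W \<rho> J \<longleftrightarrow>
     stoch_integral_process M F a C W (\<lambda>r. (deriv \<rho> r powr (1/2)) *\<^sub>R id_blinfun) J"

end

theory Submission
  imports Defs
begin

text \<open>
  Pathwise, the drift terms transform by the chain rule and by differentiating the factor
  \<open>\<eta>'(s)\<close> in \<open>Q(s) = \<eta>'(s) X(\<eta>(s))\<close>, where \<open>\<eta>\<close> is the time change and \<open>\<rho>\<close> its inverse; with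
  \<open>\<psi> = (\<eta>')\<^sup>\<half>\<close> and \<open>\<phi> = (\<rho>')\<^sup>\<half>\<close>, all stochastic integrals that occur reduce to two facts.
  First, for a \<open>C\<^sup>1\<close> function \<open>f\<close> the integral of \<open>f \<sigma>\<close> is almost surely \<open>f(t) I(t) - \<integral> f' I dr\<close>,
  where \<open>I\<close> is a continuous version of the integral of \<open>\<sigma>\<close>: the Riemann-Stieltjes sums of \<open>f\<close> against
  \<open>I\<close> are integrals of \<open>f\<^sub>n \<sigma>\<close> with \<open>f\<^sub>n \<rightarrow> f\<close> uniformly, hence Cauchy in mean square, and they
  converge pathwise. Applied to \<open>\<phi>\<close> and \<open>W\<close> this gives the integral \<open>J\<close> of \<open>\<phi>\<close>; the approximating sums
  are Gaussian and independent of the past, so \<open>J(\<eta>(s))\<close> is a Brownian motion. Second, the integral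
  of \<open>\<sigma>\<close> against \<open>W\<close> equals the integral of \<open>\<psi> (\<sigma> \<circ> \<eta>)\<close> against \<open>J \<circ> \<eta>\<close>: for steps this is
  integration by parts applied twice, and in general both sides are isometric.
\<close>

section \<open>Hilbert space preliminaries\<close>

text \<open>The definition of the integral fixes it only up to a null set that depends on the time,
  whereas integration by parts needs whole paths. Continuous versions must therefore come from
  elsewhere: for the integral of \<open>\<phi>\<close> it is an explicit functional of the path of
  \<open>W\<close>, and for a solution it is read off from the equation, as \<open>X\<close> minus
  its initial value and its drift integral. Integrating by parts twice returns \<open>W\<close>
  because the clocks are inverse, so that \<open>\<psi> s * \<phi> (\<eta> s) = 1\<close>. The
  exponent 3/2 of the diffusion term is 1, from the factor \<eta>' in \<open>Q\<close>, plus 1/2,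
  from dW(\<eta>) = \<psi> dJ(\<eta>). Both directions of the theorem are one statement about a pair
  of inverse clocks, used once for each order of the pair. The isometry serves only to control
  limits, so bounds up to a constant suffice; squared norms with factors 2 and 4 take the place of
  norms and the triangle inequality.\<close>

lemma riesz_representation:
  fixes f :: "'h::{real_inner, complete_space} \<Rightarrow> real"
  assumes f: "bounded_linear f"
  shows "\<exists>y. \<forall>x. f x = inner x y"
proof -
  interpret f: bounded_linear f by fact
  obtain K where K: "\<And>x. \<bar>f x\<bar> \<le> K * norm x"
    using f.bounded by (metis mult.commute real_norm_def)
  \<comment> \<open>The representing vector will be the minimiser of this functional, whose gradient
    at a point is that point minus the vector sought.\<close>
  define \<phi> where "\<phi> x = (norm x)\<^sup>2 / 2 - f x" for x
  have lower: "- (K\<^sup>2 / 2) \<le> \<phi> x" for x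
  proof -
    have "0 \<le> (norm x - K)\<^sup>2" by simp
    then have "2 * (K * norm x) \<le> (norm x)\<^sup>2 + K\<^sup>2"
      by (simp add: power2_diff algebra_simps)
    then show ?thesis using K[of x] unfolding \<phi>_def by (simp add: field_simps abs_le_iff)
  qed
  then have bdd: "bdd_below (range \<phi>)" by (auto intro!: bdd_belowI)
  define m where "m = Inf (range \<phi>)"
  have m_le: "m \<le> \<phi> x" for x
    unfolding m_def using bdd by (intro cInf_lower) auto
  have "\<exists>x. \<phi> x < m + inverse (real (Suc n))" for n
    using cInf_lessD[of "range \<phi>" "m + inverse (real (Suc n))"] unfolding m_def by auto
  then obtain X where X: "\<And>n. \<phi> (X n) < m + inverse (real (Suc n))" by metis
  \<comment> \<open>The parallelogram law: the midpoint cannot fall below the infimum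
    \<open>m\<close>, so two near-minimisers are close to each other and a minimising sequence is
    Cauchy.\<close>
  have par: "(norm (x - y))\<^sup>2 / 4 = \<phi> x + \<phi> y - 2 * \<phi> ((1/2) *\<^sub>R (x + y))" for x y
    unfolding \<phi>_def f.scaleR f.add
    by (simp add: power2_norm_eq_inner inner_simps inner_commute field_simps)
  have close: "(norm (X n - X k))\<^sup>2 \<le> 4 * (inverse (real (Suc n)) + inverse (real (Suc k)))" for n k
    using par[of "X n" "X k"] X[of n] X[of k] m_le[of "(1/2) *\<^sub>R (X n + X k)"] by argo
  have "Cauchy X"
  proof (rule metric_CauchyI)
    fix e :: real assume e: "0 < e"
    then obtain N where N: "inverse (real (Suc N)) < e\<^sup>2 / 8"
      using reals_Archimedean[of "e\<^sup>2 / 8"] by auto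
    show "\<exists>N. \<forall>n\<ge>N. \<forall>k\<ge>N. dist (X n) (X k) < e"
    proof (intro exI allI impI)
      fix n k assume "N \<le> n" "N \<le> k"
      then have "inverse (real (Suc n)) \<le> inverse (real (Suc N))"
        "inverse (real (Suc k)) \<le> inverse (real (Suc N))"
        by (auto intro!: le_imp_inverse_le)
      then have "(norm (X n - X k))\<^sup>2 < e\<^sup>2"
        using close[of n k] N by argo
      then show "dist (X n) (X k) < e"
        using e by (simp add: dist_norm power_less_imp_less_base)
    qed
  qed
  then obtain y where y: "X \<longlonglongrightarrow> y"
    using Cauchy_convergent convergent_def by blast
  have "(\<lambda>n. \<phi> (X n)) \<longlonglongrightarrow> \<phi> y"
    unfolding \<phi>_def by (intro tendsto_intros f.tendsto y) simp
  moreover have "(\<lambda>n. m + inverse (real (Suc n))) \<longlonglongrightarrow> m + 0"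
    by (intro tendsto_intros LIMSEQ_inverse_real_of_nat)
  ultimately have "\<phi> y \<le> m + 0"
    by (rule LIMSEQ_le) (use X less_imp_le in blast)
  then have min: "\<phi> y \<le> \<phi> z" for z using m_le[of z] by simp
  have "f x = inner x y" for x
  proof (rule ccontr)
    assume ne: "f x \<noteq> inner x y"
    define d where "d = f x - inner x y"
    have d: "d \<noteq> 0" using ne d_def by simp
    have quad: "t * d \<le> t\<^sup>2 * (norm x)\<^sup>2 / 2" for t :: real
    proof -
      have "(norm (y + t *\<^sub>R x))\<^sup>2 = (norm y)\<^sup>2 + 2 * t * inner x y + t\<^sup>2 * (norm x)\<^sup>2"
        unfolding power2_norm_eq_inner
        by (simp add: inner_simps inner_commute power2_eq_square algebra_simps)
      then show ?thesis
        using min[of "y + t *\<^sub>R x"] unfolding \<phi>_def d_def f.add f.scaleR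
        by (simp add: field_simps)
    qed
    \<comment> \<open>A perturbation of \<open>y\<close> along \<open>x\<close> that would lower the
      functional if \<open>d\<close> were nonzero. The summand 1 keeps the denominator positive for
      \<open>x = 0\<close> and leaves the surplus \<open>t\<^sup>2\<close> that gives the
      contradiction.\<close>
    define t where "t = d / ((norm x)\<^sup>2 + 1)"
    have pos: "(norm x)\<^sup>2 + 1 > 0" by (simp add: add_nonneg_pos)
    have td: "t * ((norm x)\<^sup>2 + 1) = d" using pos by (simp add: t_def)
    have "t \<noteq> 0" using d pos by (simp add: t_def)
    then have "t\<^sup>2 > 0" by simp
    have "t * d = t\<^sup>2 * (norm x)\<^sup>2 + t\<^sup>2"
      by (subst td[symmetric]) (simp add: power2_eq_square algebra_simps)
    then have "t\<^sup>2 * (norm x)\<^sup>2 / 2 + t\<^sup>2 \<le> 0" using quad[of t] by argo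
    moreover have "0 \<le> t\<^sup>2 * (norm x)\<^sup>2 / 2" by simp
    ultimately show False using \<open>t\<^sup>2 > 0\<close> by linarith
  qed
  then show ?thesis by blast
qed

definition adj :: "('h::real_inner \<Rightarrow>\<^sub>L 'h) \<Rightarrow> 'h \<Rightarrow> 'h" where
  "adj A = adjoint (blinfun_apply A)"

text \<open>\<open>adjoint\<close> is a choice among the functions with this property. Riesz
  representation, applied to each \<open>y\<close>, shows that there is one, and uniqueness
  identifies it with the chosen one.\<close>

lemma inner_adj:
  fixes A :: "'h::{real_inner, complete_space} \<Rightarrow>\<^sub>L 'h"
  shows "inner (blinfun_apply A x) y = inner x (adj A y)"
proof -
  have "\<exists>w. \<forall>x. inner (blinfun_apply A x) y = inner x w" for y
    by (rule riesz_representation)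
      (intro bounded_linear_compose[OF bounded_linear_inner_left] blinfun.bounded_linear_right)
  then obtain g where g: "\<forall>x y. inner (blinfun_apply A x) y = inner x (g y)" by metis
  show ?thesis using g adjoint_unique[OF g] unfolding adj_def by simp
qed

lemma inner_eqI: "(\<And>z. inner z x = inner z y) \<Longrightarrow> x = y" for x y :: "'h::real_inner"
  by (metis inner_diff_right inner_eq_zero_iff right_minus_eq)

lemma adj_add: "adj (A + B) y = adj A y + adj B y"
  for A B :: "'h::{real_inner, complete_space} \<Rightarrow>\<^sub>L 'h"
  by (rule inner_eqI) (simp add: inner_adj[symmetric] blinfun.bilinear_simps inner_simps)

lemma adj_scaleR: "adj (c *\<^sub>R A) y = c *\<^sub>R adj A y"
  for A :: "'h::{real_inner, complete_space} \<Rightarrow>\<^sub>L 'h"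
  by (rule inner_eqI) (simp add: inner_adj[symmetric] blinfun.bilinear_simps inner_simps)

lemma adj_zero [simp]: "adj 0 y = 0" for y :: "'h::{real_inner, complete_space}"
  by (rule inner_eqI) (simp add: inner_adj[symmetric])

lemma adj_id [simp]: "adj id_blinfun y = y" for y :: "'h::{real_inner, complete_space}"
  by (rule inner_eqI) (simp add: inner_adj[symmetric])

lemma norm_adj_le: "norm (adj A y) \<le> norm A * norm y"
  for A :: "'h::{real_inner, complete_space} \<Rightarrow>\<^sub>L 'h"
proof (cases "adj A y = 0")
  case False
  have "(norm (adj A y))\<^sup>2 = inner (blinfun_apply A (adj A y)) y"
    by (simp add: inner_adj power2_norm_eq_inner)
  also have "\<dots> \<le> norm (blinfun_apply A (adj A y)) * norm y"
    by (rule norm_cauchy_schwarz)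
  also have "\<dots> \<le> norm A * norm (adj A y) * norm y"
    by (intro mult_right_mono norm_blinfun) auto
  finally show ?thesis using False by (simp add: power2_eq_square mult_ac)
qed simp

lemma bounded_linear_adj: "bounded_linear (\<lambda>A. adj A y)"
  for y :: "'h::{real_inner, complete_space}"
  by (rule bounded_linear_intro[of _ "norm y"]) (simp_all add: adj_add adj_scaleR norm_adj_le)

section \<open>Finite orthonormal systems\<close>

definition orthonormal :: "'h::real_inner set \<Rightarrow> bool" where
  "orthonormal B \<longleftrightarrow> finite B \<and> pairwise orthogonal B \<and> (\<forall>b\<in>B. norm b = 1)"

lemma sum_inner_orthonormal:
  assumes "orthonormal B" "b \<in> B"
  shows "inner (\<Sum>c\<in>B. g c *\<^sub>R c) b = g b"
proof -
  have "inner (\<Sum>c\<in>B. g c *\<^sub>R c) b = (\<Sum>c\<in>B. g c * inner c b)" by (simp add: inner_sum_left)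
  also have "\<dots> = (\<Sum>c\<in>B. if c = b then g b else 0)"
    using assms
    by (intro sum.cong) (auto simp: orthonormal_def pairwise_def orthogonal_def norm_eq_1)
  finally show ?thesis using assms by (simp add: orthonormal_def)
qed

lemma norm_minus_projection:
  assumes "orthonormal B"
  shows "(norm (x - (\<Sum>b\<in>B. inner x b *\<^sub>R b)))\<^sup>2 = (norm x)\<^sup>2 - (\<Sum>b\<in>B. (inner x b)\<^sup>2)"
proof -
  define p where "p = (\<Sum>b\<in>B. inner x b *\<^sub>R b)"
  have 1: "inner x p = (\<Sum>b\<in>B. (inner x b)\<^sup>2)"
    unfolding p_def by (simp add: inner_sum_right power2_eq_square)
  have "inner p p = (\<Sum>b\<in>B. inner x b * inner p b)"
    by (subst (2) p_def) (simp add: inner_sum_right)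
  also have "\<dots> = (\<Sum>b\<in>B. (inner x b)\<^sup>2)"
    using sum_inner_orthonormal[OF assms, of _ "\<lambda>b. inner x b"]
    by (intro sum.cong) (auto simp: p_def power2_eq_square)
  finally show ?thesis
    unfolding p_def[symmetric] using 1
    by (simp add: power2_norm_eq_inner inner_simps inner_commute)
qed

lemma bessel: "orthonormal B \<Longrightarrow> (\<Sum>b\<in>B. (inner x b)\<^sup>2) \<le> (norm x)\<^sup>2"
  using norm_minus_projection[of B x] by (metis diff_ge_0_iff_ge zero_le_power2)

text \<open>Membership in the span is expressed by the expansion itself, the form in which it is
  used. Linear dependence is harmless: a vector with zero residual adds nothing to the
  system.\<close>

lemma gram_schmidt:
  fixes D :: "'h::real_inner set"
  assumes "finite D"
  shows "\<exists>B. orthonormal B \<and> (\<forall>d\<in>D. d = (\<Sum>b\<in>B. inner d b *\<^sub>R b))"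
  using assms
proof (induction D)
  case empty
  then show ?case by (intro exI[of _ "{}"]) (simp add: orthonormal_def)
next
  case (insert x D)
  then obtain B where B: "orthonormal B" "\<And>d. d \<in> D \<Longrightarrow> d = (\<Sum>b\<in>B. inner d b *\<^sub>R b)" by blast
  define r where "r = x - (\<Sum>b\<in>B. inner x b *\<^sub>R b)"
  show ?case
  proof (cases "r = 0")
    case True
    then show ?thesis using B by (intro exI[of _ B]) (auto simp: r_def)
  next
    case False
    define e where "e = (1 / norm r) *\<^sub>R r"
    have rb: "inner r b = 0" if "b \<in> B" for b
      using sum_inner_orthonormal[OF B(1) that, of "\<lambda>b. inner x b"] by (simp add: r_def inner_simps)
    then have eb: "inner e b = 0" if "b \<in> B" for b using that by (simp add: e_def)
    have e1: "norm e = 1" using False by (simp add: e_def)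
    have eB: "e \<notin> B" using eb[of e] e1 by (auto simp: norm_eq_1)
    have ortho: "orthonormal (insert e B)"
      using B(1) eb e1
      by (auto simp: orthonormal_def pairwise_insert orthogonal_def inner_commute)
    have Bfin: "finite B" using B(1) by (simp add: orthonormal_def)
    have De: "inner d e = 0" if "d \<in> D" for d
      by (subst B(2)[OF that]) (simp add: inner_sum_left inner_commute[of _ e] inner_sum_right eb)
    have "inner r e = norm r"
      using False by (simp add: e_def power2_norm_eq_inner[symmetric] power2_eq_square)
    moreover have "inner (\<Sum>b\<in>B. inner x b *\<^sub>R b) e = 0"
      by (simp add: inner_sum_right eb inner_commute[of _ e])
    ultimately have "inner x e = norm r" by (simp add: r_def inner_simps)
    then have "inner x e *\<^sub>R e = r" using False by (simp add: e_def)
    then have "x = (\<Sum>b\<in>insert e B. inner x b *\<^sub>R b)"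
      using eB Bfin by (simp add: r_def algebra_simps)
    moreover have "d = (\<Sum>b\<in>insert e B. inner d b *\<^sub>R b)" if "d \<in> D" for d
      using eB Bfin De[OF that] B(2)[OF that] by simp
    ultimately show ?thesis using ortho by (intro exI[of _ "insert e B"]) blast
  qed
qed

text \<open>Stands in for an orthonormal basis: the span of \<open>B n\<close> contains the first
  members of a countable dense sequence. The systems need not be nested, as only the limit of the
  Parseval sums matters.\<close>

lemma orthonormal_exhaustion:
  obtains B :: "nat \<Rightarrow> 'h::{real_inner, second_countable_topology} set"
  where "\<And>n. orthonormal (B n)"
    "\<And>x. (\<lambda>n. \<Sum>b\<in>B n. (inner x b)\<^sup>2) \<longlonglongrightarrow> (norm x)\<^sup>2"
proof -
  obtain D :: "'h set" where D: "countable D" "\<And>X. open X \<Longrightarrow> X \<noteq> {} \<Longrightarrow> \<exists>d\<in>D. d \<in> X"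
    using countable_dense_setE by blast
  have "D \<noteq> {}" using D(2)[of UNIV] by auto
  define d where "d = from_nat_into D"
  have d: "range d = D" unfolding d_def using D(1) \<open>D \<noteq> {}\<close> by (rule range_from_nat_into[rotated])
  have "\<exists>B. orthonormal B \<and> (\<forall>x\<in>d ` {..n}. x = (\<Sum>b\<in>B. inner x b *\<^sub>R b))" for n
    by (rule gram_schmidt) simp
  then obtain B where B: "\<And>n. orthonormal (B n)"
    "\<And>n k. k \<le> n \<Longrightarrow> d k = (\<Sum>b\<in>B n. inner (d k) b *\<^sub>R b)"
    by (metis atMost_iff imageI)
  have "(\<lambda>n. \<Sum>b\<in>B n. (inner x b)\<^sup>2) \<longlonglongrightarrow> (norm x)\<^sup>2" for x
  proof (rule LIMSEQ_I)
    fix e :: real assume e: "0 < e"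
    have "ball x (sqrt e) \<noteq> {}" "open (ball x (sqrt e))" using e by auto
    then obtain y where y: "y \<in> D" "y \<in> ball x (sqrt e)" using D(2) by blast
    then obtain k where k: "y = d k" using d by blast
    show "\<exists>N. \<forall>n\<ge>N. norm ((\<Sum>b\<in>B n. (inner x b)\<^sup>2) - (norm x)\<^sup>2) < e"
    proof (intro exI allI impI)
      fix n assume n: "k \<le> n"
      \<comment> \<open>\<open>y\<close> equals its own projection, so subtracting it does not
        change the residual of \<open>x\<close>.\<close>
      have *: "x - (\<Sum>b\<in>B n. inner x b *\<^sub>R b) = (x - y) - (\<Sum>b\<in>B n. inner (x - y) b *\<^sub>R b)"
        using B(2)[OF n] k by (simp add: inner_diff_left scaleR_diff_left sum_subtractf)
      have "(norm x)\<^sup>2 - (\<Sum>b\<in>B n. (inner x b)\<^sup>2) = (norm (x - y))\<^sup>2 - (\<Sum>b\<in>B n. (inner (x - y) b)\<^sup>2)"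
        using norm_minus_projection[OF B(1), of x n] norm_minus_projection[OF B(1), of "x - y" n] *
        by simp
      also have "\<dots> \<le> (norm (x - y))\<^sup>2" by (simp add: sum_nonneg)
      also have "\<dots> < e"
      proof -
        have "norm (x - y) < sqrt e" using y by (simp add: dist_norm)
        then have "(norm (x - y))\<^sup>2 < (sqrt e)\<^sup>2" by (intro power_strict_mono) auto
        then show ?thesis using e by simp
      qed
      finally show "norm ((\<Sum>b\<in>B n. (inner x b)\<^sup>2) - (norm x)\<^sup>2) < e"
        using bessel[OF B(1), of x n] by simp
    qed
  qed
  with B(1) show ?thesis using that by blast
qed

subsection \<open>The covariance norm\<close>

text \<open>With the operator moved to the adjoint side, each summand is the quadratic form of
  \<open>C\<close> at \<open>adj A b\<close>. It is continuous in \<open>A\<close>, and it is the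
  variance per unit time of the coordinate \<open>b\<close> of \<open>A\<close> applied to the
  noise.\<close>

lemma cov_norm2_eq:
  fixes A :: "'h::{real_inner, complete_space} \<Rightarrow>\<^sub>L 'h"
  shows "cov_norm2 C A = (SUP B\<in>{B. orthonormal B}.
    \<Sum>b\<in>B. ennreal (inner (blinfun_apply C (adj A b)) (adj A b)))"
  unfolding cov_norm2_def op_trace_def orthonormal_def inner_adj adj_def ..

lemma cov_norm2_id: "cov_norm2 C id_blinfun = op_trace (blinfun_apply C)"
  for C :: "'h::{real_inner, complete_space} \<Rightarrow>\<^sub>L 'h"
  unfolding cov_norm2_eq op_trace_def orthonormal_def by simp

lemma cov_norm2_0 [simp]: "cov_norm2 C 0 = 0"
  for C :: "'h::{real_inner, complete_space} \<Rightarrow>\<^sub>L 'h"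
proof -
  have "orthonormal ({} :: 'h set)" by (simp add: orthonormal_def)
  then have "{B::'h set. orthonormal B} \<noteq> {}" by blast
  then show ?thesis unfolding cov_norm2_eq by simp
qed

lemma cov_norm2_scaleR: "cov_norm2 C (c *\<^sub>R A) = ennreal (c\<^sup>2) * cov_norm2 C A"
  for A :: "'h::{real_inner, complete_space} \<Rightarrow>\<^sub>L 'h"
proof -
  have *: "ennreal (inner (blinfun_apply C (adj (c *\<^sub>R A) b)) (adj (c *\<^sub>R A) b)) =
     ennreal (c\<^sup>2) * ennreal (inner (blinfun_apply C (adj A b)) (adj A b))" for b
    by (simp add: adj_scaleR blinfun.scaleR_right power2_eq_square ennreal_mult'[symmetric] mult_ac)
  show ?thesis unfolding cov_norm2_eq * sum_distrib_left[symmetric]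
    by (rule SUP_mult_left_ennreal[symmetric])
qed

lemma cov_norm2_minus: "cov_norm2 C (- A) = cov_norm2 C A"
  for A :: "'h::{real_inner, complete_space} \<Rightarrow>\<^sub>L 'h"
  using cov_norm2_scaleR[of C "-1" A] by simp

lemma cov_norm2_diff_commute: "cov_norm2 C (A - B) = cov_norm2 C (B - A)"
  for A :: "'h::{real_inner, complete_space} \<Rightarrow>\<^sub>L 'h"
  using cov_norm2_minus[of C "A - B"] by simp

text \<open>The parallelogram identity for the quadratic form of \<open>C\<close>, with the
  nonnegative term of the difference dropped. No square root is taken, which keeps the estimate in
  \<open>ennreal\<close>.\<close>

lemma cov_norm2_add_le:
  fixes A B :: "'h::{real_inner, complete_space} \<Rightarrow>\<^sub>L 'h"
  assumes C: "covariance_operator C"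
  shows "cov_norm2 C (A + B) \<le> 2 * cov_norm2 C A + 2 * cov_norm2 C B"
proof -
  define q where "q x = inner (blinfun_apply C x) x" for x
  have q0: "0 \<le> q x" for x using C unfolding covariance_operator_def q_def by blast
  have par: "q (x + y) + q (x - y) = 2 * q x + 2 * q y" for x y
    unfolding q_def by (simp add: blinfun.bilinear_simps inner_simps)
  have q: "ennreal (q (x + y)) \<le> 2 * ennreal (q x) + 2 * ennreal (q y)" for x y
  proof -
    have "q (x + y) \<le> 2 * q x + 2 * q y" using par[of x y] q0[of "x - y"] by argo
    then have "ennreal (q (x + y)) \<le> ennreal (2 * q x + 2 * q y)" by (rule ennreal_leI)
    then show ?thesis using q0 by (simp add: ennreal_plus ennreal_mult')
  qed
  show ?thesis unfolding cov_norm2_eq[of C "A + B"]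
  proof (rule SUP_least)
    fix F :: "'h set" assume F: "F \<in> {B. orthonormal B}"
    have "(\<Sum>b\<in>F. ennreal (q (adj (A + B) b)))
        \<le> (\<Sum>b\<in>F. 2 * ennreal (q (adj A b)) + 2 * ennreal (q (adj B b)))"
      unfolding adj_add by (intro sum_mono q)
    also have "\<dots> = 2 * (\<Sum>b\<in>F. ennreal (q (adj A b))) + 2 * (\<Sum>b\<in>F. ennreal (q (adj B b)))"
      by (simp add: sum.distrib sum_distrib_left)
    also have "\<dots> \<le> 2 * cov_norm2 C A + 2 * cov_norm2 C B"
      unfolding cov_norm2_eq q_def
      by (intro add_mono mult_left_mono SUP_upper F) auto
    finally show "(\<Sum>b\<in>F. ennreal (inner (blinfun_apply C (adj (A + B) b)) (adj (A + B) b)))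
      \<le> 2 * cov_norm2 C A + 2 * cov_norm2 C B" by (simp add: q_def)
  qed
qed

text \<open>The supremum runs over uncountably many systems, so countable operations do not reach
  it. Its terms are continuous in \<open>A\<close>, which makes it lower semicontinuous: the
  superlevel sets are unions of open sets.\<close>

lemma borel_measurable_cov_norm2 [measurable]:
  fixes C :: "'h::{real_inner, complete_space} \<Rightarrow>\<^sub>L 'h"
  shows "cov_norm2 C \<in> borel_measurable borel"
proof (rule borel_measurableI_greater)
  fix y
  define f where "f B A = (\<Sum>b\<in>B. ennreal (inner (blinfun_apply C (adj A b)) (adj A b)))"
    for B and A :: "'h \<Rightarrow>\<^sub>L 'h"
  have "continuous_on UNIV (f B)" for B
    unfolding f_def
    by (intro continuous_intros continuous_on_ennreal bounded_linear.continuous_on[OF bounded_linear_adj])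
  then have "open {A. y < f B A}" for B
    by (auto intro!: open_Collect_less)
  then have "open (\<Union>B\<in>{B. orthonormal B}. {A. y < f B A})" by blast
  moreover have "{A\<in>space borel. y < cov_norm2 C A} = (\<Union>B\<in>{B. orthonormal B}. {A. y < f B A})"
    unfolding cov_norm2_eq f_def by (auto simp: less_SUP_iff)
  ultimately show "{A\<in>space borel. y < cov_norm2 C A} \<in> sets borel" by simp
qed

text \<open>
  The codomain need not be separable (it will be the space of operators), so measurability of
  the pair does not follow from that of its components in general; it does here because \<open>c\<close>
  takes values in a second countable space.
\<close>

lemma borel_measurable_scaleR_second_countable:
  fixes c :: "'a \<Rightarrow> real" and G :: "'a \<Rightarrow> 'b::real_normed_vector"
  assumes [measurable]: "c \<in> borel_measurable M" "G \<in> borel_measurable M"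
  shows "(\<lambda>x. c x *\<^sub>R G x) \<in> borel_measurable M"
proof (rule borel_measurableI)
  fix S :: "'b set" assume S: "open S"
  obtain B :: "real set set" where B: "countable B" "topological_basis B"
    using ex_countable_basis by blast
  define U where "U b = \<Union>{V. open V \<and> (\<forall>r\<in>b. \<forall>v\<in>V. r *\<^sub>R v \<in> S)}" for b :: "real set"
  have U: "open (U b)" for b unfolding U_def by auto
  have bo: "open b" if "b \<in> B" for b using that B(2) topological_basis_open by blast
  have "(\<lambda>x. c x *\<^sub>R G x) -` S \<inter> space M = (\<Union>b\<in>B. (c -` b \<inter> space M) \<inter> (G -` U b \<inter> space M))"
  proof (intro set_eqI iffI)
    fix x assume x: "x \<in> (\<lambda>x. c x *\<^sub>R G x) -` S \<inter> space M"
    have "open ((\<lambda>p. fst p *\<^sub>R snd p) -` S)"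
      using S by (intro open_vimage continuous_intros) auto
    moreover have "(c x, G x) \<in> (\<lambda>p. fst p *\<^sub>R snd p) -` S" using x by simp
    ultimately obtain P Q where PQ': "open P" "open Q" "(c x, G x) \<in> P \<times> Q"
      and sub: "P \<times> Q \<subseteq> (\<lambda>p. fst p *\<^sub>R snd p) -` S"
      by (rule open_prod_elim)
    then have PQ: "open P" "open Q" "c x \<in> P" "G x \<in> Q" by auto
    then obtain b where b: "b \<in> B" "c x \<in> b" "b \<subseteq> P"
      using topological_basisE[OF B(2) PQ(1), of "c x"] by blast
    have "r *\<^sub>R v \<in> S" if "r \<in> b" "v \<in> Q" for r v
      using sub b(3) that by (auto simp: subset_iff)
    then have "Q \<subseteq> U b" unfolding U_def using PQ(2) by blast
    then show "x \<in> (\<Union>b\<in>B. (c -` b \<inter> space M) \<inter> (G -` U b \<inter> space M))"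
      using x b PQ by auto
  qed (auto simp: U_def)
  moreover have "(\<Union>b\<in>B. (c -` b \<inter> space M) \<inter> (G -` U b \<inter> space M)) \<in> sets M"
    using B(1) bo U by (intro sets.countable_UN' ) (auto intro!: measurable_sets)
  ultimately show "(\<lambda>x. c x *\<^sub>R G x) -` S \<inter> space M \<in> sets M" by simp
qed

text \<open>Sums of operator-valued functions raise the same separability question as products.
  Translation by a constant avoids it, being continuous.\<close>

lemma borel_measurable_add_const:
  fixes G :: "'a \<Rightarrow> 'b::real_normed_vector"
  assumes "G \<in> borel_measurable M"
  shows "(\<lambda>x. G x + a) \<in> borel_measurable M"
  using measurable_compose[OF assms borel_measurable_continuous_onI[of "\<lambda>y. y + a"]]
  by (simp add: continuous_on_add)

subsection \<open>Integrals of Hilbert-space-valued paths\<close>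

text \<open>
  The sort of the state space does not include \<^class>\<open>banach\<close>. The Riesz isomorphism to the dual
  space, which is an instance of \<^class>\<open>banach\<close>, transports the needed facts.
\<close>

definition riesz_inv :: "('h::{real_inner, complete_space} \<Rightarrow>\<^sub>L real) \<Rightarrow> 'h" where
  "riesz_inv f = (SOME y. \<forall>x. blinfun_apply f x = inner x y)"

lemma inner_riesz_inv: "inner x (riesz_inv f) = blinfun_apply f x"
proof -
  have "\<forall>x. blinfun_apply f x = inner x (riesz_inv f)"
    unfolding riesz_inv_def
    by (rule someI_ex[OF riesz_representation[OF blinfun.bounded_linear_right]])
  then show ?thesis by (rule allE) (rule sym)
qed

lemma riesz_inv_blinfun_inner_left [simp]: "riesz_inv (blinfun_inner_left x) = x"
  by (rule inner_eqI) (simp add: inner_riesz_inv)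

lemma bounded_linear_riesz_inv: "bounded_linear riesz_inv"
proof (rule bounded_linear_intro)
  fix f g :: "'a \<Rightarrow>\<^sub>L real" and c :: real
  show "riesz_inv (f + g) = riesz_inv f + riesz_inv g"
    by (rule inner_eqI) (simp only: inner_riesz_inv inner_add_right plus_blinfun.rep_eq)
  show "riesz_inv (c *\<^sub>R f) = c *\<^sub>R riesz_inv f"
    by (rule inner_eqI) (simp only: inner_riesz_inv inner_scaleR_right scaleR_blinfun.rep_eq real_scaleR_def)
  show "norm (riesz_inv f) \<le> norm f * 1"
  proof (cases "riesz_inv f = 0")
    case False
    have "norm (riesz_inv f) * norm (riesz_inv f) = blinfun_apply f (riesz_inv f)"
      unfolding inner_riesz_inv[symmetric] power2_eq_square[symmetric] by (rule power2_norm_eq_inner)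
    also have "\<dots> \<le> norm f * norm (riesz_inv f)"
      using norm_blinfun[of f "riesz_inv f"] unfolding real_norm_def by linarith
    finally show ?thesis using False by (simp only: mult_le_cancel_right mult_1_right) simp
  qed simp
qed

lemma riesz_inv_o_blinfun_inner_left: "riesz_inv \<circ> (\<lambda>x. blinfun_inner_left (f x)) = f"
  by (rule ext) (simp only: o_apply riesz_inv_blinfun_inner_left)

lemma hilbert_integrable_continuous:
  fixes f :: "real \<Rightarrow> 'h::{real_inner, complete_space}"
  assumes f: "continuous_on {a..b} f"
  shows "f integrable_on {a..b}"
proof -
  have "(\<lambda>x. blinfun_inner_left (f x)) integrable_on {a..b}"
    by (rule integrable_continuous_real)
      (rule bounded_linear.continuous_on[OF bounded_linear_blinfun_inner_left f])
  from integrable_linear[OF this bounded_linear_riesz_inv] show ?thesis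
    by (simp only: riesz_inv_o_blinfun_inner_left)
qed

lemma hilbert_FTC:
  fixes F :: "real \<Rightarrow> 'h::{real_inner, complete_space}"
  assumes "a \<le> b" "\<And>x. x \<in> {a..b} \<Longrightarrow> (F has_vector_derivative f x) (at x within {a..b})"
  shows "(f has_integral (F b - F a)) {a..b}"
proof -
  have "((\<lambda>x. blinfun_inner_left (f x)) has_integral (blinfun_inner_left (F b) - blinfun_inner_left (F a))) {a..b}"
    by (rule fundamental_theorem_of_calculus[OF assms(1)])
      (rule bounded_linear.has_vector_derivative[OF bounded_linear_blinfun_inner_left assms(2)])
  from has_integral_linear[OF this bounded_linear_riesz_inv] show ?thesis
    by (simp only: riesz_inv_o_blinfun_inner_left linear_diff[OF bounded_linear.linear[OF bounded_linear_riesz_inv]]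
        riesz_inv_blinfun_inner_left)
qed

lemma hilbert_integral_has_vector_derivative:
  fixes f :: "real \<Rightarrow> 'h::{real_inner, complete_space}"
  assumes f: "continuous_on {a..b} f" and x: "x \<in> {a..b}"
  shows "((\<lambda>u. integral {a..u} f) has_vector_derivative f x) (at x within {a..b})"
proof -
  define g where "g = (\<lambda>x. blinfun_inner_left (f x))"
  have g: "continuous_on {a..b} g"
    unfolding g_def by (rule bounded_linear.continuous_on[OF bounded_linear_blinfun_inner_left f])
  have f_eq: "riesz_inv \<circ> g = f" unfolding g_def by (rule riesz_inv_o_blinfun_inner_left)
  have *: "((\<lambda>u. riesz_inv (integral {a..u} g)) has_vector_derivative riesz_inv (g x)) (at x within {a..b})"
    by (rule bounded_linear.has_vector_derivative[OF bounded_linear_riesz_inv])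
      (rule integral_has_vector_derivative[OF g x])
  have "((\<lambda>u. integral {a..u} f) has_vector_derivative riesz_inv (g x)) (at x within {a..b})"
  proof (rule has_vector_derivative_transform[OF x _ *])
    fix u assume u: "u \<in> {a..b}"
    have "g integrable_on {a..u}"
      by (rule integrable_continuous_real[OF continuous_on_subset[OF g]]) (use u in auto)
    from integral_linear[OF this bounded_linear_riesz_inv]
    show "integral {a..u} f = riesz_inv (integral {a..u} g)"
      by (simp only: f_eq)
  qed
  then show ?thesis unfolding g_def by (simp only: riesz_inv_blinfun_inner_left)
qed

lemma hilbert_has_integral:
  fixes f :: "real \<Rightarrow> 'h::{real_inner, complete_space}"
  shows "continuous_on {a..b} f \<Longrightarrow> (f has_integral integral {a..b} f) {a..b}"
  by (rule integrable_integral[OF hilbert_integrable_continuous])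

lemma hilbert_integral_combine:
  fixes f :: "real \<Rightarrow> 'h::{real_inner, complete_space}"
  assumes "a \<le> c" "c \<le> b" and f: "continuous_on {a..b} f"
  shows "integral {a..c} f + integral {c..b} f = integral {a..b} f"
proof -
  have "(f has_integral (integral {a..b} f - integral {a..c} f)) {c..b}"
    by (rule hilbert_FTC[OF assms(2)],
        rule has_vector_derivative_within_subset[OF hilbert_integral_has_vector_derivative[OF f]])
      (use assms in auto)
  then show ?thesis by (simp add: integral_unique)
qed

section \<open>Step integrands\<close>

text \<open>
  In contrast to \<^const>\<open>elementary\<close>, the intervals \<open>(u, v]\<close> of a list of triples \<open>(A, u, v)\<close> may
  overlap, so that sums are concatenations and no common refinement is needed.
\<close>

definition sfun :: "(('h::real_normed_vector \<Rightarrow>\<^sub>L 'h) \<times> real \<times> real) list \<Rightarrow> real \<Rightarrow> 'h \<Rightarrow>\<^sub>L 'h" where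
  "sfun xs r = (\<Sum>(A, u, v)\<leftarrow>xs. indicator {u<..v} r *\<^sub>R A)"

definition sint :: "(('h::real_normed_vector \<Rightarrow>\<^sub>L 'h) \<times> real \<times> real) list \<Rightarrow> (real \<Rightarrow> 'w \<Rightarrow> 'h) \<Rightarrow> 'w \<Rightarrow> 'h" where
  "sint xs W \<omega> = (\<Sum>(A, u, v)\<leftarrow>xs. blinfun_apply A (W v \<omega> - W u \<omega>))"

definition steps_in :: "real \<Rightarrow> real \<Rightarrow> (('h::real_normed_vector \<Rightarrow>\<^sub>L 'h) \<times> real \<times> real) list \<Rightarrow> bool" where
  "steps_in a b xs \<longleftrightarrow> (\<forall>(A, u, v)\<in>set xs. a \<le> u \<and> u \<le> v \<and> v \<le> b)"

lemma sfun_simps [simp]: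
  "sfun [] r = 0" "sfun ((A, u, v) # xs) r = indicator {u<..v} r *\<^sub>R A + sfun xs r"
  "sfun (xs @ ys) r = sfun xs r + sfun ys r"
  by (simp_all add: sfun_def)

lemma sint_simps [simp]:
  "sint [] W \<omega> = 0" "sint ((A, u, v) # xs) W \<omega> = blinfun_apply A (W v \<omega> - W u \<omega>) + sint xs W \<omega>"
  "sint (xs @ ys) W \<omega> = sint xs W \<omega> + sint ys W \<omega>"
  by (simp_all add: sint_def)

lemma steps_in_simps [simp]:
  "steps_in a b []" "steps_in a b ((A, u, v) # xs) \<longleftrightarrow> a \<le> u \<and> u \<le> v \<and> v \<le> b \<and> steps_in a b xs"
  "steps_in a b (xs @ ys) \<longleftrightarrow> steps_in a b xs \<and> steps_in a b ys"
  by (auto simp: steps_in_def ball_Un)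

lemma steps_in_mono: "steps_in a b xs \<Longrightarrow> a' \<le> a \<Longrightarrow> b \<le> b' \<Longrightarrow> steps_in a' b' xs"
  by (induction xs) auto

definition scale_steps :: "real \<Rightarrow> (('h::real_normed_vector \<Rightarrow>\<^sub>L 'h) \<times> real \<times> real) list \<Rightarrow> _" where
  "scale_steps c xs = map (\<lambda>(A, u, v). (c *\<^sub>R A, u, v)) xs"

lemma sfun_scale_steps [simp]: "sfun (scale_steps c xs) r = c *\<^sub>R sfun xs r"
  unfolding scale_steps_def by (induction xs) (auto simp: scaleR_add_right)

lemma sint_scale_steps [simp]: "sint (scale_steps c xs) W \<omega> = c *\<^sub>R sint xs W \<omega>"
  unfolding scale_steps_def by (induction xs) (auto simp: scaleR_add_right blinfun.scaleR_left)

lemma steps_in_scale_steps [simp]: "steps_in a b (scale_steps c xs) \<longleftrightarrow> steps_in a b xs"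
  unfolding scale_steps_def by (induction xs) auto

text \<open>Moving both endpoints into \<open>[c, d]\<close> intersects each interval with
  \<open>(c, d]\<close>; an interval that misses it collapses to an empty one and contributes
  nothing.\<close>

definition clamp_steps :: "real \<Rightarrow> real \<Rightarrow> (('h::real_normed_vector \<Rightarrow>\<^sub>L 'h) \<times> real \<times> real) list \<Rightarrow> _" where
  "clamp_steps c d xs = map (\<lambda>(A, u, v). (A, max c (min d u), max c (min d v))) xs"

lemma sfun_clamp_steps: "c \<le> d \<Longrightarrow> sfun (clamp_steps c d xs) r = indicator {c<..d} r *\<^sub>R sfun xs r"
  unfolding clamp_steps_def
  by (induction xs) (auto simp: scaleR_add_right split: split_indicator)

lemma steps_in_clamp_steps: "c \<le> d \<Longrightarrow> steps_in a b xs \<Longrightarrow> steps_in c d (clamp_steps c d xs)"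
  unfolding clamp_steps_def by (induction xs) auto

text \<open>Each interval is cut at \<open>c\<close> and the increments over its two pieces
  telescope; if \<open>c\<close> lies outside, one piece is degenerate and its increment
  zero.\<close>

lemma sint_clamp_steps_combine:
  assumes "steps_in a d xs" "a \<le> c" "c \<le> d"
  shows "sint (clamp_steps a c xs) W \<omega> + sint (clamp_steps c d xs) W \<omega> = sint xs W \<omega>"
  using assms unfolding clamp_steps_def
proof (induction xs)
  case (Cons x xs)
  obtain A u v where x: "x = (A, u, v)" by (cases x) auto
  have uv: "a \<le> u" "u \<le> v" "v \<le> d" using Cons.prems by (auto simp: x)
  have "blinfun_apply A (W (max a (min c v)) \<omega> - W (max a (min c u)) \<omega>) +
      blinfun_apply A (W (max c (min d v)) \<omega> - W (max c (min d u)) \<omega>) = blinfun_apply A (W v \<omega> - W u \<omega>)"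
    using uv Cons.prems(2,3) unfolding blinfun.add_right[symmetric]
    by (intro arg_cong[where f = "blinfun_apply A"]) (auto simp: min_def max_def)
  then show ?case using Cons by (simp add: x algebra_simps)
qed simp

text \<open>The indicator is tested at the right end \<open>p (Suc i)\<close>, in line with
  left-open cells, so it selects exactly the indices from \<open>l\<close> to
  \<open>m - 1\<close>.\<close>

lemma sum_telescope_window:
  fixes g :: "real \<Rightarrow> 'v::real_vector" and p :: "nat \<Rightarrow> real"
  assumes p: "\<And>i j. i < j \<Longrightarrow> j \<le> n \<Longrightarrow> p i < p j" and lm: "l \<le> m" "m \<le> n"
  shows "(\<Sum>i<n. indicator {p l<..p m} (p (Suc i)) *\<^sub>R (g (p (Suc i)) - g (p i))) = g (p m) - g (p l)"
proof -
  have less_iff: "p i < p j \<longleftrightarrow> i < j" if "i \<le> n" "j \<le> n" for i j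
    using p[of i j] p[of j i] that by (metis less_irrefl less_trans linorder_neqE_nat)
  have "(\<Sum>i<n. indicator {p l<..p m} (p (Suc i)) *\<^sub>R (g (p (Suc i)) - g (p i)))
      = (\<Sum>i\<in>{l..<m}. g (p (Suc i)) - g (p i))"
  proof (rule sum.mono_neutral_cong_right)
    show "\<forall>i\<in>{..<n} - {l..<m}. indicator {p l<..p m} (p (Suc i)) *\<^sub>R (g (p (Suc i)) - g (p i)) = 0"
      using lm less_iff by (auto simp: indicator_def not_less[symmetric])
    show "indicator {p l<..p m} (p (Suc i)) *\<^sub>R (g (p (Suc i)) - g (p i)) = g (p (Suc i)) - g (p i)"
      if "i \<in> {l..<m}" for i
      using that lm less_iff by (auto simp: indicator_def not_less[symmetric])
  qed (use lm in auto)
  also have "\<dots> = g (p m) - g (p l)"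
    using sum_Suc_diff'[OF lm(1), of "\<lambda>i. g (p i)"] .
  finally show ?thesis .
qed

text \<open>All endpoints, together with \<open>a\<close> and \<open>b\<close>, are sorted into one
  grid that refines every interval. The coefficient of a cell is the value of \<open>sfun\<close> at
  its right end, a point that the left-open cell contains.\<close>

lemma steps_as_partition:
  fixes xs :: "(('h::real_normed_vector \<Rightarrow>\<^sub>L 'h) \<times> real \<times> real) list"
  assumes "a \<le> b" and xs: "steps_in a b xs"
  shows "\<exists>n p A. partition_of a b n p \<and> elementary n p A = sfun xs \<and>
    (\<forall>(W :: real \<Rightarrow> 'w \<Rightarrow> 'h) \<omega>. elementary_integral n p A W \<omega> = sint xs W \<omega>)"
proof -
  define P where "P = {a, b} \<union> (\<Union>(A, u, v)\<in>set xs. {u, v})"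
  have finP: "finite P" unfolding P_def by auto
  have Pab: "x \<in> P \<Longrightarrow> a \<le> x \<and> x \<le> b" for x
    using assms unfolding P_def steps_in_def by fastforce
  define l where "l = sorted_list_of_set P"
  have l: "sorted_wrt (<) l" "set l = P" unfolding l_def using finP by auto
  have "l \<noteq> []" using l(2) by (auto simp: P_def)
  define n where "n = length l - 1"
  have n: "length l = Suc n" using \<open>l \<noteq> []\<close> by (simp add: n_def)
  define p where "p i = l ! i" for i
  have p_less: "p i < p j" if "i < j" "j \<le> n" for i j
    unfolding p_def using sorted_wrt_nth_less[OF l(1) that(1)] that n by simp
  have p_le: "p i \<le> p j" if "i \<le> j" "j \<le> n" for i j
    using p_less[of i j] that by (cases "i = j") auto
  have p_ex: "\<exists>i\<le>n. p i = x" if "x \<in> P" for x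
    using that l(2) n unfolding p_def by (metis in_set_conv_nth less_Suc_eq_le)
  have p_in: "p i \<in> P" if "i \<le> n" for i
    using that l(2) n unfolding p_def by (metis less_Suc_eq_le nth_mem)
  have p0: "p 0 = a"
  proof -
    obtain i where "i \<le> n" "p i = a" using p_ex[of a] by (auto simp: P_def)
    then show ?thesis using p_le[of 0 i] Pab[OF p_in[of 0]] by simp
  qed
  have pn: "p n = b"
  proof -
    obtain i where "i \<le> n" "p i = b" using p_ex[of b] by (auto simp: P_def)
    then show ?thesis using p_le[of i n] Pab[OF p_in[of n]] by simp
  qed
  have part: "partition_of a b n p"
    unfolding partition_of_def using p0 pn p_less[THEN less_imp_le] by simp
  define D where "D i = sfun xs (p (Suc i))" for i
  have window: "(\<Sum>i<n. indicator {u<..v} (p (Suc i)) *\<^sub>R (g (p (Suc i)) - g (p i))) = g v - g u"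
    if "(A, u, v) \<in> set xs" for A u v and g :: "real \<Rightarrow> 'v::real_vector"
  proof -
    have "u \<in> P" "v \<in> P" using that unfolding P_def by auto
    then obtain i j where ij: "i \<le> n" "p i = u" "j \<le> n" "p j = v" using p_ex by metis
    have "u \<le> v" using xs that unfolding steps_in_def by auto
    then have "i \<le> j" using p_less[of j i] ij by (meson leD leI)
    with sum_telescope_window[of n p i j g] p_less ij show ?thesis by simp
  qed
  \<comment> \<open>Kept general in \<open>G\<close> to serve twice: with
    \<open>\<lambda>A x. x *\<^sub>R A\<close> for the values of the step function and with
    \<open>blinfun_apply\<close> for its integral.\<close>
  have sum_window: "(\<Sum>i<n. \<Sum>(A, u, v)\<leftarrow>ys. G A (indicator {u<..v} (p (Suc i)) *\<^sub>R (g (p (Suc i)) - g (p i))))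
      = (\<Sum>(A, u, v)\<leftarrow>ys. G A (g v - g u))"
    if "set ys \<subseteq> set xs" and G: "\<And>A. linear (G A)"
    for ys and g :: "real \<Rightarrow> 'v::real_vector" and G :: "('h \<Rightarrow>\<^sub>L 'h) \<Rightarrow> 'v \<Rightarrow> 'z::real_vector"
    using that(1)
  proof (induction ys)
    case (Cons y ys)
    obtain A u v where y: "y = (A, u, v)" by (cases y) auto
    have "(\<Sum>i<n. G A (indicator {u<..v} (p (Suc i)) *\<^sub>R (g (p (Suc i)) - g (p i)))) = G A (g v - g u)"
      unfolding linear_sum[OF G, symmetric]
      by (subst window[of A u v g]) (use Cons.prems in \<open>auto simp: y\<close>)
    then show ?case using Cons by (simp add: y sum.distrib)
  qed simp
  have "elementary n p D r = sfun xs r" for r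
  proof -
    have scaleR_sfun: "x *\<^sub>R sfun ys s = (\<Sum>(A, u, v)\<leftarrow>ys. (indicator {u<..v} s *\<^sub>R x) *\<^sub>R A)"
      for ys :: "(('h \<Rightarrow>\<^sub>L 'h) \<times> real \<times> real) list" and x s :: real
      by (induction ys) (auto simp: scaleR_add_right)
    \<comment> \<open>The unit jump at \<open>r\<close>. Its increment over \<open>(u, v]\<close> is
      the indicator at \<open>r\<close>, so evaluating a step function at \<open>r\<close> becomes
      the same kind of sum as integrating it.\<close>
    define g :: "real \<Rightarrow> real" where "g t = (if r \<le> t then 1 else 0)" for t
    have ind: "indicator {u<..v} r = g v - g u" if "u \<le> v" for u v
      using that by (auto simp: g_def split: split_indicator)
    have "elementary n p D r = (\<Sum>i<n. (g (p (Suc i)) - g (p i)) *\<^sub>R D i)"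
      unfolding elementary_def
      by (intro sum.cong refl) (simp add: ind p_le)
    also have "\<dots> = (\<Sum>i<n. \<Sum>(A, u, v)\<leftarrow>xs. (indicator {u<..v} (p (Suc i)) *\<^sub>R (g (p (Suc i)) - g (p i))) *\<^sub>R A)"
      unfolding D_def by (intro sum.cong refl scaleR_sfun)
    also have "\<dots> = (\<Sum>(A, u, v)\<leftarrow>xs. (g v - g u) *\<^sub>R A)"
      by (rule sum_window[of xs "\<lambda>A x. x *\<^sub>R A" g]) (auto intro!: linearI simp: scaleR_add_left)
    also have "\<dots> = sfun xs r"
      unfolding sfun_def using xs
      by (intro arg_cong[where f = sum_list] map_cong refl) (auto simp: ind steps_in_def)
    finally show ?thesis .
  qed
  moreover have "elementary_integral n p D W \<omega> = sint xs W \<omega>" for W :: "real \<Rightarrow> 'w \<Rightarrow> 'h" and \<omega>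
  proof -
    have ap: "blinfun_apply (sfun ys r) x = (\<Sum>(A, u, v)\<leftarrow>ys. blinfun_apply A (indicator {u<..v} r *\<^sub>R x))" for ys r x
      by (induction ys) (auto simp: blinfun.bilinear_simps)
    have "elementary_integral n p D W \<omega> =
      (\<Sum>i<n. \<Sum>(A, u, v)\<leftarrow>xs. blinfun_apply A (indicator {u<..v} (p (Suc i)) *\<^sub>R (W (p (Suc i)) \<omega> - W (p i) \<omega>)))"
      unfolding elementary_integral_def D_def ap ..
    also have "\<dots> = sint xs W \<omega>"
      unfolding sint_def
      by (rule sum_window[of xs blinfun_apply "\<lambda>t. W t \<omega>"]) (auto intro: bounded_linear.linear blinfun.bounded_linear_right)
    finally show ?thesis .
  qed
  ultimately show ?thesis using part by blast
qed

lemma partition_as_steps: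
  assumes "partition_of a b n p"
  shows "\<exists>xs. steps_in a b xs \<and> elementary n p A = sfun xs \<and>
    (\<forall>(W :: real \<Rightarrow> 'w \<Rightarrow> 'h::real_normed_vector) \<omega>. elementary_integral n p A W \<omega> = sint xs W \<omega>)"
proof -
  have p: "p i \<le> p j" if "i \<le> j" "j \<le> n" for i j
    using that(1,2)
  proof (induction j rule: dec_induct)
    case (step k)
    then show ?case using assms unfolding partition_of_def by (meson Suc_le_lessD Suc_leD order_trans)
  qed simp
  have "a \<le> p i \<and> p i \<le> b" if "i \<le> n" for i
    using p[of 0 i] p[of i n] that assms unfolding partition_of_def by auto
  then have "steps_in a b (map (\<lambda>i. (A i, p i, p (Suc i))) [0..<n])"
    using p unfolding steps_in_def by auto
  then show ?thesis
    by (intro exI[of _ "map (\<lambda>i. (A i, p i, p (Suc i))) [0..<n]"])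
      (auto simp: fun_eq_iff elementary_def elementary_integral_def sfun_def sint_def o_def
        interv_sum_list_conv_sum_set_nat lessThan_atLeast0)
qed

section \<open>The Ito isometry for step integrands\<close>

lemma (in prob_space) indep_var_of_indep_set:
  assumes ind: "indep_set (sets G) (sets H)" and sp: "space G = space M" "space H = space M"
    and X: "X \<in> measurable G N" and Y: "Y \<in> measurable H N'"
  shows "indep_var N X N' Y"
proof -
  have GM: "sets G \<subseteq> events" and HM: "sets H \<subseteq> events"
    using indep_setD_ev1[OF ind] indep_setD_ev2[OF ind] by auto
  have rv: "X \<in> measurable M N" "Y \<in> measurable M N'"
    using measurable_mono[OF order_refl refl GM sp(1)] X measurable_mono[OF order_refl refl HM sp(2)] Y
    by auto
  have 1: "sigma_sets (space M) {X -` A \<inter> space M | A. A \<in> sets N} \<subseteq> sets G"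
    unfolding sp(1)[symmetric] using X by (intro sets.sigma_sets_subset) (auto intro: measurable_sets)
  have 2: "sigma_sets (space M) {Y -` A \<inter> space M | A. A \<in> sets N'} \<subseteq> sets H"
    unfolding sp(2)[symmetric] using Y by (intro sets.sigma_sets_subset) (auto intro: measurable_sets)
  show ?thesis
    unfolding indep_var_eq using rv ind 1 2 unfolding indep_sets2_eq by blast
qed

locale brownian = prob_space M for M :: "'w measure" +
  fixes F :: "real \<Rightarrow> 'w measure" and a :: real
    and C :: "'h::{real_inner, polish_space} \<Rightarrow>\<^sub>L 'h" and W :: "real \<Rightarrow> 'w \<Rightarrow> 'h"
  assumes filt: "filtration_on M F a" and bm: "brownian_motion M F a C W"
begin

abbreviation q :: "'h \<Rightarrow> real" where "q h \<equiv> inner (blinfun_apply C h) h"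

lemma covariance: "covariance_operator C"
  using bm unfolding brownian_motion_def by blast

lemma q_nonneg: "0 \<le> q h"
  using covariance unfolding covariance_operator_def by blast

lemma subalgebra_F: "a \<le> t \<Longrightarrow> subalgebra M (F t)"
  using filt unfolding filtration_on_def by blast

lemma subalgebra_F_mono: "a \<le> s \<Longrightarrow> s \<le> t \<Longrightarrow> subalgebra (F t) (F s)"
  using filt unfolding filtration_on_def by blast

lemma space_F: "a \<le> t \<Longrightarrow> space (F t) = space M"
  using subalgebra_F unfolding subalgebra_def by blast

lemma measurable_F_M: "a \<le> t \<Longrightarrow> X \<in> measurable (F t) N \<Longrightarrow> X \<in> measurable M N"
  using measurable_from_subalg[OF subalgebra_F] by blast

lemma measurable_F_mono: "a \<le> s \<Longrightarrow> s \<le> t \<Longrightarrow> X \<in> measurable (F s) N \<Longrightarrow> X \<in> measurable (F t) N"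
  using measurable_from_subalg[OF subalgebra_F_mono] by blast

lemma W_measurable_F: "a \<le> s \<Longrightarrow> s \<le> t \<Longrightarrow> W s \<in> borel_measurable (F t)"
  using bm measurable_F_mono unfolding brownian_motion_def adapted_def by blast

lemma W_measurable: "a \<le> t \<Longrightarrow> W t \<in> borel_measurable M"
  using W_measurable_F measurable_F_M by blast

lemma W_start: "AE \<omega> in M. W a \<omega> = 0"
  using bm unfolding brownian_motion_def by blast

lemma W_continuous: "AE \<omega> in M. continuous_on {a..} (\<lambda>t. W t \<omega>)"
  using bm unfolding brownian_motion_def continuous_process_def by blast

lemma indep_increment:
  assumes "a \<le> s" "s \<le> t" "X \<in> measurable (F s) N" "f \<in> measurable borel N'"
  shows "indep_var N X N' (\<lambda>\<omega>. f (W t \<omega> - W s \<omega>))"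
proof (rule indep_var_of_indep_set)
  show "indep_set (sets (F s)) (sets (vimage_algebra (space M) (\<lambda>\<omega>. W t \<omega> - W s \<omega>) borel))"
    using bm assms(1,2) unfolding brownian_motion_def by blast
  show "(\<lambda>\<omega>. f (W t \<omega> - W s \<omega>)) \<in> measurable (vimage_algebra (space M) (\<lambda>\<omega>. W t \<omega> - W s \<omega>) borel) N'"
    by (rule measurable_compose[OF measurable_vimage_algebra1 assms(4)]) auto
qed (use assms space_F in auto)

lemma increment_moments:
  fixes h :: 'h
  assumes st: "a \<le> s" "s \<le> t"
  defines "X \<equiv> \<lambda>\<omega>. inner (W t \<omega> - W s \<omega>) h"
  shows "integrable M X" "integrable M (\<lambda>\<omega>. (X \<omega>)\<^sup>2)" "expectation X = 0"
    "expectation (\<lambda>\<omega>. (X \<omega>)\<^sup>2) = (t - s) * q h"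
proof -
  have [measurable]: "W s \<in> borel_measurable M" "W t \<in> borel_measurable M"
    using W_measurable st by auto
  have [measurable]: "X \<in> borel_measurable M" unfolding X_def by measurable
  define v where "v = (t - s) * q h"
  have "centred_gaussian M ((t - s) *\<^sub>R C) (\<lambda>\<omega>. W t \<omega> - W s \<omega>)"
    using bm st unfolding brownian_motion_def by blast
  then have *: "if v = 0 then (AE \<omega> in M. X \<omega> = 0)
      else distributed M lborel X (normal_density 0 (sqrt v))"
  proof -
    have "inner (blinfun_apply ((t - s) *\<^sub>R C) h) h = v" by (simp add: v_def blinfun.scaleR_left)
    then show ?thesis
      using \<open>centred_gaussian M ((t - s) *\<^sub>R C) (\<lambda>\<omega>. W t \<omega> - W s \<omega>)\<close>
        [unfolded centred_gaussian_def, THEN conjunct2, THEN spec[of _ h]]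
      by (simp only: X_def)
  qed
  have "integrable M X \<and> integrable M (\<lambda>\<omega>. (X \<omega>)\<^sup>2) \<and> expectation X = 0 \<and> expectation (\<lambda>\<omega>. (X \<omega>)\<^sup>2) = v"
  \<comment> \<open>A point mass has no density, so the degenerate case enters separately, as in
    \<open>centred_gaussian\<close>.\<close>
  proof (cases "v = 0")
    case True
    then have X0: "AE \<omega> in M. X \<omega> = 0" using * by simp
    then have X20: "AE \<omega> in M. (X \<omega>)\<^sup>2 = 0" by eventually_elim simp
    show ?thesis
      using True integrable_cong_AE[of X M "\<lambda>_. 0"] integral_cong_AE[of X M "\<lambda>_. 0"] X0
        integrable_cong_AE[of "\<lambda>\<omega>. (X \<omega>)\<^sup>2" M "\<lambda>_. 0"] integral_cong_AE[of "\<lambda>\<omega>. (X \<omega>)\<^sup>2" M "\<lambda>_. 0"] X20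
      by simp
  next
    case False
    have "0 \<le> v" unfolding v_def using st q_nonneg by simp
    then have pos: "0 < sqrt v" using False by simp
    have D: "distributed M lborel X (normal_density 0 (sqrt v))" using * False by simp
    have i1: "integrable M X"
      using distributed_integrable[OF D, of "\<lambda>x. x"] integrable_normal_moment_nz_1[OF pos, of 0] by simp
    have i2: "integrable M (\<lambda>\<omega>. (X \<omega>)\<^sup>2)"
      using distributed_integrable[OF D, of "\<lambda>x. x^2"] integrable_normal_moment[OF pos, of 0 2] by simp
    have e1: "expectation X = 0" by (rule normal_distributed_expectation[OF pos D])
    have "expectation (\<lambda>\<omega>. (X \<omega>)\<^sup>2) = v"
      using normal_distributed_variance[OF pos D] e1 \<open>0 \<le> v\<close> by simp
    then show ?thesis using i1 i2 e1 by simp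
  qed
  then show "integrable M X" "integrable M (\<lambda>\<omega>. (X \<omega>)\<^sup>2)" "expectation X = 0"
    "expectation (\<lambda>\<omega>. (X \<omega>)\<^sup>2) = (t - s) * q h" by (auto simp: v_def)
qed

text \<open>Measurability of the partial sum for \<open>F (p k)\<close> belongs to the induction
  because it makes the next increment independent of that sum; the cross term then has mean zero and
  the variances add.\<close>

lemma sum_increments_moments:
  fixes h :: "nat \<Rightarrow> 'h" and p :: "nat \<Rightarrow> real"
  assumes "a \<le> p 0" "\<And>i. i < n \<Longrightarrow> p i \<le> p (Suc i)" "k \<le> n"
  defines "S \<equiv> \<lambda>k \<omega>. \<Sum>i<k. inner (W (p (Suc i)) \<omega> - W (p i) \<omega>) (h i)"
  shows "a \<le> p k \<and> S k \<in> borel_measurable (F (p k)) \<and> integrable M (S k) \<and>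
    integrable M (\<lambda>\<omega>. (S k \<omega>)\<^sup>2) \<and> expectation (S k) = 0 \<and>
    expectation (\<lambda>\<omega>. (S k \<omega>)\<^sup>2) = (\<Sum>i<k. (p (Suc i) - p i) * q (h i))"
  using assms(3)
proof (induction k)
  case 0
  then show ?case using assms(1) by (simp add: S_def)
next
  case (Suc k)
  then have k: "k < n" "k \<le> n" by auto
  note IH = Suc.IH[OF k(2)]
  then have pk: "a \<le> p k" "p k \<le> p (Suc k)" using assms(2) k by auto
  define X where "X \<omega> = inner (W (p (Suc k)) \<omega> - W (p k) \<omega>) (h k)" for \<omega>
  note X = increment_moments[OF pk, of "h k", folded X_def]
  have S_Suc: "S (Suc k) = (\<lambda>\<omega>. S k \<omega> + X \<omega>)" by (simp add: S_def X_def)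
  have "S k \<in> borel_measurable (F (p (Suc k)))"
    by (rule measurable_F_mono[OF pk IH[THEN conjunct2, THEN conjunct1]])
  moreover have "W (p k) \<in> borel_measurable (F (p (Suc k)))" "W (p (Suc k)) \<in> borel_measurable (F (p (Suc k)))"
    by (rule W_measurable_F; use pk in linarith)+
  ultimately have m: "S (Suc k) \<in> borel_measurable (F (p (Suc k)))"
    unfolding S_Suc X_def by (intro borel_measurable_add borel_measurable_inner borel_measurable_diff borel_measurable_const)
  have ind: "indep_var borel (S k) borel X"
    unfolding X_def by (rule indep_increment[OF pk IH[THEN conjunct2, THEN conjunct1]]) simp
  have SX: "integrable M (\<lambda>\<omega>. S k \<omega> * X \<omega>)" "expectation (\<lambda>\<omega>. S k \<omega> * X \<omega>) = 0"
    using indep_var_integrable[OF ind] indep_var_lebesgue_integral[OF ind] IH X(1,3) by simp_all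
  have sq: "(\<lambda>\<omega>. (S (Suc k) \<omega>)\<^sup>2) = (\<lambda>\<omega>. (S k \<omega>)\<^sup>2 + (2 * (S k \<omega> * X \<omega>) + (X \<omega>)\<^sup>2))"
    by (auto simp: S_Suc power2_eq_square algebra_simps)
  have "integrable M (S (Suc k))" "expectation (S (Suc k)) = 0"
    unfolding S_Suc using IH X(1,3) by simp_all
  moreover have "integrable M (\<lambda>\<omega>. (S (Suc k) \<omega>)\<^sup>2)"
    "expectation (\<lambda>\<omega>. (S (Suc k) \<omega>)\<^sup>2) = (\<Sum>i<Suc k. (p (Suc i) - p i) * q (h i))"
    unfolding sq using IH X(2,4) SX by simp_all
  ultimately show ?case using m order_trans[OF pk] by blast
qed

lemma nn_integral_projection:
  assumes "a \<le> p 0" "\<And>i. i < n \<Longrightarrow> p i \<le> p (Suc i)"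
  shows "(\<integral>\<^sup>+ \<omega>. ennreal ((inner (elementary_integral n p A W \<omega>) b)\<^sup>2) \<partial>M)
    = (\<Sum>i<n. ennreal (p (Suc i) - p i) * ennreal (q (adj (A i) b)))"
proof -
  have eq: "inner (elementary_integral n p A W \<omega>) b =
      (\<Sum>i<n. inner (W (p (Suc i)) \<omega> - W (p i) \<omega>) (adj (A i) b))" for \<omega>
    by (simp add: elementary_integral_def inner_sum_left inner_adj)
  note m = sum_increments_moments[OF assms order_refl, where h = "\<lambda>i. adj (A i) b"]
  have "(\<integral>\<^sup>+ \<omega>. ennreal ((inner (elementary_integral n p A W \<omega>) b)\<^sup>2) \<partial>M)
     = ennreal (\<Sum>i<n. (p (Suc i) - p i) * q (adj (A i) b))"
    unfolding eq using m by (subst nn_integral_eq_integral) auto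
  also have "\<dots> = (\<Sum>i<n. ennreal ((p (Suc i) - p i) * q (adj (A i) b)))"
    using assms(2) q_nonneg by (intro sum_ennreal[symmetric]) auto
  also have "\<dots> = (\<Sum>i<n. ennreal (p (Suc i) - p i) * ennreal (q (adj (A i) b)))"
    using assms(2) q_nonneg by (intro sum.cong refl ennreal_mult) auto
  finally show ?thesis .
qed

lemma borel_measurable_blinfun_apply:
  "X \<in> borel_measurable N \<Longrightarrow> (\<lambda>\<omega>. blinfun_apply A (X \<omega>)) \<in> borel_measurable N" for A :: "'h \<Rightarrow>\<^sub>L 'h"
  by (rule measurable_compose[OF _ borel_measurable_continuous_onI[OF
        linear_continuous_on[OF blinfun.bounded_linear_right]]])

lemma elementary_integral_measurable:
  assumes "a \<le> p 0" "\<And>i. i < n \<Longrightarrow> p i \<le> p (Suc i)"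
  shows "elementary_integral n p A W \<in> borel_measurable M"
proof -
  have "a \<le> p i" if "i \<le> n" for i
    using that
  proof (induction i)
    case (Suc i)
    then show ?case using assms(2)[of i] by simp
  qed (use assms in simp)
  then have "W (p (Suc i)) \<in> borel_measurable M" "W (p i) \<in> borel_measurable M" if "i < n" for i
    using that W_measurable by auto
  then have "(\<lambda>\<omega>. blinfun_apply (A i) (W (p (Suc i)) \<omega> - W (p i) \<omega>)) \<in> borel_measurable M" if "i < n" for i
    using that by (intro borel_measurable_blinfun_apply borel_measurable_diff)
  then have "(\<lambda>\<omega>. \<Sum>i<n. blinfun_apply (A i) (W (p (Suc i)) \<omega> - W (p i) \<omega>)) \<in> borel_measurable M"
    by (intro borel_measurable_sum) auto
  then show ?thesis unfolding elementary_integral_def[abs_def] .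
qed

text \<open>The squared norm is a limit of Parseval sums along an exhausting sequence of orthonormal
  systems. Each such sum has an explicit expectation, dominated by the supremum in
  \<open>cov_norm2\<close>, and Fatou's lemma passes the bound to the limit.\<close>

lemma elementary_integral_isometry_le:
  assumes p: "partition_of c d n p" and ac: "a \<le> c"
  shows "(\<integral>\<^sup>+ \<omega>. ennreal ((norm (elementary_integral n p A W \<omega>))\<^sup>2) \<partial>M)
    \<le> (\<integral>\<^sup>+ r\<in>{c..d}. cov_norm2 C (elementary n p A r) \<partial>lborel)"
proof -
  have p': "a \<le> p 0" "\<And>i. i < n \<Longrightarrow> p i \<le> p (Suc i)"
    using p ac unfolding partition_of_def by auto
  note [measurable] = elementary_integral_measurable[OF p', where A = A]
  define S where "S = elementary_integral n p A W"
  obtain B :: "nat \<Rightarrow> 'h set" where B: "\<And>n. orthonormal (B n)"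
    "\<And>x. (\<lambda>n. \<Sum>b\<in>B n. (inner x b)\<^sup>2) \<longlonglongrightarrow> (norm x)\<^sup>2"
    using orthonormal_exhaustion[where 'h = 'h] by blast
  have lim: "liminf (\<lambda>k. ennreal (\<Sum>b\<in>B k. (inner (S \<omega>) b)\<^sup>2)) = ennreal ((norm (S \<omega>))\<^sup>2)" for \<omega>
    by (intro lim_imp_Liminf tendsto_ennrealI B(2)) simp
  have bound: "(\<integral>\<^sup>+ \<omega>. ennreal (\<Sum>b\<in>B k. (inner (S \<omega>) b)\<^sup>2) \<partial>M)
    \<le> (\<Sum>i<n. ennreal (p (Suc i) - p i) * cov_norm2 C (A i))" for k
  proof -
    have "(\<integral>\<^sup>+ \<omega>. ennreal (\<Sum>b\<in>B k. (inner (S \<omega>) b)\<^sup>2) \<partial>M)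
      = (\<integral>\<^sup>+ \<omega>. (\<Sum>b\<in>B k. ennreal ((inner (S \<omega>) b)\<^sup>2)) \<partial>M)"
      by (simp add: sum_ennreal)
    also have "\<dots> = (\<Sum>b\<in>B k. \<integral>\<^sup>+ \<omega>. ennreal ((inner (S \<omega>) b)\<^sup>2) \<partial>M)"
      unfolding S_def by (intro nn_integral_sum) measurable
    also have "\<dots> = (\<Sum>b\<in>B k. \<Sum>i<n. ennreal (p (Suc i) - p i) * ennreal (q (adj (A i) b)))"
      unfolding S_def by (intro sum.cong refl nn_integral_projection p')
    also have "\<dots> = (\<Sum>i<n. ennreal (p (Suc i) - p i) * (\<Sum>b\<in>B k. ennreal (q (adj (A i) b))))"
      unfolding sum_distrib_left by (rule sum.swap)
    also have "\<dots> \<le> (\<Sum>i<n. ennreal (p (Suc i) - p i) * cov_norm2 C (A i))"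
      unfolding cov_norm2_eq using B(1) by (intro sum_mono mult_left_mono SUP_upper) auto
    finally show ?thesis .
  qed
  have "(\<integral>\<^sup>+ \<omega>. ennreal ((norm (S \<omega>))\<^sup>2) \<partial>M)
      = (\<integral>\<^sup>+ \<omega>. liminf (\<lambda>k. ennreal (\<Sum>b\<in>B k. (inner (S \<omega>) b)\<^sup>2)) \<partial>M)"
    unfolding lim ..
  also have "\<dots> \<le> liminf (\<lambda>k. \<integral>\<^sup>+ \<omega>. ennreal (\<Sum>b\<in>B k. (inner (S \<omega>) b)\<^sup>2) \<partial>M)"
    unfolding S_def by (intro nn_integral_liminf) measurable
  also have "\<dots> \<le> (\<Sum>i<n. ennreal (p (Suc i) - p i) * cov_norm2 C (A i))"
    by (intro Liminf_le always_eventually allI bound) auto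
  also have "\<dots> = (\<integral>\<^sup>+ r. (\<Sum>i<n. cov_norm2 C (A i) * indicator {p i<..p (Suc i)} r) \<partial>lborel)"
    using p' by (subst nn_integral_sum)
      (auto simp: nn_integral_cmult_indicator mult.commute intro!: sum.cong)
  also have "\<dots> \<le> (\<integral>\<^sup>+ r\<in>{c..d}. cov_norm2 C (elementary n p A r) \<partial>lborel)"
  proof (rule nn_integral_mono)
    fix r
    have pm: "p i \<le> p j" if "i \<le> j" "j \<le> n" for i j
      using that
    proof (induction j rule: dec_induct)
      case (step k)
      then show ?case using p'(2)[of k] by linarith
    qed simp
    show "(\<Sum>i<n. cov_norm2 C (A i) * indicator {p i<..p (Suc i)} r)
        \<le> cov_norm2 C (elementary n p A r) * indicator {c..d} r"
    \<comment> \<open>The cells are disjoint, so at most one summand is nonzero; a point in no cell,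
      such as \<open>c\<close>, contributes zero on the left.\<close>
    proof (cases "\<exists>i<n. r \<in> {p i<..p (Suc i)}")
      case True
      then obtain i where i: "i < n" "r \<in> {p i<..p (Suc i)}" by blast
      have other: "r \<notin> {p j<..p (Suc j)}" if "j < n" "j \<noteq> i" for j
        using pm[of "Suc i" j] pm[of "Suc j" i] that i by (cases "i < j") (auto simp: not_less)
      have 1: "(\<Sum>j<n. cov_norm2 C (A j) * indicator {p j<..p (Suc j)} r) = (\<Sum>j<n. if j = i then cov_norm2 C (A i) else 0)"
        using i other by (intro sum.cong) (auto split: split_indicator)
      have 2: "elementary n p A r = (\<Sum>j<n. if j = i then A i else 0)"
        unfolding elementary_def using i other by (intro sum.cong) (auto split: split_indicator)
      have "r \<in> {c..d}" using i pm[of 0 i] pm[of "Suc i" n] p unfolding partition_of_def by auto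
      then show ?thesis unfolding 1 2 using i(1) by simp
    next
      case False
      then have "(\<Sum>i<n. cov_norm2 C (A i) * indicator {p i<..p (Suc i)} r) = 0"
        by (intro sum.neutral) auto
      then show ?thesis by simp
    qed
  qed
  finally show ?thesis unfolding S_def .
qed

lemma sint_isometry_le:
  assumes xs: "steps_in c d xs" and "a \<le> c" "c \<le> d"
  shows "(\<integral>\<^sup>+ \<omega>. ennreal ((norm (sint xs W \<omega>))\<^sup>2) \<partial>M) \<le> (\<integral>\<^sup>+ r\<in>{c..d}. cov_norm2 C (sfun xs r) \<partial>lborel)"
proof -
  obtain n p A where npA: "partition_of c d n p" "elementary n p A = sfun xs"
    "\<forall>(W :: real \<Rightarrow> 'w \<Rightarrow> 'h) \<omega>. elementary_integral n p A W \<omega> = sint xs W \<omega>"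
    using steps_as_partition[OF assms(3) xs] by blast
  show ?thesis using elementary_integral_isometry_le[OF npA(1) assms(2), where A = A] npA(2,3) by simp
qed

lemma sint_measurable_F:
  "steps_in c d xs \<Longrightarrow> a \<le> c \<Longrightarrow> sint xs W \<in> borel_measurable (F d)"
proof (induction xs)
  case (Cons x xs)
  obtain A u v where x: "x = (A, u, v)" by (cases x) auto
  have "W u \<in> borel_measurable (F d)" "W v \<in> borel_measurable (F d)"
    using Cons.prems by (auto simp: x intro!: W_measurable_F)
  then have "(\<lambda>\<omega>. blinfun_apply A (W v \<omega> - W u \<omega>)) \<in> borel_measurable (F d)"
    by (intro borel_measurable_blinfun_apply borel_measurable_diff)
  moreover have "sint xs W \<in> borel_measurable (F d)" using Cons by (simp add: x)
  moreover have "sint ((A, u, v) # xs) W = (\<lambda>\<omega>. blinfun_apply A (W v \<omega> - W u \<omega>) + sint xs W \<omega>)"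
    by (rule ext) simp
  ultimately show ?case by (simp add: x)
next
  case Nil
  have "sint [] W = (\<lambda>\<omega>. 0)" by (rule ext) simp
  then show ?case by simp
qed

lemma sint_measurable: "steps_in c d xs \<Longrightarrow> a \<le> c \<Longrightarrow> c \<le> d \<Longrightarrow> sint xs W \<in> borel_measurable M"
  by (rule measurable_F_M[OF _ sint_measurable_F]) auto

end

section \<open>The integral of deterministic integrands\<close>

text \<open>Stated for the difference because, with values in the nonseparable operator space, its
  measurability does not follow from that of the two terms in general. A single step subtracts a
  constant on a Borel set, and induction removes the steps one by one.\<close>

lemma borel_measurable_diff_sfun:
  assumes "\<sigma> \<in> borel_measurable (restrict_space borel S)"
  shows "(\<lambda>r. \<sigma> r - sfun xs r) \<in> borel_measurable (restrict_space borel S)"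
  using assms
proof (induction xs arbitrary: \<sigma>)
  case (Cons x xs)
  obtain A u v where x: "x = (A, u, v)" by (cases x) auto
  have "{r \<in> space (restrict_space borel S). r \<in> {u<..v}} \<in> sets (restrict_space borel S)"
    by (auto simp: sets_restrict_space space_restrict_space intro!: image_eqI[of _ _ "{u<..v}"])
  then have "(\<lambda>r. if r \<in> {u<..v} then \<sigma> r + (- A) else \<sigma> r) \<in> borel_measurable (restrict_space borel S)"
    by (intro measurable_If borel_measurable_add_const Cons.prems)
  also have "(\<lambda>r. if r \<in> {u<..v} then \<sigma> r + (- A) else \<sigma> r) = (\<lambda>r. \<sigma> r - indicator {u<..v} r *\<^sub>R A)"
    by (auto simp: fun_eq_iff)
  finally have "(\<lambda>r. \<sigma> r - indicator {u<..v} r *\<^sub>R A) \<in> borel_measurable (restrict_space borel S)" .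
  from Cons.IH[OF this] show ?case by (simp add: x diff_diff_eq)
qed simp

lemma borel_measurable_sfun: "sfun xs \<in> borel_measurable (restrict_space borel S)"
proof -
  have "(\<lambda>r. 0 - sfun (scale_steps (-1) xs) r) \<in> borel_measurable (restrict_space borel S)"
    by (rule borel_measurable_diff_sfun) simp
  then show ?thesis by simp
qed

lemma sfun_at_start: "steps_in c d xs \<Longrightarrow> sfun xs c = 0"
  by (induction xs) auto

text \<open>The square of the norm in the Ito isometry, kept in \<open>ennreal\<close> so that no
  integrability has to be established beforehand.\<close>

definition cov_L2 :: "('h::real_inner \<Rightarrow>\<^sub>L 'h) \<Rightarrow> real \<Rightarrow> real \<Rightarrow> (real \<Rightarrow> 'h \<Rightarrow>\<^sub>L 'h) \<Rightarrow> ennreal" where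
  "cov_L2 C c d \<sigma> = (\<integral>\<^sup>+ r\<in>{c..d}. cov_norm2 C (\<sigma> r) \<partial>lborel)"

definition mean_square :: "'w measure \<Rightarrow> ('w \<Rightarrow> 'h::real_normed_vector) \<Rightarrow> ennreal" where
  "mean_square M X = (\<integral>\<^sup>+ \<omega>. ennreal ((norm (X \<omega>))\<^sup>2) \<partial>M)"

lemma norm_add_square_le: "(norm (x + y))\<^sup>2 \<le> 2 * (norm x)\<^sup>2 + 2 * (norm y)\<^sup>2"
  for x y :: "'h::real_normed_vector"
proof -
  have "(norm (x + y))\<^sup>2 \<le> (norm x + norm y)\<^sup>2" by (intro power_mono norm_triangle_ineq) simp
  also have "\<dots> \<le> 2 * (norm x)\<^sup>2 + 2 * (norm y)\<^sup>2"
    using zero_le_power2[of "norm x - norm y"] by (simp add: power2_sum power2_diff)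
  finally show ?thesis .
qed

lemma mean_square_add_le:
  fixes X Y :: "'w \<Rightarrow> 'h::{real_normed_vector, second_countable_topology}"
  assumes [measurable]: "X \<in> borel_measurable M" "Y \<in> borel_measurable M"
  shows "mean_square M (\<lambda>\<omega>. X \<omega> + Y \<omega>) \<le> 2 * mean_square M X + 2 * mean_square M Y"
proof -
  have "ennreal ((norm (X \<omega> + Y \<omega>))\<^sup>2) \<le> 2 * ennreal ((norm (X \<omega>))\<^sup>2) + 2 * ennreal ((norm (Y \<omega>))\<^sup>2)" for \<omega>
    using ennreal_leI[OF norm_add_square_le[of "X \<omega>" "Y \<omega>"]] by (simp add: ennreal_plus ennreal_mult')
  then have "mean_square M (\<lambda>\<omega>. X \<omega> + Y \<omega>)
      \<le> (\<integral>\<^sup>+ \<omega>. 2 * ennreal ((norm (X \<omega>))\<^sup>2) + 2 * ennreal ((norm (Y \<omega>))\<^sup>2) \<partial>M)"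
    unfolding mean_square_def by (intro nn_integral_mono)
  also have "\<dots> = 2 * mean_square M X + 2 * mean_square M Y"
    unfolding mean_square_def by (simp add: nn_integral_add nn_integral_cmult)
  finally show ?thesis .
qed

lemma mean_square_minus: "mean_square M (\<lambda>\<omega>. X \<omega> - Y \<omega>) = mean_square M (\<lambda>\<omega>. Y \<omega> - X \<omega>)"
  unfolding mean_square_def by (simp add: norm_minus_commute)

lemma mean_square_scaleR:
  fixes X :: "'w \<Rightarrow> 'h::{real_normed_vector, second_countable_topology}"
  assumes [measurable]: "X \<in> borel_measurable M"
  shows "mean_square M (\<lambda>\<omega>. c *\<^sub>R X \<omega>) = ennreal (c\<^sup>2) * mean_square M X"
  unfolding mean_square_def
  by (simp add: power_mult_distrib ennreal_mult nn_integral_cmult)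

lemma cov_L2_mono:
  "c' \<le> c \<Longrightarrow> d \<le> d' \<Longrightarrow> cov_L2 C c d \<sigma> \<le> cov_L2 C c' d' \<sigma>"
  unfolding cov_L2_def by (intro nn_integral_mono) (auto split: split_indicator)

lemma cov_L2_cong: "(\<And>r. c \<le> r \<Longrightarrow> r \<le> d \<Longrightarrow> \<sigma> r = \<sigma>' r) \<Longrightarrow> cov_L2 C c d \<sigma> = cov_L2 C c d \<sigma>'"
  unfolding cov_L2_def by (intro nn_integral_cong) (auto split: split_indicator)

context brownian
begin

definition integrand :: "(real \<Rightarrow> 'h \<Rightarrow>\<^sub>L 'h) \<Rightarrow> bool" where
  "integrand \<sigma> \<longleftrightarrow> \<sigma> \<in> borel_measurable (restrict_space borel {a..})"

lemma integrand_sfun [simp]: "integrand (sfun xs)"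
  unfolding integrand_def by (rule borel_measurable_sfun)

lemma integrand_diff_sfun: "integrand \<sigma> \<Longrightarrow> integrand (\<lambda>r. \<sigma> r - sfun xs r)"
  unfolding integrand_def by (rule borel_measurable_diff_sfun)

lemma integrand_minus_sfun: "integrand \<sigma> \<Longrightarrow> integrand (\<lambda>r. sfun xs r - \<sigma> r)"
  unfolding integrand_def
  using borel_measurable_scaleR_second_countable[OF borel_measurable_const borel_measurable_diff_sfun, of \<sigma> "{a..}" "-1" xs]
  by simp

lemma integrand_scaleR: "f \<in> borel_measurable (restrict_space borel {a..}) \<Longrightarrow> integrand \<sigma> \<Longrightarrow> integrand (\<lambda>r. f r *\<^sub>R \<sigma> r)"
  unfolding integrand_def by (rule borel_measurable_scaleR_second_countable)

lemma integrand_indicator: "integrand \<sigma> \<Longrightarrow> integrand (\<lambda>r. indicator {u<..v} r *\<^sub>R \<sigma> r)"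
  by (rule integrand_scaleR) (auto intro!: measurable_restrict_space1)

lemma integrand_cov_measurable:
  assumes "integrand \<sigma>" "a \<le> c"
  shows "(\<lambda>r. cov_norm2 C (\<sigma> r) * indicator {c..d} r) \<in> borel_measurable borel"
proof -
  have "(\<lambda>r. cov_norm2 C (\<sigma> r)) \<in> borel_measurable (restrict_space borel {a..})"
    using assms(1) unfolding integrand_def by (rule measurable_compose[OF _ borel_measurable_cov_norm2])
  then have "(\<lambda>r. cov_norm2 C (\<sigma> r) * indicator {a..} r) \<in> borel_measurable borel"
    by (subst (asm) borel_measurable_restrict_space_iff_ennreal) auto
  then have "(\<lambda>r. cov_norm2 C (\<sigma> r) * indicator {a..} r * indicator {c..d} r) \<in> borel_measurable borel"
    by (rule borel_measurable_times_ennreal) simp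
  also have "(\<lambda>r. cov_norm2 C (\<sigma> r) * indicator {a..} r * indicator {c..d} r)
     = (\<lambda>r. cov_norm2 C (\<sigma> r) * indicator {c..d} r)"
    using assms(2) by (auto simp: fun_eq_iff split: split_indicator)
  finally show ?thesis .
qed

lemma cov_L2_add_le:
  assumes "integrand f" "integrand g" "a \<le> c"
  shows "cov_L2 C c d (\<lambda>r. f r + g r) \<le> 2 * cov_L2 C c d f + 2 * cov_L2 C c d g"
proof -
  note [measurable] = integrand_cov_measurable[OF assms(1,3), of d] integrand_cov_measurable[OF assms(2,3), of d]
  have "cov_L2 C c d (\<lambda>r. f r + g r) \<le> (\<integral>\<^sup>+ r. 2 * (cov_norm2 C (f r) * indicator {c..d} r)
      + 2 * (cov_norm2 C (g r) * indicator {c..d} r) \<partial>lborel)"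
    unfolding cov_L2_def
    using cov_norm2_add_le[OF covariance] by (intro nn_integral_mono) (auto split: split_indicator)
  also have "\<dots> = 2 * cov_L2 C c d f + 2 * cov_L2 C c d g"
    unfolding cov_L2_def by (simp add: nn_integral_add nn_integral_cmult)
  finally show ?thesis .
qed

lemma cov_L2_minus: "cov_L2 C c d (\<lambda>r. f r - g r) = cov_L2 C c d (\<lambda>r. g r - f r)"
  unfolding cov_L2_def by (simp add: cov_norm2_diff_commute[of C "f _"])

text \<open>The bound is asked for only on \<open>(c, d]\<close>, because the step functions it is
  applied to vanish at the left end, which is a null set.\<close>

lemma cov_L2_scaleR_le:
  assumes "integrand \<sigma>" "a \<le> c" "\<And>r. c < r \<Longrightarrow> r \<le> d \<Longrightarrow> \<bar>f r\<bar> \<le> K"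
  shows "cov_L2 C c d (\<lambda>r. f r *\<^sub>R \<sigma> r) \<le> ennreal (K\<^sup>2) * cov_L2 C c d \<sigma>"
proof -
  have "(f r)\<^sup>2 \<le> K\<^sup>2" if "c < r" "r \<le> d" for r
    using assms(3)[OF that] by (metis abs_ge_zero order_trans power2_abs power_mono)
  then have "cov_L2 C c d (\<lambda>r. f r *\<^sub>R \<sigma> r)
      \<le> (\<integral>\<^sup>+ r. ennreal (K\<^sup>2) * (cov_norm2 C (\<sigma> r) * indicator {c..d} r) \<partial>lborel)"
    unfolding cov_L2_def cov_norm2_scaleR
    by (intro nn_integral_mono_AE eventually_mono[OF AE_lborel_singleton[of c]])
      (auto split: split_indicator intro!: mult_right_mono ennreal_leI)
  also have "\<dots> = ennreal (K\<^sup>2) * cov_L2 C c d \<sigma>"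
    unfolding cov_L2_def using integrand_cov_measurable[OF assms(1,2), of d] by (intro nn_integral_cmult) simp
  finally show ?thesis .
qed

text \<open>Working form of the definition: one step list that is close in both senses at once, in
  place of two limits along a sequence of partitions. The sequence is recovered from the errors
  \<open>inverse (real (Suc k))\<close>.\<close>

lemma has_stoch_integral_iff:
  assumes ac: "a \<le> c" and cd: "c \<le> d"
  shows "has_stoch_integral M C W \<sigma> c d I \<longleftrightarrow> I \<in> borel_measurable M \<and>
    (\<forall>e>0. \<exists>xs. steps_in c d xs \<and> cov_L2 C c d (\<lambda>r. \<sigma> r - sfun xs r) \<le> ennreal e \<and>
       mean_square M (\<lambda>\<omega>. I \<omega> - sint xs W \<omega>) \<le> ennreal e)" (is "?L \<longleftrightarrow> ?R")
proof
  assume L: ?L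
  then obtain n p A where part: "\<And>k. partition_of c d (n k) (p k)"
    and 1: "(\<lambda>k. \<integral>\<^sup>+ r\<in>{c..d}. cov_norm2 C (\<sigma> r - elementary (n k) (p k) (A k) r) \<partial>lborel) \<longlonglongrightarrow> 0"
    and 2: "(\<lambda>k. \<integral>\<^sup>+ \<omega>. ennreal ((norm (I \<omega> - elementary_integral (n k) (p k) (A k) W \<omega>))\<^sup>2) \<partial>M) \<longlonglongrightarrow> 0"
    unfolding has_stoch_integral_def by blast
  show ?R
  proof (intro conjI allI impI)
    show "I \<in> borel_measurable M" using L unfolding has_stoch_integral_def by blast
    fix e :: real assume "0 < e"
    then have "0 < ennreal e" by simp
    from order_tendstoD(2)[OF 1 this] order_tendstoD(2)[OF 2 this]
    have "\<forall>\<^sub>F k in sequentially.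
        (\<integral>\<^sup>+ r\<in>{c..d}. cov_norm2 C (\<sigma> r - elementary (n k) (p k) (A k) r) \<partial>lborel) < ennreal e \<and>
        (\<integral>\<^sup>+ \<omega>. ennreal ((norm (I \<omega> - elementary_integral (n k) (p k) (A k) W \<omega>))\<^sup>2) \<partial>M) < ennreal e"
      by (rule eventually_conj)
    then obtain k where k:
        "(\<integral>\<^sup>+ r\<in>{c..d}. cov_norm2 C (\<sigma> r - elementary (n k) (p k) (A k) r) \<partial>lborel) < ennreal e"
        "(\<integral>\<^sup>+ \<omega>. ennreal ((norm (I \<omega> - elementary_integral (n k) (p k) (A k) W \<omega>))\<^sup>2) \<partial>M) < ennreal e"
      using eventually_happens'[OF sequentially_bot] by blast
    obtain xs where xs: "steps_in c d xs" "elementary (n k) (p k) (A k) = sfun xs"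
      "\<forall>(W :: real \<Rightarrow> 'w \<Rightarrow> 'h) \<omega>. elementary_integral (n k) (p k) (A k) W \<omega> = sint xs W \<omega>"
      using partition_as_steps[OF part] by blast
    show "\<exists>xs. steps_in c d xs \<and> cov_L2 C c d (\<lambda>r. \<sigma> r - sfun xs r) \<le> ennreal e \<and>
       mean_square M (\<lambda>\<omega>. I \<omega> - sint xs W \<omega>) \<le> ennreal e"
      using k xs unfolding cov_L2_def mean_square_def by (intro exI[of _ xs]) (auto intro: less_imp_le)
  qed
next
  assume R: ?R
  have "\<exists>xs. steps_in c d xs \<and> cov_L2 C c d (\<lambda>r. \<sigma> r - sfun xs r) \<le> ennreal (inverse (real (Suc k))) \<and>
       mean_square M (\<lambda>\<omega>. I \<omega> - sint xs W \<omega>) \<le> ennreal (inverse (real (Suc k)))" for k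
    using R by simp
  then obtain xs where xs: "\<And>k. steps_in c d (xs k)"
      "\<And>k. cov_L2 C c d (\<lambda>r. \<sigma> r - sfun (xs k) r) \<le> ennreal (inverse (real (Suc k)))"
      "\<And>k. mean_square M (\<lambda>\<omega>. I \<omega> - sint (xs k) W \<omega>) \<le> ennreal (inverse (real (Suc k)))" by metis
  have "\<exists>n p A. partition_of c d n p \<and> elementary n p A = sfun (xs k) \<and>
    (\<forall>(W :: real \<Rightarrow> 'w \<Rightarrow> 'h) \<omega>. elementary_integral n p A W \<omega> = sint (xs k) W \<omega>)" for k
    by (rule steps_as_partition[OF cd xs(1)])
  then obtain n p A where npA: "\<And>k. partition_of c d (n k) (p k)" "\<And>k. elementary (n k) (p k) (A k) = sfun (xs k)"
    "\<And>k (W :: real \<Rightarrow> 'w \<Rightarrow> 'h) \<omega>. elementary_integral (n k) (p k) (A k) W \<omega> = sint (xs k) W \<omega>"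
    by metis
  have lim: "(\<lambda>k. ennreal (inverse (real (Suc k)))) \<longlonglongrightarrow> 0"
    using tendsto_ennrealI[OF LIMSEQ_inverse_real_of_nat] by simp
  show ?L
    unfolding has_stoch_integral_def
  proof (intro conjI exI allI)
    show "I \<in> borel_measurable M" using R by blast
    show "partition_of c d (n k) (p k)" for k by fact
    show "(\<lambda>k. \<integral>\<^sup>+ r\<in>{c..d}. cov_norm2 C (\<sigma> r - elementary (n k) (p k) (A k) r) \<partial>lborel) \<longlonglongrightarrow> 0"
      by (rule tendsto_sandwich[OF _ _ tendsto_const lim])
        (use xs(2) in \<open>simp_all add: npA cov_L2_def\<close>)
    show "(\<lambda>k. \<integral>\<^sup>+ \<omega>. ennreal ((norm (I \<omega> - elementary_integral (n k) (p k) (A k) W \<omega>))\<^sup>2) \<partial>M) \<longlonglongrightarrow> 0"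
      by (rule tendsto_sandwich[OF _ _ tendsto_const lim])
        (use xs(3) in \<open>simp_all add: npA mean_square_def\<close>)
  qed
qed

lemma has_stoch_integral_measurable: "has_stoch_integral M C W \<sigma> c d I \<Longrightarrow> I \<in> borel_measurable M"
  unfolding has_stoch_integral_def by blast

lemma has_stoch_integral_approx:
  assumes "has_stoch_integral M C W \<sigma> c d I" "a \<le> c" "c \<le> d" "0 < e"
  obtains xs where "steps_in c d xs" "cov_L2 C c d (\<lambda>r. \<sigma> r - sfun xs r) \<le> ennreal e"
    "mean_square M (\<lambda>\<omega>. I \<omega> - sint xs W \<omega>) \<le> ennreal e"
  using assms(1,4) unfolding has_stoch_integral_iff[OF assms(2,3)] by blast

lemma has_stoch_integral_sfun:
  assumes "steps_in c d xs" "a \<le> c" "c \<le> d"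
  shows "has_stoch_integral M C W (sfun xs) c d (sint xs W)"
  unfolding has_stoch_integral_iff[OF assms(2,3)]
  using assms(1) sint_measurable[OF assms] by (auto simp: cov_L2_def mean_square_def intro!: exI[of _ xs])

lemma has_stoch_integral_cong:
  assumes "has_stoch_integral M C W \<sigma> c d I" "a \<le> c" "c \<le> d"
    "\<And>r. c \<le> r \<Longrightarrow> r \<le> d \<Longrightarrow> \<sigma> r = \<sigma>' r" "I' \<in> borel_measurable M" "AE \<omega> in M. I \<omega> = I' \<omega>"
  shows "has_stoch_integral M C W \<sigma>' c d I'"
proof -
  have "cov_L2 C c d (\<lambda>r. \<sigma>' r - f r) = cov_L2 C c d (\<lambda>r. \<sigma> r - f r)" for f
    by (rule cov_L2_cong) (simp add: assms(4))
  moreover have "mean_square M (\<lambda>\<omega>. I' \<omega> - f \<omega>) = mean_square M (\<lambda>\<omega>. I \<omega> - f \<omega>)" for f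
    unfolding mean_square_def using assms(6) by (intro nn_integral_cong_AE) auto
  ultimately show ?thesis using assms(1,5) unfolding has_stoch_integral_iff[OF assms(2,3)] by simp
qed

lemma has_stoch_integral_add:
  assumes "has_stoch_integral M C W \<sigma> c d I" "has_stoch_integral M C W \<sigma>' c d I'"
    and ac: "a \<le> c" "c \<le> d" and m: "integrand \<sigma>" "integrand \<sigma>'"
  shows "has_stoch_integral M C W (\<lambda>r. \<sigma> r + \<sigma>' r) c d (\<lambda>\<omega>. I \<omega> + I' \<omega>)"
  unfolding has_stoch_integral_iff[OF ac]
proof (intro conjI allI impI)
  have [measurable]: "I \<in> borel_measurable M" "I' \<in> borel_measurable M"
    using assms has_stoch_integral_measurable by blast+
  show "(\<lambda>\<omega>. I \<omega> + I' \<omega>) \<in> borel_measurable M" by measurable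
  fix e :: real assume e: "0 < e"
  \<comment> \<open>Quarters, because the two-term estimates double each of two errors.\<close>
  then have e4: "0 < e / 4" by simp
  obtain xs where xs: "steps_in c d xs" "cov_L2 C c d (\<lambda>r. \<sigma> r - sfun xs r) \<le> ennreal (e/4)"
    "mean_square M (\<lambda>\<omega>. I \<omega> - sint xs W \<omega>) \<le> ennreal (e/4)"
    by (rule has_stoch_integral_approx[OF assms(1) ac e4])
  obtain ys where ys: "steps_in c d ys" "cov_L2 C c d (\<lambda>r. \<sigma>' r - sfun ys r) \<le> ennreal (e/4)"
    "mean_square M (\<lambda>\<omega>. I' \<omega> - sint ys W \<omega>) \<le> ennreal (e/4)"
    by (rule has_stoch_integral_approx[OF assms(2) ac e4])
  have ee: "2 * ennreal (e/4) + 2 * ennreal (e/4) = ennreal e"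
    using e by (simp add: ennreal_plus[symmetric] ennreal_mult'[symmetric] flip: ennreal_numeral)
  note [measurable] = sint_measurable[OF xs(1) ac] sint_measurable[OF ys(1) ac]
  have "cov_L2 C c d (\<lambda>r. (\<sigma> r - sfun xs r) + (\<sigma>' r - sfun ys r)) \<le> 2 * ennreal (e/4) + 2 * ennreal (e/4)"
    using xs ys by (intro order_trans[OF cov_L2_add_le[OF integrand_diff_sfun integrand_diff_sfun]] add_mono mult_left_mono m ac) auto
  moreover have "mean_square M (\<lambda>\<omega>. (I \<omega> - sint xs W \<omega>) + (I' \<omega> - sint ys W \<omega>)) \<le> 2 * ennreal (e/4) + 2 * ennreal (e/4)"
    using xs ys by (intro order_trans[OF mean_square_add_le] add_mono mult_left_mono) auto
  ultimately show "\<exists>xs. steps_in c d xs \<and> cov_L2 C c d (\<lambda>r. \<sigma> r + \<sigma>' r - sfun xs r) \<le> ennreal e \<and>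
       mean_square M (\<lambda>\<omega>. I \<omega> + I' \<omega> - sint xs W \<omega>) \<le> ennreal e"
    using xs(1) ys(1) unfolding ee by (intro exI[of _ "xs @ ys"]) (simp add: algebra_simps)
qed

lemma has_stoch_integral_scaleR:
  assumes I: "has_stoch_integral M C W \<sigma> c d I" and ac: "a \<le> c" "c \<le> d" and m: "integrand \<sigma>"
  shows "has_stoch_integral M C W (\<lambda>r. k *\<^sub>R \<sigma> r) c d (\<lambda>\<omega>. k *\<^sub>R I \<omega>)"
  unfolding has_stoch_integral_iff[OF ac]
proof (intro conjI allI impI)
  have [measurable]: "I \<in> borel_measurable M" using I has_stoch_integral_measurable by blast
  show "(\<lambda>\<omega>. k *\<^sub>R I \<omega>) \<in> borel_measurable M" by measurable
  fix e :: real assume e: "0 < e"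
  have k1: "0 < k\<^sup>2 + 1" by (simp add: add_nonneg_pos)
  define e' where "e' = e / (k\<^sup>2 + 1)"
  have e': "0 < e'" using e k1 by (simp add: e'_def)
  have "k\<^sup>2 * e' \<le> (k\<^sup>2 + 1) * e'" using e' by (intro mult_right_mono) auto
  then have ke: "ennreal (k\<^sup>2) * ennreal e' \<le> ennreal e"
    using k1 e' by (simp add: ennreal_mult'[symmetric] ennreal_leI e'_def)
  obtain xs where xs: "steps_in c d xs" "cov_L2 C c d (\<lambda>r. \<sigma> r - sfun xs r) \<le> ennreal e'"
    "mean_square M (\<lambda>\<omega>. I \<omega> - sint xs W \<omega>) \<le> ennreal e'"
    by (rule has_stoch_integral_approx[OF I ac e'])
  note [measurable] = sint_measurable[OF xs(1) ac]
  have "cov_L2 C c d (\<lambda>r. k *\<^sub>R (\<sigma> r - sfun xs r)) \<le> ennreal (\<bar>k\<bar>\<^sup>2) * cov_L2 C c d (\<lambda>r. \<sigma> r - sfun xs r)"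
    by (rule cov_L2_scaleR_le[OF integrand_diff_sfun[OF m] ac(1)]) simp
  also have "\<dots> \<le> ennreal (k\<^sup>2) * ennreal e'" using xs(2) by (simp add: mult_left_mono)
  also note ke
  finally have 1: "cov_L2 C c d (\<lambda>r. k *\<^sub>R (\<sigma> r - sfun xs r)) \<le> ennreal e" .
  have "mean_square M (\<lambda>\<omega>. k *\<^sub>R (I \<omega> - sint xs W \<omega>)) \<le> ennreal (k\<^sup>2) * ennreal e'"
    by (subst mean_square_scaleR) (use xs(3) in \<open>auto intro: mult_left_mono\<close>)
  also note ke
  finally have 2: "mean_square M (\<lambda>\<omega>. k *\<^sub>R (I \<omega> - sint xs W \<omega>)) \<le> ennreal e" .
  show "\<exists>xs. steps_in c d xs \<and> cov_L2 C c d (\<lambda>r. k *\<^sub>R \<sigma> r - sfun xs r) \<le> ennreal e \<and>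
       mean_square M (\<lambda>\<omega>. k *\<^sub>R I \<omega> - sint xs W \<omega>) \<le> ennreal e"
    using xs(1) 1 2 by (intro exI[of _ "scale_steps k xs"]) (simp add: scaleR_diff_right)
qed

lemma has_stoch_integral_diff:
  assumes "has_stoch_integral M C W \<sigma> c d I" "has_stoch_integral M C W \<sigma>' c d I'"
    and ac: "a \<le> c" "c \<le> d" and m: "integrand \<sigma>" "integrand \<sigma>'"
  shows "has_stoch_integral M C W (\<lambda>r. \<sigma> r - \<sigma>' r) c d (\<lambda>\<omega>. I \<omega> - I' \<omega>)"
proof -
  have "integrand (\<lambda>r. (-1) *\<^sub>R \<sigma>' r)" by (intro integrand_scaleR m) simp
  from has_stoch_integral_add[OF assms(1) has_stoch_integral_scaleR[OF assms(2) ac m(2), of "-1"] ac m(1) this]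
  show ?thesis by simp
qed

text \<open>The constant 4 comes from passing to a step integrand and back, each passage doubling
  the square. The approximation error is thereby counted two and four times, which explains the
  sixths.\<close>

lemma has_stoch_integral_isometry_le:
  assumes I: "has_stoch_integral M C W \<sigma> c d I" and ac: "a \<le> c" "c \<le> d" and m: "integrand \<sigma>"
  shows "mean_square M I \<le> 4 * cov_L2 C c d \<sigma>"
proof (rule ennreal_le_epsilon)
  fix e :: real assume e: "0 < e"
  then have e6: "0 < e / 6" by simp
  obtain xs where xs: "steps_in c d xs" "cov_L2 C c d (\<lambda>r. \<sigma> r - sfun xs r) \<le> ennreal (e/6)"
    "mean_square M (\<lambda>\<omega>. I \<omega> - sint xs W \<omega>) \<le> ennreal (e/6)"
    by (rule has_stoch_integral_approx[OF I ac e6])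
  note [measurable] = sint_measurable[OF xs(1) ac] has_stoch_integral_measurable[OF I]
  have 1: "cov_L2 C c d (sfun xs) \<le> 2 * ennreal (e/6) + 2 * cov_L2 C c d \<sigma>"
  proof -
    have "cov_L2 C c d (sfun xs) = cov_L2 C c d (\<lambda>r. (sfun xs r - \<sigma> r) + \<sigma> r)" by simp
    also have "\<dots> \<le> 2 * cov_L2 C c d (\<lambda>r. sfun xs r - \<sigma> r) + 2 * cov_L2 C c d \<sigma>"
      by (rule cov_L2_add_le[OF integrand_minus_sfun[OF m] m ac(1)])
    also have "\<dots> \<le> 2 * ennreal (e/6) + 2 * cov_L2 C c d \<sigma>"
      using xs(2) by (subst cov_L2_minus) (intro add_right_mono mult_left_mono, auto)
    finally show ?thesis .
  qed
  have "mean_square M I = mean_square M (\<lambda>\<omega>. (I \<omega> - sint xs W \<omega>) + sint xs W \<omega>)" by simp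
  also have "\<dots> \<le> 2 * mean_square M (\<lambda>\<omega>. I \<omega> - sint xs W \<omega>) + 2 * mean_square M (sint xs W)"
    by (rule mean_square_add_le) measurable
  also have "\<dots> \<le> 2 * ennreal (e/6) + 2 * (2 * ennreal (e/6) + 2 * cov_L2 C c d \<sigma>)"
    using sint_isometry_le[OF xs(1) ac, folded cov_L2_def mean_square_def] xs(3) 1
    by (intro add_mono mult_left_mono) auto
  also have "\<dots> = 4 * cov_L2 C c d \<sigma> + (2 * ennreal (e/6) + 4 * ennreal (e/6))"
    by (simp add: distrib_left mult.assoc[symmetric] ac_simps)
  also have "2 * ennreal (e/6) + 4 * ennreal (e/6) = ennreal e"
    using e by (simp add: ennreal_plus[symmetric] ennreal_mult'[symmetric] flip: ennreal_numeral)
  finally show "mean_square M I \<le> 4 * cov_L2 C c d \<sigma> + ennreal e" .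
qed

text \<open>The difference of two versions is an integral of zero, which the isometry bound forces
  to vanish.\<close>

lemma has_stoch_integral_unique:
  assumes I: "has_stoch_integral M C W \<sigma> c d I" "has_stoch_integral M C W \<sigma> c d I'"
    and ac: "a \<le> c" "c \<le> d" and m: "integrand \<sigma>"
  shows "AE \<omega> in M. I \<omega> = I' \<omega>"
proof -
  note [measurable] = has_stoch_integral_measurable[OF I(1)] has_stoch_integral_measurable[OF I(2)]
  have D: "has_stoch_integral M C W (\<lambda>r. 0) c d (\<lambda>\<omega>. I \<omega> - I' \<omega>)"
    using has_stoch_integral_diff[OF I ac m m] by simp
  have "integrand (\<lambda>r. 0)" unfolding integrand_def by simp
  from has_stoch_integral_isometry_le[OF D ac this]
  have "(\<integral>\<^sup>+ \<omega>. ennreal ((norm (I \<omega> - I' \<omega>))\<^sup>2) \<partial>M) = 0"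
    by (simp add: mean_square_def cov_L2_def)
  then have "AE \<omega> in M. ennreal ((norm (I \<omega> - I' \<omega>))\<^sup>2) = 0"
    by (subst (asm) nn_integral_0_iff_AE) auto
  then show ?thesis by eventually_elim simp
qed

text \<open>The graph of the integral is closed. The approximants may be any integrands with known
  integrals, so later limits do not have to go back to step functions.\<close>

lemma has_stoch_integral_closure:
  assumes ac: "a \<le> c" "c \<le> d" and [measurable]: "I \<in> borel_measurable M"
    and approx: "\<And>e. 0 < e \<Longrightarrow> \<exists>\<sigma>' I'. has_stoch_integral M C W \<sigma>' c d I' \<and> integrand \<sigma>' \<and> integrand (\<lambda>r. \<sigma> r - \<sigma>' r) \<and>
      cov_L2 C c d (\<lambda>r. \<sigma> r - \<sigma>' r) \<le> ennreal e \<and> mean_square M (\<lambda>\<omega>. I \<omega> - I' \<omega>) \<le> ennreal e"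
  shows "has_stoch_integral M C W \<sigma> c d I"
  unfolding has_stoch_integral_iff[OF ac]
proof (intro conjI allI impI assms)
  fix e :: real assume e: "0 < e"
  then have e4: "0 < e / 4" by simp
  from approx[OF e4] obtain \<sigma>' I' where
    I': "has_stoch_integral M C W \<sigma>' c d I'" "integrand \<sigma>'" "integrand (\<lambda>r. \<sigma> r - \<sigma>' r)"
      "cov_L2 C c d (\<lambda>r. \<sigma> r - \<sigma>' r) \<le> ennreal (e/4)" "mean_square M (\<lambda>\<omega>. I \<omega> - I' \<omega>) \<le> ennreal (e/4)"
    by blast
  obtain xs where xs: "steps_in c d xs" "cov_L2 C c d (\<lambda>r. \<sigma>' r - sfun xs r) \<le> ennreal (e/4)"
    "mean_square M (\<lambda>\<omega>. I' \<omega> - sint xs W \<omega>) \<le> ennreal (e/4)"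
    by (rule has_stoch_integral_approx[OF I'(1) ac e4])
  note [measurable] = sint_measurable[OF xs(1) ac] has_stoch_integral_measurable[OF I'(1)]
  have ee: "2 * ennreal (e/4) + 2 * ennreal (e/4) = ennreal e"
    using e by (simp add: ennreal_plus[symmetric] ennreal_mult'[symmetric] flip: ennreal_numeral)
  have "cov_L2 C c d (\<lambda>r. (\<sigma> r - \<sigma>' r) + (\<sigma>' r - sfun xs r)) \<le> 2 * ennreal (e/4) + 2 * ennreal (e/4)"
    using xs I' by (intro order_trans[OF cov_L2_add_le[OF _ integrand_diff_sfun]] add_mono mult_left_mono ac) auto
  moreover have "mean_square M (\<lambda>\<omega>. (I \<omega> - I' \<omega>) + (I' \<omega> - sint xs W \<omega>)) \<le> 2 * ennreal (e/4) + 2 * ennreal (e/4)"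
    using xs I' by (intro order_trans[OF mean_square_add_le] add_mono mult_left_mono) auto
  ultimately show "\<exists>xs. steps_in c d xs \<and> cov_L2 C c d (\<lambda>r. \<sigma> r - sfun xs r) \<le> ennreal e \<and>
       mean_square M (\<lambda>\<omega>. I \<omega> - sint xs W \<omega>) \<le> ennreal e"
    using xs(1) unfolding ee by (intro exI[of _ xs]) simp
qed

text \<open>One approximation of \<open>\<sigma>\<close> on \<open>[c, v]\<close> is split at
  \<open>u\<close>. Its part before \<open>u\<close> approximates \<open>Iu\<close> by the isometry,
  hence the rest approximates \<open>Iv - Iu\<close>. The surrounding interval
  \<open>[c', d']\<close> only has to contain \<open>(u, v]\<close>.\<close>

lemma has_stoch_integral_interval:
  assumes Iu: "has_stoch_integral M C W \<sigma> c u Iu" and Iv: "has_stoch_integral M C W \<sigma> c v Iv"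
    and ord: "a \<le> c" "c \<le> u" "u \<le> v" "a \<le> c'" "c' \<le> u" "v \<le> d'" and m: "integrand \<sigma>"
  shows "has_stoch_integral M C W (\<lambda>r. indicator {u<..v} r *\<^sub>R \<sigma> r) c' d' (\<lambda>\<omega>. Iv \<omega> - Iu \<omega>)"
proof -
  have c'd': "c' \<le> d'" and cv: "c \<le> v" using ord by auto
  note [measurable] = has_stoch_integral_measurable[OF Iu] has_stoch_integral_measurable[OF Iv]
  show ?thesis
    unfolding has_stoch_integral_iff[OF ord(4) c'd']
  proof (intro conjI allI impI)
    fix e :: real assume e: "0 < e"
    \<comment> \<open>Tenths: the error at \<open>v\<close> is doubled, and the one at
      \<open>u\<close> carries the isometry constant 4 and is doubled as well, 2 + 8 = 10.\<close>
    then have e10: "0 < e / 10" by simp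
    obtain xs where xs: "steps_in c v xs" "cov_L2 C c v (\<lambda>r. \<sigma> r - sfun xs r) \<le> ennreal (e/10)"
      "mean_square M (\<lambda>\<omega>. Iv \<omega> - sint xs W \<omega>) \<le> ennreal (e/10)"
      by (rule has_stoch_integral_approx[OF Iv ord(1) cv e10])
    define ys where "ys = clamp_steps u v xs"
    define zs where "zs = clamp_steps c u xs"
    have ys: "steps_in u v ys" unfolding ys_def by (rule steps_in_clamp_steps[OF ord(3) xs(1)])
    have zs: "steps_in c u zs" unfolding zs_def by (rule steps_in_clamp_steps[OF ord(2) xs(1)])
    have au: "a \<le> u" using ord by simp
    note [measurable] = sint_measurable[OF xs(1) ord(1) cv] sint_measurable[OF ys au ord(3)]
      sint_measurable[OF zs ord(1,2)]
    have "cov_L2 C c' d' (\<lambda>r. indicator {u<..v} r *\<^sub>R \<sigma> r - sfun ys r) \<le> cov_L2 C c v (\<lambda>r. \<sigma> r - sfun xs r)"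
      unfolding cov_L2_def ys_def sfun_clamp_steps[OF ord(3)] using ord
      by (intro nn_integral_mono) (auto split: split_indicator)
    also have "\<dots> \<le> ennreal e" using xs(2) e by (auto elim!: order_trans intro!: ennreal_leI)
    finally have 1: "cov_L2 C c' d' (\<lambda>r. indicator {u<..v} r *\<^sub>R \<sigma> r - sfun ys r) \<le> ennreal e" .
    have 2: "mean_square M (\<lambda>\<omega>. Iu \<omega> - sint zs W \<omega>) \<le> 4 * cov_L2 C c u (\<lambda>r. \<sigma> r - sfun zs r)"
      by (intro has_stoch_integral_isometry_le[OF has_stoch_integral_diff[OF Iu has_stoch_integral_sfun[OF zs]]]
          integrand_diff_sfun m ord integrand_sfun)
    \<comment> \<open>At \<open>r = c\<close> the clamped list vanishes; so does the original one,
      its intervals being left-open.\<close>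
    have "cov_L2 C c u (\<lambda>r. \<sigma> r - sfun zs r) = cov_L2 C c u (\<lambda>r. \<sigma> r - sfun xs r)"
    proof (rule cov_L2_cong)
      fix r assume "c \<le> r" "r \<le> u"
      then show "\<sigma> r - sfun zs r = \<sigma> r - sfun xs r"
        using sfun_at_start[OF xs(1)]
        by (cases "r = c") (auto simp: zs_def sfun_clamp_steps[OF ord(2)])
    qed
    also have "\<dots> \<le> cov_L2 C c v (\<lambda>r. \<sigma> r - sfun xs r)" using ord by (intro cov_L2_mono) auto
    also note xs(2)
    finally have "4 * cov_L2 C c u (\<lambda>r. \<sigma> r - sfun zs r) \<le> 4 * ennreal (e/10)"
      by (rule mult_left_mono) simp
    with 2 have "mean_square M (\<lambda>\<omega>. Iu \<omega> - sint zs W \<omega>) \<le> 4 * ennreal (e/10)"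
      by (rule order_trans)
    then have "mean_square M (\<lambda>\<omega>. (Iv \<omega> - sint xs W \<omega>) + (sint zs W \<omega> - Iu \<omega>)) \<le> 2 * ennreal (e/10) + 2 * (4 * ennreal (e/10))"
      using xs by (intro order_trans[OF mean_square_add_le] add_mono mult_left_mono)
        (auto simp: mean_square_minus[of M "sint zs W"])
    also have "\<dots> = ennreal e"
      using e by (simp add: ennreal_plus[symmetric] ennreal_mult'[symmetric] flip: ennreal_numeral)
    also have "(\<lambda>\<omega>. (Iv \<omega> - sint xs W \<omega>) + (sint zs W \<omega> - Iu \<omega>)) = (\<lambda>\<omega>. Iv \<omega> - Iu \<omega> - sint ys W \<omega>)"
      using sint_clamp_steps_combine[OF xs(1) ord(2,3), of W, folded ys_def zs_def]
      by (auto simp: fun_eq_iff algebra_simps)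
    finally show "\<exists>xs. steps_in c' d' xs \<and> cov_L2 C c' d' (\<lambda>r. indicator {u<..v} r *\<^sub>R \<sigma> r - sfun xs r) \<le> ennreal e \<and>
       mean_square M (\<lambda>\<omega>. Iv \<omega> - Iu \<omega> - sint xs W \<omega>) \<le> ennreal e"
      using 1 steps_in_mono[OF ys ord(5,6)] by blast
  qed measurable
qed

text \<open>A probabilistic argument replaces the square root of \<open>C\<close>: the form of
  \<open>C\<close> at \<open>adj A b\<close> is the second moment of a coordinate of
  \<open>A\<close> applied to a unit-time increment \<open>\<xi>\<close>, Bessel's inequality sums
  these coordinates, and the mean square of \<open>\<xi>\<close> is at most the trace of
  \<open>C\<close>.\<close>

lemma cov_norm2_finite: "cov_norm2 C A < \<infinity>"
proof -
  define \<xi> where "\<xi> \<omega> = W (a + 1) \<omega> - W a \<omega>" for \<omega>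
  have [measurable]: "\<xi> \<in> borel_measurable M" unfolding \<xi>_def
    by (intro borel_measurable_diff W_measurable) auto
  have "mean_square M \<xi> = mean_square M (sint [(id_blinfun, a, a + 1)] W)"
    unfolding mean_square_def \<xi>_def by simp
  also have "\<dots> \<le> cov_L2 C a (a + 1) (sfun [(id_blinfun, a, a + 1)])"
    unfolding mean_square_def cov_L2_def by (rule sint_isometry_le) auto
  also have "\<dots> \<le> (\<integral>\<^sup>+ r. op_trace (blinfun_apply C) * indicator {a..a+1} r \<partial>lborel)"
    unfolding cov_L2_def cov_norm2_id[symmetric]
    by (intro nn_integral_mono) (auto split: split_indicator)
  also have "\<dots> = op_trace (blinfun_apply C)" by (simp add: nn_integral_cmult_indicator)
  finally have \<xi>: "mean_square M \<xi> \<le> op_trace (blinfun_apply C)" .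
  have "cov_norm2 C A \<le> ennreal ((norm A)\<^sup>2) * op_trace (blinfun_apply C)"
    unfolding cov_norm2_eq
  proof (rule SUP_least)
    fix B :: "'h set" assume "B \<in> {B. orthonormal B}"
    then have B: "orthonormal B" by simp
    have one: "ennreal (q (adj A b)) = (\<integral>\<^sup>+ \<omega>. ennreal ((inner (blinfun_apply A (\<xi> \<omega>)) b)\<^sup>2) \<partial>M)" for b
      unfolding inner_adj[of A] \<xi>_def
      using increment_moments(2,4)[of a "a + 1" "adj A b"] by (subst nn_integral_eq_integral) auto
    have "(\<Sum>b\<in>B. ennreal (q (adj A b))) = (\<integral>\<^sup>+ \<omega>. (\<Sum>b\<in>B. ennreal ((inner (blinfun_apply A (\<xi> \<omega>)) b)\<^sup>2)) \<partial>M)"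
    proof -
      have [measurable]: "(\<lambda>\<omega>. blinfun_apply A (\<xi> \<omega>)) \<in> borel_measurable M"
        by (rule borel_measurable_blinfun_apply) fact
      show ?thesis unfolding one by (intro nn_integral_sum[symmetric]) measurable
    qed
    also have "\<dots> \<le> (\<integral>\<^sup>+ \<omega>. ennreal ((norm A)\<^sup>2) * ennreal ((norm (\<xi> \<omega>))\<^sup>2) \<partial>M)"
    proof (rule nn_integral_mono)
      fix \<omega>
      have "(\<Sum>b\<in>B. (inner (blinfun_apply A (\<xi> \<omega>)) b)\<^sup>2) \<le> (norm (blinfun_apply A (\<xi> \<omega>)))\<^sup>2"
        by (rule bessel[OF B])
      also have "\<dots> \<le> (norm A * norm (\<xi> \<omega>))\<^sup>2" by (intro power_mono norm_blinfun) auto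
      finally show "(\<Sum>b\<in>B. ennreal ((inner (blinfun_apply A (\<xi> \<omega>)) b)\<^sup>2)) \<le> ennreal ((norm A)\<^sup>2) * ennreal ((norm (\<xi> \<omega>))\<^sup>2)"
        by (simp add: sum_ennreal ennreal_mult'[symmetric] power_mult_distrib ennreal_leI)
    qed
    also have "\<dots> = ennreal ((norm A)\<^sup>2) * mean_square M \<xi>"
      unfolding mean_square_def by (intro nn_integral_cmult) measurable
    also have "\<dots> \<le> ennreal ((norm A)\<^sup>2) * op_trace (blinfun_apply C)" by (intro mult_left_mono \<xi>) simp
    finally show "(\<Sum>b\<in>B. ennreal (q (adj A b))) \<le> ennreal ((norm A)\<^sup>2) * op_trace (blinfun_apply C)" .
  qed
  also have "\<dots> < \<infinity>"
    using covariance unfolding covariance_operator_def by (simp add: ennreal_mult_less_top)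
  finally show ?thesis .
qed

lemma cov_L2_sfun_finite: "a \<le> c \<Longrightarrow> cov_L2 C c d (sfun xs) < \<infinity>"
proof (induction xs)
  case (Cons x xs)
  obtain A u v where x: "x = (A, u, v)" by (cases x) auto
  have "cov_L2 C c d (sfun [x]) \<le> (\<integral>\<^sup>+ r. cov_norm2 C A * indicator {c..d} r \<partial>lborel)"
    unfolding cov_L2_def x by (intro nn_integral_mono) (auto split: split_indicator)
  also have "\<dots> = cov_norm2 C A * emeasure lborel {c..d}" by (simp add: nn_integral_cmult_indicator)
  also have "\<dots> < \<infinity>"
    using cov_norm2_finite[of A] emeasure_compact_finite[of "{c..d}"] by (auto simp: ennreal_mult_less_top)
  finally have fin: "cov_L2 C c d (sfun [x]) < \<infinity>" .
  have "cov_L2 C c d (sfun (x # xs)) = cov_L2 C c d (\<lambda>r. sfun [x] r + sfun xs r)"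
    by (rule cov_L2_cong) (simp add: x)
  also have "\<dots> \<le> 2 * cov_L2 C c d (sfun [x]) + 2 * cov_L2 C c d (sfun xs)"
    by (rule cov_L2_add_le[OF integrand_sfun integrand_sfun Cons.prems])
  also have "\<dots> < \<infinity>" using Cons fin by (auto simp: ennreal_mult_less_top)
  finally show ?case .
next
  case Nil
  show ?case unfolding cov_L2_def by simp
qed

lemma has_stoch_integral_finite:
  assumes I: "has_stoch_integral M C W \<sigma> c d I" and ac: "a \<le> c" "c \<le> d" and m: "integrand \<sigma>"
  shows "cov_L2 C c d \<sigma> < \<infinity>"
proof -
  obtain xs where xs: "steps_in c d xs" "cov_L2 C c d (\<lambda>r. \<sigma> r - sfun xs r) \<le> ennreal 1"
    "mean_square M (\<lambda>\<omega>. I \<omega> - sint xs W \<omega>) \<le> ennreal 1"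
    by (rule has_stoch_integral_approx[OF I ac zero_less_one])
  have "cov_L2 C c d \<sigma> = cov_L2 C c d (\<lambda>r. (\<sigma> r - sfun xs r) + sfun xs r)" by simp
  also have "\<dots> \<le> 2 * cov_L2 C c d (\<lambda>r. \<sigma> r - sfun xs r) + 2 * cov_L2 C c d (sfun xs)"
    by (rule cov_L2_add_le[OF integrand_diff_sfun[OF m] integrand_sfun ac(1)])
  also have "\<dots> < \<infinity>"
    using cov_L2_sfun_finite[OF ac(1), of d xs] le_less_trans[OF xs(2), of \<infinity>]
    by (auto simp: ennreal_mult_less_top)
  finally show ?thesis .
qed

end

section \<open>Riemann-Stieltjes sums\<close>

text \<open>\<open>Suc k\<close> cells, so that every \<open>k\<close> gives a genuine
  partition.\<close>

definition grid :: "real \<Rightarrow> real \<Rightarrow> nat \<Rightarrow> nat \<Rightarrow> real" where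
  "grid c d k i = c + (d - c) * real i / real (Suc k)"

definition RS_sum :: "real \<Rightarrow> real \<Rightarrow> (real \<Rightarrow> real) \<Rightarrow> (real \<Rightarrow> 'v::real_vector) \<Rightarrow> nat \<Rightarrow> 'v" where
  "RS_sum c d \<psi> w k = (\<Sum>i<Suc k. \<psi> (grid c d k i) *\<^sub>R (w (grid c d k (Suc i)) - w (grid c d k i)))"

lemma grid_simps [simp]: "grid c d k 0 = c" "grid c d k (Suc k) = d"
proof -
  show "grid c d k (Suc k) = d"
  proof -
    have "(d - c) * real (Suc k) / real (Suc k) = d - c"
      by (rule nonzero_mult_div_cancel_right) (simp del: of_nat_Suc)
    then show ?thesis unfolding grid_def by linarith
  qed
qed (simp add: grid_def)

lemma grid_mono: "c \<le> d \<Longrightarrow> i \<le> j \<Longrightarrow> grid c d k i \<le> grid c d k j"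
  unfolding grid_def by (intro add_left_mono divide_right_mono mult_left_mono) auto

lemma grid_range: "c \<le> d \<Longrightarrow> i \<le> Suc k \<Longrightarrow> c \<le> grid c d k i \<and> grid c d k i \<le> d"
  using grid_mono[of c d 0 i k] grid_mono[of c d i "Suc k" k] by simp

lemma grid_mesh: "grid c d k (Suc i) - grid c d k i = (d - c) / real (Suc k)"
proof -
  have "(d - c) * real (Suc i) - (d - c) * real i = d - c" by (simp add: algebra_simps)
  then show ?thesis unfolding grid_def add_diff_cancel_left by (simp only: diff_divide_distrib[symmetric])
qed

lemma eventually_mesh:
  assumes "0 < e"
  shows "\<forall>\<^sub>F k in sequentially. (d - c) / real (Suc k) < e"
proof -
  have "(\<lambda>k. (d - c) * inverse (real (Suc k))) \<longlonglongrightarrow> (d - c) * 0"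
    by (intro tendsto_intros LIMSEQ_inverse_real_of_nat)
  then show ?thesis using order_tendstoD(2)[of _ 0 sequentially e] assms
    by (simp add: divide_inverse)
qed

lemma summation_by_parts:
  fixes w :: "nat \<Rightarrow> 'v::real_vector" and \<psi> :: "nat \<Rightarrow> real"
  shows "(\<Sum>i<n. \<psi> i *\<^sub>R (w (Suc i) - w i)) =
    \<psi> n *\<^sub>R w n - \<psi> 0 *\<^sub>R w 0 - (\<Sum>i<n. (\<psi> (Suc i) - \<psi> i) *\<^sub>R w (Suc i))"
  by (induction n) (auto simp: algebra_simps)

text \<open>On each cell the fundamental theorem integrates \<open>\<psi>'\<close> exactly, so the
  only error is the oscillation of \<open>w\<close> there, weighted by \<open>K\<close> and the
  length of the cell.\<close>

lemma riemann_sum_error: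
  fixes w :: "real \<Rightarrow> 'h::{real_inner, complete_space}"
  assumes w: "continuous_on {c..d} w"
    and \<psi>: "\<And>x. x \<in> {c..d} \<Longrightarrow> (\<psi> has_real_derivative \<psi>' x) (at x within {c..d})"
    and \<psi>': "continuous_on {c..d} \<psi>'" "\<And>x. x \<in> {c..d} \<Longrightarrow> \<bar>\<psi>' x\<bar> \<le> K"
    and p: "p 0 = c" "\<And>i. i < n \<Longrightarrow> p i \<le> p (Suc i)" "p n = d"
    and close: "\<And>i x. i < n \<Longrightarrow> p i \<le> x \<Longrightarrow> x \<le> p (Suc i) \<Longrightarrow> norm (w x - w (p (Suc i))) \<le> e"
    and "k \<le> n"
  shows "norm (integral {c..p k} (\<lambda>r. \<psi>' r *\<^sub>R w r) - (\<Sum>i<k. (\<psi> (p (Suc i)) - \<psi> (p i)) *\<^sub>R w (p (Suc i))))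
    \<le> K * e * (p k - c)"
  using \<open>k \<le> n\<close>
proof (induction k)
  case 0
  then show ?case by (simp add: p(1))
next
  case (Suc k)
  have pm: "p i \<le> p j" if "i \<le> j" "j \<le> n" for i j
    using that
  proof (induction j rule: dec_induct)
    case (step k)
    then show ?case using p(2)[of k] by linarith
  qed simp
  have ord: "c \<le> p k" "p k \<le> p (Suc k)" "p (Suc k) \<le> d"
    using pm[of 0 k] pm[of k "Suc k"] pm[of "Suc k" n] Suc.prems p by auto
  have cont: "continuous_on S (\<lambda>r. \<psi>' r *\<^sub>R w r)" if "S \<subseteq> {c..d}" for S
    by (intro continuous_on_scaleR continuous_on_subset[OF w that] continuous_on_subset[OF \<psi>'(1) that])
  define z where "z = w (p (Suc k))"
  have "((\<lambda>r. \<psi>' r *\<^sub>R z) has_integral (\<psi> (p (Suc k)) *\<^sub>R z - \<psi> (p k) *\<^sub>R z)) {p k..p (Suc k)}"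
  proof (rule hilbert_FTC[OF ord(2)])
    fix x assume x: "x \<in> {p k..p (Suc k)}"
    have "(\<psi> has_real_derivative \<psi>' x) (at x within {p k..p (Suc k)})"
      by (rule DERIV_subset[OF \<psi>]) (use x ord in auto)
    then show "((\<lambda>x. \<psi> x *\<^sub>R z) has_vector_derivative \<psi>' x *\<^sub>R z) (at x within {p k..p (Suc k)})"
      by (auto intro!: derivative_eq_intros simp: has_real_derivative_iff_has_vector_derivative)
  qed
  moreover have c2: "((\<lambda>r. \<psi>' r *\<^sub>R w r) has_integral integral {p k..p (Suc k)} (\<lambda>r. \<psi>' r *\<^sub>R w r)) {p k..p (Suc k)}"
    by (intro hilbert_has_integral cont) (use ord in auto)
  ultimately have hi: "((\<lambda>r. \<psi>' r *\<^sub>R w r - \<psi>' r *\<^sub>R z) has_integral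
      (integral {p k..p (Suc k)} (\<lambda>r. \<psi>' r *\<^sub>R w r) - (\<psi> (p (Suc k)) *\<^sub>R z - \<psi> (p k) *\<^sub>R z))) {p k..p (Suc k)}"
    by (intro has_integral_diff)
  have K0: "0 \<le> K" using \<psi>'(2)[of c] ord by fastforce
  have b: "norm (\<psi>' r *\<^sub>R w r - \<psi>' r *\<^sub>R z) \<le> K * e" if "r \<in> {p k..p (Suc k)}" for r
  proof -
    have "\<bar>\<psi>' r\<bar> * norm (w r - z) \<le> K * e"
      using \<psi>'(2)[of r] close[of k r] Suc.prems that ord K0 unfolding z_def
      by (intro mult_mono) auto
    then show ?thesis by (simp add: scaleR_diff_right[symmetric])
  qed
  have e0: "0 \<le> K * e" using b[of "p k"] ord by (auto intro: order_trans[OF norm_ge_zero])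
  have err: "norm (integral {p k..p (Suc k)} (\<lambda>r. \<psi>' r *\<^sub>R w r) - (\<psi> (p (Suc k)) - \<psi> (p k)) *\<^sub>R z)
      \<le> K * e * (p (Suc k) - p k)"
    using has_integral_bound_real[OF e0 finite.emptyI hi] b ord by (simp add: scaleR_diff_left)
  have comb: "integral {c..p k} (\<lambda>r. \<psi>' r *\<^sub>R w r) + integral {p k..p (Suc k)} (\<lambda>r. \<psi>' r *\<^sub>R w r)
    = integral {c..p (Suc k)} (\<lambda>r. \<psi>' r *\<^sub>R w r)"
    by (rule hilbert_integral_combine[OF ord(1,2) cont]) (use ord in auto)
  have "norm (integral {c..p (Suc k)} (\<lambda>r. \<psi>' r *\<^sub>R w r) - (\<Sum>i<Suc k. (\<psi> (p (Suc i)) - \<psi> (p i)) *\<^sub>R w (p (Suc i))))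
    = norm ((integral {c..p k} (\<lambda>r. \<psi>' r *\<^sub>R w r) - (\<Sum>i<k. (\<psi> (p (Suc i)) - \<psi> (p i)) *\<^sub>R w (p (Suc i))))
      + (integral {p k..p (Suc k)} (\<lambda>r. \<psi>' r *\<^sub>R w r) - (\<psi> (p (Suc k)) - \<psi> (p k)) *\<^sub>R z))"
    unfolding comb[symmetric] z_def by (simp add: algebra_simps)
  also have "\<dots> \<le> K * e * (p k - c) + K * e * (p (Suc k) - p k)"
    using Suc by (intro norm_triangle_mono err) auto
  finally show ?case by (simp add: algebra_simps)
qed

text \<open>The path \<open>w\<close> is merely continuous, since Brownian paths have unbounded
  variation. Summation by parts moves the differences to \<open>\<psi>\<close>, after which the sum
  approximates an ordinary integral.\<close>

lemma RS_sum_tendsto: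
  fixes w :: "real \<Rightarrow> 'h::{real_inner, complete_space}"
  assumes cd: "c \<le> d" and w: "continuous_on {c..d} w"
    and \<psi>: "\<And>x. x \<in> {c..d} \<Longrightarrow> (\<psi> has_real_derivative \<psi>' x) (at x within {c..d})"
    and \<psi>': "continuous_on {c..d} \<psi>'"
  shows "RS_sum c d \<psi> w \<longlonglongrightarrow> \<psi> d *\<^sub>R w d - \<psi> c *\<^sub>R w c - integral {c..d} (\<lambda>r. \<psi>' r *\<^sub>R w r)"
proof (rule LIMSEQ_I)
  fix e :: real assume e: "0 < e"
  obtain K where K: "0 < K" "\<And>x. x \<in> {c..d} \<Longrightarrow> \<bar>\<psi>' x\<bar> \<le> K"
  proof -
    have "bounded (\<psi>' ` {c..d})" using \<psi>' by (intro compact_imp_bounded compact_continuous_image) auto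
    then obtain K where "0 < K" "\<forall>x\<in>\<psi>' ` {c..d}. norm x \<le> K" unfolding bounded_pos by blast
    then show ?thesis using that by auto
  qed
  have pos: "0 < K * (d - c + 1)" using K cd by simp
  \<comment> \<open>The summand 1 makes the final estimate strict and covers
    \<open>c = d\<close>.\<close>
  define e' where "e' = e / (K * (d - c + 1))"
  have e': "0 < e'" unfolding e'_def using e pos by simp
  have lt: "K * e' * (d - c) < e"
  proof -
    have "K * e' * (d - c) < K * e' * (d - c + 1)" using K e' by simp
    also have "\<dots> = e' * (K * (d - c + 1))" by (simp add: algebra_simps)
    also have "\<dots> = e" using pos by (metis e'_def less_irrefl nonzero_eq_divide_eq)
    finally show ?thesis .
  qed
  have "uniformly_continuous_on {c..d} w" using w by (intro compact_uniformly_continuous) auto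
  then obtain \<delta> where \<delta>: "0 < \<delta>" "\<And>x y. x \<in> {c..d} \<Longrightarrow> y \<in> {c..d} \<Longrightarrow> dist x y < \<delta> \<Longrightarrow> dist (w x) (w y) < e'"
    using e' unfolding uniformly_continuous_on_def by metis
  from eventually_mesh[OF \<delta>(1), of d c] obtain N where N: "\<And>k. k \<ge> N \<Longrightarrow> (d - c) / real (Suc k) < \<delta>"
    unfolding eventually_sequentially by blast
  show "\<exists>N. \<forall>k\<ge>N. norm (RS_sum c d \<psi> w k - (\<psi> d *\<^sub>R w d - \<psi> c *\<^sub>R w c - integral {c..d} (\<lambda>r. \<psi>' r *\<^sub>R w r))) < e"
  proof (intro exI allI impI)
    fix k assume k: "N \<le> k"
    define p where "p = grid c d k"
    have close: "norm (w x - w (p (Suc i))) \<le> e'" if "i < Suc k" "p i \<le> x" "x \<le> p (Suc i)" for i x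
    proof -
      have "x \<in> {c..d}" "p (Suc i) \<in> {c..d}"
        using grid_range[OF cd, of i k] grid_range[OF cd, of "Suc i" k] that unfolding p_def by auto
      moreover have "dist x (p (Suc i)) < \<delta>"
        using N[OF k] grid_mesh[of c d k i] that unfolding p_def dist_real_def by auto
      ultimately show ?thesis using \<delta>(2)[of x "p (Suc i)"] by (simp add: dist_norm)
    qed
    have "norm (integral {c..p (Suc k)} (\<lambda>r. \<psi>' r *\<^sub>R w r) - (\<Sum>i<Suc k. (\<psi> (p (Suc i)) - \<psi> (p i)) *\<^sub>R w (p (Suc i))))
        \<le> K * e' * (p (Suc k) - c)"
    proof (rule riemann_sum_error[OF w \<psi> \<psi>' K(2), where p = p and n = "Suc k"])
      show "norm (w x - w (p (Suc i))) \<le> e'" if "i < Suc k" "p i \<le> x" "x \<le> p (Suc i)" for i x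
        using that by (rule close)
    qed (auto simp: p_def intro: grid_mono cd)
    also have "\<dots> < e" using lt by (simp add: p_def)
    finally have *: "norm (integral {c..d} (\<lambda>r. \<psi>' r *\<^sub>R w r) - (\<Sum>i<Suc k. (\<psi> (p (Suc i)) - \<psi> (p i)) *\<^sub>R w (p (Suc i)))) < e"
      by (simp add: p_def)
    define S where "S = (\<Sum>i<Suc k. (\<psi> (p (Suc i)) - \<psi> (p i)) *\<^sub>R w (p (Suc i)))"
    have "RS_sum c d \<psi> w k = \<psi> d *\<^sub>R w d - \<psi> c *\<^sub>R w c - S"
      unfolding RS_sum_def p_def[symmetric] S_def summation_by_parts[of "\<lambda>i. \<psi> (p i)" "\<lambda>i. w (p i)" "Suc k"]
      by (simp add: p_def)
    then have "RS_sum c d \<psi> w k - (\<psi> d *\<^sub>R w d - \<psi> c *\<^sub>R w c - integral {c..d} (\<lambda>r. \<psi>' r *\<^sub>R w r))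
        = integral {c..d} (\<lambda>r. \<psi>' r *\<^sub>R w r) - S" by simp
    then show "norm (RS_sum c d \<psi> w k - (\<psi> d *\<^sub>R w d - \<psi> c *\<^sub>R w c - integral {c..d} (\<lambda>r. \<psi>' r *\<^sub>R w r))) < e"
      using * unfolding S_def[symmetric] by (simp only:)
  qed
qed

definition grid_step :: "real \<Rightarrow> real \<Rightarrow> (real \<Rightarrow> real) \<Rightarrow> nat \<Rightarrow> real \<Rightarrow> real" where
  "grid_step c d \<psi> k r = (\<Sum>i<Suc k. \<psi> (grid c d k i) * indicator {grid c d k i<..grid c d k (Suc i)} r)"

text \<open>The step function behind \<open>RS_sum\<close> takes the left value on each left-open
  cell, hence is zero at \<open>c\<close>; this is why the comparison starts to the right of
  \<open>c\<close>.\<close>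

lemma grid_step_uniform:
  assumes cd: "c \<le> d" and \<psi>: "continuous_on {c..d} \<psi>" and e: "0 < e"
  shows "\<exists>N. \<forall>k\<ge>N. \<forall>r. c < r \<longrightarrow> r \<le> d \<longrightarrow> \<bar>grid_step c d \<psi> k r - \<psi> r\<bar> \<le> e"
proof -
  have "uniformly_continuous_on {c..d} \<psi>" using \<psi> by (intro compact_uniformly_continuous) auto
  then obtain \<delta> where \<delta>: "0 < \<delta>" "\<And>x y. x \<in> {c..d} \<Longrightarrow> y \<in> {c..d} \<Longrightarrow> dist x y < \<delta> \<Longrightarrow> dist (\<psi> x) (\<psi> y) < e"
    using e unfolding uniformly_continuous_on_def by metis
  from eventually_mesh[OF \<delta>(1), of d c] obtain N where N: "\<And>k. k \<ge> N \<Longrightarrow> (d - c) / real (Suc k) < \<delta>"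
    unfolding eventually_sequentially by blast
  show ?thesis
  proof (intro exI allI impI)
    fix k r assume k: "N \<le> k" and r: "c < r" "r \<le> d"
    define p where "p = grid c d k"
    have pm: "p i \<le> p j" if "i \<le> j" for i j unfolding p_def by (rule grid_mono[OF cd that])
    define j where "j = (LEAST j. r \<le> p j)"
    have "r \<le> p (Suc k)" using r by (simp add: p_def)
    then have j: "r \<le> p j" "j \<le> Suc k" unfolding j_def by (auto intro: LeastI Least_le)
    have "j \<noteq> 0" using j r by (metis grid_simps(1) leD p_def)
    then obtain i where i: "j = Suc i" using not0_implies_Suc by blast
    have "p i < r" using not_less_Least[of i "\<lambda>j. r \<le> p j", folded j_def] i by simp
    then have ri: "r \<in> {p i<..p (Suc i)}" "i < Suc k" using j i by auto
    have other: "r \<notin> {p m<..p (Suc m)}" if "m \<noteq> i" for m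
      using pm[of "Suc i" m] pm[of "Suc m" i] that ri by (cases "i < m") (auto simp: not_less)
    have "grid_step c d \<psi> k r = (\<Sum>m<Suc k. if m = i then \<psi> (p i) else 0)"
      unfolding grid_step_def p_def[symmetric] using ri other
      by (intro sum.cong) (auto split: split_indicator)
    then have eq: "grid_step c d \<psi> k r = \<psi> (p i)" using ri by simp
    have "p i \<in> {c..d}" using grid_range[OF cd, of i k] ri unfolding p_def by auto
    moreover have "dist (p i) r < \<delta>"
      using N[OF k] grid_mesh[of c d k i] ri unfolding p_def dist_real_def by auto
    ultimately have "dist (\<psi> (p i)) (\<psi> r) < e" using \<delta>(2)[of "p i" r] r by auto
    then show "\<bar>grid_step c d \<psi> k r - \<psi> r\<bar> \<le> e" unfolding eq by (simp add: dist_real_def)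
  qed
qed

section \<open>Multiplication of an integrand by a smooth function\<close>

text \<open>
  The Riemann-Stieltjes sums converge only almost surely, and the filtration need not contain the
  null sets. The value \<open>0\<close> for divergent sequences keeps the limit adapted.
\<close>

definition clim :: "(nat \<Rightarrow> 'v::{metric_space, zero}) \<Rightarrow> 'v" where
  "clim X = (if Cauchy X then lim X else 0)"

lemma clim_eq: "X \<longlonglongrightarrow> L \<Longrightarrow> clim X = L"
  unfolding clim_def using LIMSEQ_imp_Cauchy limI by auto

text \<open>Replacing all terms by 0 off the event of being Cauchy gives a sequence that converges
  everywhere, to which measurability of pointwise limits applies.\<close>

lemma borel_measurable_clim:
  fixes X :: "nat \<Rightarrow> 'w \<Rightarrow> 'v::{real_normed_vector, polish_space}"
  assumes [measurable]: "\<And>k. X k \<in> borel_measurable N"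
  shows "(\<lambda>\<omega>. clim (\<lambda>k. X k \<omega>)) \<in> borel_measurable N"
proof (rule borel_measurable_LIMSEQ_metric)
  show "(\<lambda>\<omega>. if Cauchy (\<lambda>k. X k \<omega>) then X k \<omega> else 0) \<in> borel_measurable N" for k
    by measurable
  show "(\<lambda>k. if Cauchy (\<lambda>k. X k \<omega>) then X k \<omega> else 0) \<longlonglongrightarrow> clim (\<lambda>k. X k \<omega>)" for \<omega>
    using Cauchy_convergent convergent_LIMSEQ_iff unfolding clim_def by auto
qed

text \<open>Identifies the almost sure limit with the mean-square limit without extracting
  subsequences: a Cauchy bound on the tail, taken with \<open>Y\<close> a fixed member of the
  sequence, passes to the limit by Fatou's lemma.\<close>

lemma mean_square_fatou:
  fixes X :: "nat \<Rightarrow> 'w \<Rightarrow> 'v::{real_normed_vector, second_countable_topology}"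
  assumes [measurable]: "\<And>k. X k \<in> borel_measurable M" "Y \<in> borel_measurable M"
    and lim: "AE \<omega> in M. (\<lambda>k. X k \<omega>) \<longlonglongrightarrow> L \<omega>"
    and bound: "\<And>k. k \<ge> N \<Longrightarrow> mean_square M (\<lambda>\<omega>. X k \<omega> - Y \<omega>) \<le> B"
  shows "mean_square M (\<lambda>\<omega>. L \<omega> - Y \<omega>) \<le> B"
proof -
  have "mean_square M (\<lambda>\<omega>. L \<omega> - Y \<omega>) = (\<integral>\<^sup>+ \<omega>. liminf (\<lambda>k. ennreal ((norm (X k \<omega> - Y \<omega>))\<^sup>2)) \<partial>M)"
    unfolding mean_square_def
  proof (rule nn_integral_cong_AE, use lim in eventually_elim)
    fix \<omega> assume "(\<lambda>k. X k \<omega>) \<longlonglongrightarrow> L \<omega>"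
    then have "(\<lambda>k. ennreal ((norm (X k \<omega> - Y \<omega>))\<^sup>2)) \<longlonglongrightarrow> ennreal ((norm (L \<omega> - Y \<omega>))\<^sup>2)"
      by (intro tendsto_ennrealI tendsto_intros)
    then show "ennreal ((norm (L \<omega> - Y \<omega>))\<^sup>2) = liminf (\<lambda>k. ennreal ((norm (X k \<omega> - Y \<omega>))\<^sup>2))"
      using lim_imp_Liminf[OF trivial_limit_sequentially] by metis
  qed
  also have "\<dots> \<le> liminf (\<lambda>k. mean_square M (\<lambda>\<omega>. X k \<omega> - Y \<omega>))"
    unfolding mean_square_def by (intro nn_integral_liminf) measurable
  also have "\<dots> \<le> B"
    using bound by (intro Liminf_le eventually_sequentiallyI[of N]) auto
  finally show ?thesis .
qed

context brownian
begin

lemma has_stoch_integral_sum: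
  assumes "\<And>i. i < (n::nat) \<Longrightarrow> has_stoch_integral M C W (\<lambda>r. f i r *\<^sub>R \<sigma> r) c d (I i)"
    and f [measurable]: "\<And>i. f i \<in> borel_measurable borel" and m: "integrand \<sigma>" and ac: "a \<le> c" "c \<le> d"
  shows "has_stoch_integral M C W (\<lambda>r. (\<Sum>i<n. f i r) *\<^sub>R \<sigma> r) c d (\<lambda>\<omega>. \<Sum>i<n. I i \<omega>)"
  using assms(1)
proof (induction n)
  case 0
  have "sfun [] = (\<lambda>r. 0)" "sint [] W = (\<lambda>\<omega>. 0)" by (rule ext, simp)+
  from has_stoch_integral_sfun[OF _ ac, where xs = "[]", unfolded this] show ?case by simp
next
  case (Suc n)
  have fm: "(\<lambda>r. \<Sum>i<n. f i r) \<in> borel_measurable borel" by measurable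
  have "has_stoch_integral M C W (\<lambda>r. (\<Sum>i<n. f i r) *\<^sub>R \<sigma> r + f n r *\<^sub>R \<sigma> r) c d (\<lambda>\<omega>. (\<Sum>i<n. I i \<omega>) + I n \<omega>)"
    using Suc
    by (intro has_stoch_integral_add ac integrand_scaleR[OF measurable_restrict_space1[OF fm] m]
        integrand_scaleR[OF measurable_restrict_space1[OF f] m]) auto
  then show ?case by (simp add: scaleR_add_left)
qed

lemma has_stoch_integral_grid_step:
  assumes I: "\<And>u. a \<le> u \<Longrightarrow> u \<le> d \<Longrightarrow> has_stoch_integral M C W \<sigma> a u (I u)"
    and ad: "a \<le> d" and m: "integrand \<sigma>"
  shows "has_stoch_integral M C W (\<lambda>r. grid_step a d \<psi> k r *\<^sub>R \<sigma> r) a d (\<lambda>\<omega>. RS_sum a d \<psi> (\<lambda>u. I u \<omega>) k)"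
  unfolding grid_step_def RS_sum_def
proof (rule has_stoch_integral_sum[OF _ _ m order_refl ad])
  fix i assume i: "i < Suc k"
  define u v where "u = grid a d k i" and "v = grid a d k (Suc i)"
  have uv: "a \<le> u" "u \<le> v" "v \<le> d"
    using grid_range[OF ad, of i k] grid_range[OF ad, of "Suc i" k] grid_mono[OF ad, of i "Suc i" k] i
    unfolding u_def v_def by auto
  have "has_stoch_integral M C W (\<lambda>r. indicator {u<..v} r *\<^sub>R \<sigma> r) a d (\<lambda>\<omega>. I v \<omega> - I u \<omega>)"
    by (rule has_stoch_integral_interval[OF I I]) (use uv m in auto)
  from has_stoch_integral_scaleR[OF this order_refl ad integrand_indicator[OF m], of "\<psi> u"]
  show "has_stoch_integral M C W (\<lambda>r. (\<psi> (grid a d k i) * indicator {grid a d k i<..grid a d k (Suc i)} r) *\<^sub>R \<sigma> r) a d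
      (\<lambda>\<omega>. \<psi> (grid a d k i) *\<^sub>R (I (grid a d k (Suc i)) \<omega> - I (grid a d k i) \<omega>))"
    unfolding u_def v_def by simp
qed measurable

lemma borel_measurable_grid_step: "grid_step c d \<psi> k \<in> borel_measurable borel"
  unfolding grid_step_def[abs_def] by measurable

text \<open>\<open>I\<close> and \<open>J\<close> are kept apart: \<open>I u\<close> is an arbitrary
  version at each time, which is all that the definition provides, and \<open>J\<close> has
  continuous paths and agrees with it almost surely at each time. The sums are formed with
  \<open>I\<close>, their limit is computed with \<open>J\<close>.\<close>

lemma has_stoch_integral_scale_smooth:
  assumes I: "\<And>u. a \<le> u \<Longrightarrow> u \<le> d \<Longrightarrow> has_stoch_integral M C W \<sigma> a u (I u)"
    and m: "integrand \<sigma>" and ad: "a \<le> d"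
    and J: "AE \<omega> in M. continuous_on {a..d} (\<lambda>u. J u \<omega>)" "\<And>u. a \<le> u \<Longrightarrow> u \<le> d \<Longrightarrow> AE \<omega> in M. J u \<omega> = I u \<omega>"
    and \<psi>: "\<And>x. x \<in> {a..d} \<Longrightarrow> (\<psi> has_real_derivative \<psi>' x) (at x within {a..d})"
    and \<psi>': "continuous_on {a..d} \<psi>'" and \<psi>m: "\<psi> \<in> borel_measurable (restrict_space borel {a..})"
  shows "\<exists>R. has_stoch_integral M C W (\<lambda>r. \<psi> r *\<^sub>R \<sigma> r) a d R \<and>
    (AE \<omega> in M. R \<omega> = \<psi> d *\<^sub>R J d \<omega> - integral {a..d} (\<lambda>r. \<psi>' r *\<^sub>R J r \<omega>))"
proof -
  define X where "X k \<omega> = RS_sum a d \<psi> (\<lambda>u. I u \<omega>) k" for k \<omega>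
  define R where "R \<omega> = clim (\<lambda>k. X k \<omega>)" for \<omega>
  define L where "L \<omega> = \<psi> d *\<^sub>R J d \<omega> - integral {a..d} (\<lambda>r. \<psi>' r *\<^sub>R J r \<omega>)" for \<omega>
  have X: "has_stoch_integral M C W (\<lambda>r. grid_step a d \<psi> k r *\<^sub>R \<sigma> r) a d (X k)" for k
    unfolding X_def by (rule has_stoch_integral_grid_step[OF I ad m])
  note Xm [measurable] = has_stoch_integral_measurable[OF X]
  have Rm [measurable]: "R \<in> borel_measurable M" unfolding R_def by (rule borel_measurable_clim) measurable
  \<comment> \<open>Removes the boundary term at \<open>a\<close>: the integral over a single point
    is zero.\<close>
  have "AE \<omega> in M. I a \<omega> = 0"
  proof -
    have "has_stoch_integral M C W \<sigma> a a (\<lambda>\<omega>. 0)"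
      unfolding has_stoch_integral_iff[OF order_refl order_refl]
    proof (intro conjI allI impI exI[of _ "[]"])
      fix e :: real
      show "cov_L2 C a a (\<lambda>r. \<sigma> r - sfun [] r) \<le> ennreal e"
        unfolding cov_L2_def using nn_integral_null_set[of "{a}" lborel]
        by (auto simp: null_sets_def)
    qed (simp_all add: mean_square_def)
    then show ?thesis by (rule has_stoch_integral_unique[OF I[OF order_refl ad] _ order_refl order_refl m])
  qed
  then have Ja: "AE \<omega> in M. J a \<omega> = 0" using J(2)[OF order_refl ad] by eventually_elim simp
  \<comment> \<open>The grids have only countably many points in all, so \<open>I\<close> and
    \<open>J\<close> agree on them outside one null set.\<close>
  have "AE \<omega> in M. \<forall>k. \<forall>i\<in>{..Suc k}. J (grid a d k i) \<omega> = I (grid a d k i) \<omega>"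
    unfolding AE_all_countable
    by (intro allI AE_ball_countable[THEN iffD2] ballI J(2)) (use grid_range[OF ad] in auto)
  with Ja J(1) have lim: "AE \<omega> in M. (\<lambda>k. X k \<omega>) \<longlonglongrightarrow> L \<omega>"
  proof eventually_elim
    case (elim \<omega>)
    have "X k \<omega> = RS_sum a d \<psi> (\<lambda>u. J u \<omega>) k" for k
      unfolding X_def RS_sum_def using elim(3) by (intro sum.cong) auto
    then show ?case
      using RS_sum_tendsto[OF ad elim(2) \<psi> \<psi>'] elim(1) unfolding L_def by (simp add: fun_eq_iff)
  qed
  then have RL: "AE \<omega> in M. R \<omega> = L \<omega>"
    unfolding R_def by eventually_elim (rule clim_eq)
  define D where "D = enn2real (cov_L2 C a d \<sigma>)"
  have D: "cov_L2 C a d \<sigma> = ennreal D" "0 \<le> D"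
    unfolding D_def using has_stoch_integral_finite[OF I[OF ad order_refl] order_refl ad m] by auto
  have cont: "continuous_on {a..d} \<psi>"
    using \<psi> DERIV_continuous unfolding continuous_on_eq_continuous_within by blast
  have gsm: "(\<lambda>r. grid_step a d \<psi> k r) \<in> borel_measurable (restrict_space borel {a..})" for k
    by (rule measurable_restrict_space1[OF borel_measurable_grid_step])
  have "has_stoch_integral M C W (\<lambda>r. \<psi> r *\<^sub>R \<sigma> r) a d R"
  proof (rule has_stoch_integral_closure[OF order_refl ad Rm])
    fix e :: real assume e: "0 < e"
    \<comment> \<open>Two grid functions within \<open>\<epsilon>\<close> of \<open>\<psi>\<close>
      differ by at most \<open>2 * \<epsilon>\<close>; with the isometry constant 4 this gives
      \<open>16 * \<epsilon>\<^sup>2 * D\<close>. The summand 1 allows \<open>D = 0\<close>.\<close>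
    define \<epsilon> where "\<epsilon> = sqrt (e / (16 * (D + 1)))"
    have \<epsilon>: "0 < \<epsilon>" "16 * \<epsilon>\<^sup>2 * D \<le> e" "\<epsilon>\<^sup>2 * D \<le> e"
    proof -
      have sq: "\<epsilon>\<^sup>2 = e / (16 * (D + 1))" unfolding \<epsilon>_def using e D by simp
      show "0 < \<epsilon>" unfolding \<epsilon>_def using e D by simp
      have "16 * \<epsilon>\<^sup>2 * (D + 1) = e" unfolding sq using D by (simp add: field_simps)
      moreover have "16 * \<epsilon>\<^sup>2 * D \<le> 16 * \<epsilon>\<^sup>2 * (D + 1)" by (intro mult_left_mono) auto
      ultimately show 1: "16 * \<epsilon>\<^sup>2 * D \<le> e" by simp
      have "\<epsilon>\<^sup>2 * D \<ge> 0" using D by simp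
      then show "\<epsilon>\<^sup>2 * D \<le> e" using 1 by linarith
    qed
    from grid_step_uniform[OF ad cont \<epsilon>(1)] obtain N where
      N: "\<And>k r. N \<le> k \<Longrightarrow> a < r \<Longrightarrow> r \<le> d \<Longrightarrow> \<bar>grid_step a d \<psi> k r - \<psi> r\<bar> \<le> \<epsilon>" by blast
    have ms: "mean_square M (\<lambda>\<omega>. X k \<omega> - X N \<omega>) \<le> ennreal e" if k: "N \<le> k" for k
    proof -
      have b: "\<bar>grid_step a d \<psi> k r - grid_step a d \<psi> N r\<bar> \<le> 2 * \<epsilon>" if "a < r" "r \<le> d" for r
        using N[OF k that] N[OF order_refl that] by linarith
      have mm: "integrand (\<lambda>r. (grid_step a d \<psi> k r - grid_step a d \<psi> N r) *\<^sub>R \<sigma> r)"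
        by (intro integrand_scaleR m borel_measurable_diff gsm)
      have "has_stoch_integral M C W (\<lambda>r. (grid_step a d \<psi> k r - grid_step a d \<psi> N r) *\<^sub>R \<sigma> r) a d (\<lambda>\<omega>. X k \<omega> - X N \<omega>)"
        using has_stoch_integral_diff[OF X X order_refl ad integrand_scaleR[OF gsm m] integrand_scaleR[OF gsm m]]
        by (simp add: scaleR_diff_left)
      from has_stoch_integral_isometry_le[OF this order_refl ad mm]
      have "mean_square M (\<lambda>\<omega>. X k \<omega> - X N \<omega>)
        \<le> 4 * cov_L2 C a d (\<lambda>r. (grid_step a d \<psi> k r - grid_step a d \<psi> N r) *\<^sub>R \<sigma> r)" .
      also have "\<dots> \<le> 4 * (ennreal ((2 * \<epsilon>)\<^sup>2) * cov_L2 C a d \<sigma>)"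
        by (intro mult_left_mono cov_L2_scaleR_le m b) auto
      also have "\<dots> = ennreal (16 * \<epsilon>\<^sup>2 * D)"
        unfolding D(1) using D(2) by (simp add: ennreal_mult'[symmetric] power2_eq_square mult_ac flip: ennreal_numeral)
      also have "\<dots> \<le> ennreal e" using \<epsilon>(2) by (rule ennreal_leI)
      finally show ?thesis .
    qed
    have "mean_square M (\<lambda>\<omega>. L \<omega> - X N \<omega>) \<le> ennreal e"
      by (rule mean_square_fatou[OF Xm Xm lim ms])
    moreover have "mean_square M (\<lambda>\<omega>. R \<omega> - X N \<omega>) = mean_square M (\<lambda>\<omega>. L \<omega> - X N \<omega>)"
      unfolding mean_square_def by (rule nn_integral_cong_AE) (use RL in \<open>eventually_elim, simp\<close>)
    ultimately have 1: "mean_square M (\<lambda>\<omega>. R \<omega> - X N \<omega>) \<le> ennreal e" by simp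
    have eq: "(\<lambda>r. \<psi> r *\<^sub>R \<sigma> r - grid_step a d \<psi> N r *\<^sub>R \<sigma> r) = (\<lambda>r. (\<psi> r - grid_step a d \<psi> N r) *\<^sub>R \<sigma> r)"
      by (simp add: scaleR_diff_left)
    have 2: "integrand (\<lambda>r. (\<psi> r - grid_step a d \<psi> N r) *\<^sub>R \<sigma> r)"
      by (intro integrand_scaleR m borel_measurable_diff gsm \<psi>m)
    have "cov_L2 C a d (\<lambda>r. (\<psi> r - grid_step a d \<psi> N r) *\<^sub>R \<sigma> r) \<le> ennreal (\<epsilon>\<^sup>2) * cov_L2 C a d \<sigma>"
      by (intro cov_L2_scaleR_le m order_refl) (use N in \<open>auto simp: abs_minus_commute\<close>)
    also have "\<dots> = ennreal (\<epsilon>\<^sup>2 * D)" unfolding D(1) by (simp add: ennreal_mult')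
    also have "\<dots> \<le> ennreal e" using \<epsilon>(3) by (rule ennreal_leI)
    finally have 3: "cov_L2 C a d (\<lambda>r. (\<psi> r - grid_step a d \<psi> N r) *\<^sub>R \<sigma> r) \<le> ennreal e" .
    show "\<exists>\<sigma>' I'. has_stoch_integral M C W \<sigma>' a d I' \<and> integrand \<sigma>' \<and> integrand (\<lambda>r. \<psi> r *\<^sub>R \<sigma> r - \<sigma>' r) \<and>
      cov_L2 C a d (\<lambda>r. \<psi> r *\<^sub>R \<sigma> r - \<sigma>' r) \<le> ennreal e \<and> mean_square M (\<lambda>\<omega>. R \<omega> - I' \<omega>) \<le> ennreal e"
      using X[of N] integrand_scaleR[OF gsm m, of N] 1 2 3 unfolding eq[symmetric] by blast
  qed
  then show ?thesis using RL unfolding L_def by blast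
qed

end

section \<open>Smooth deterministic integrands give time-changed Brownian motions\<close>

lemma (in prob_space) char_centred_normal:
  assumes v: "0 < v" and D: "distributed M lborel X (normal_density 0 (sqrt v))"
  shows "char (distr M borel X) t = complex_of_real (exp (- (t\<^sup>2 * v / 2)))"
proof -
  have pos: "0 < sqrt v" using v by simp
  have Xm [measurable]: "X \<in> borel_measurable M" using distributed_measurable[OF D] by simp
  have S: "distributed M lborel (\<lambda>\<omega>. X \<omega> / sqrt v) std_normal_density"
    using normal_standard_normal_convert[OF pos, of X 0] D by simp
  have "distr M borel (\<lambda>\<omega>. X \<omega> / sqrt v) = distr M lborel (\<lambda>\<omega>. X \<omega> / sqrt v)"
    by (rule distr_cong) auto
  also have "\<dots> = std_normal_distribution" using distributed_distr_eq_density[OF S] by simp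
  finally have "char (distr M borel (\<lambda>\<omega>. X \<omega> / sqrt v)) (t * sqrt v) = complex_of_real (exp (- ((t * sqrt v)\<^sup>2) / 2))"
    by (simp add: char_std_normal_distribution)
  moreover have "char (distr M borel (\<lambda>\<omega>. X \<omega> / sqrt v)) (t * sqrt v) = char (distr M borel X) t"
    unfolding char_def using v by (simp add: integral_distr)
  ultimately show ?thesis using v by (simp add: power_mult_distrib)
qed

lemma (in prob_space) char_AE_zero:
  assumes [measurable]: "X \<in> borel_measurable M" and "AE \<omega> in M. X \<omega> = (0::real)"
  shows "char (distr M borel X) t = 1"
proof -
  have "char (distr M borel X) t = (CLINT \<omega>|M. iexp (t * X \<omega>))"
    unfolding char_def by (simp add: integral_distr)
  also have "\<dots> = (CLINT \<omega>|M. 1)"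
    by (rule integral_cong_AE) (use assms(2) in \<open>auto\<close>)
  finally show ?thesis by (simp add: prob_space)
qed

text \<open>Characteristic functions cover degenerate and nondegenerate laws by one formula that is
  stable under limits. The case distinction of \<open>centred_gaussian\<close> is recovered only
  here, by Levy's uniqueness theorem.\<close>

lemma (in prob_space) centred_normal_if_char:
  assumes Xm [measurable]: "X \<in> borel_measurable M" and v: "0 \<le> v"
    and ch: "\<And>t. char (distr M borel X) t = complex_of_real (exp (- (t\<^sup>2 * v / 2)))"
  shows "if v = 0 then (AE \<omega> in M. X \<omega> = 0) else distributed M lborel X (normal_density 0 (sqrt v))"
proof (cases "v = 0")
  case True
  interpret R: prob_space "return borel (0::real)" by (rule prob_space_return) simp
  have "real_distribution (return borel (0::real))"
    by (simp add: real_distribution_def real_distribution_axioms_def R.prob_space_axioms)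
  moreover have "char (distr M borel X) = char (return borel 0)"
    using ch True by (auto simp: fun_eq_iff char_def integral_return)
  ultimately have eq: "distr M borel X = return borel 0"
    by (intro Levy_uniqueness) auto
  have "AE x in distr M borel X. x = 0" unfolding eq by (subst AE_return) auto
  then show ?thesis using True by (simp add: AE_distr_iff)
next
  case False
  with v have pos: "0 < v" "0 < sqrt v" by auto
  define N where "N = density lborel (normal_density 0 (sqrt v))"
  interpret N: prob_space N unfolding N_def by (rule prob_space_normal_density[OF pos(2)])
  have sN: "sets N = sets borel" "space N = UNIV" unfolding N_def by simp_all
  have rN: "real_distribution N"
    unfolding real_distribution_def real_distribution_axioms_def using N.prob_space_axioms sN by simp
  have idm: "(\<lambda>x. x) \<in> measurable N lborel"
    by (rule measurableI) (auto simp: sN)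
  have dN: "distributed N lborel (\<lambda>x. x) (normal_density 0 (sqrt v))"
    unfolding distributed_def
  proof (intro conjI idm)
    show "distr N lborel (\<lambda>x. x) = density lborel (normal_density 0 (sqrt v))"
      by (subst distr_id2) (simp_all add: sN, simp add: N_def)
  qed simp
  have "distr N borel (\<lambda>x. x) = N" by (rule distr_id2) (simp add: sN)
  then have "char N t = complex_of_real (exp (- (t\<^sup>2 * v / 2)))" for t
    using N.char_centred_normal[OF pos(1) dN, of t] by simp
  then have "distr M borel X = N"
    using ch by (intro Levy_uniqueness rN) auto
  then have "distr M lborel X = N"
    using distr_cong[of M M lborel borel X X] by simp
  then show ?thesis using False Xm unfolding distributed_def N_def by simp
qed

lemma (in prob_space) char_tendsto:
  assumes [measurable]: "\<And>k. X k \<in> borel_measurable M" "L \<in> borel_measurable M"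
    and lim: "AE \<omega> in M. (\<lambda>k. X k \<omega>) \<longlonglongrightarrow> L \<omega>"
  shows "(\<lambda>k. char (distr M borel (X k)) t) \<longlonglongrightarrow> char (distr M borel L) t"
proof -
  have "(\<lambda>k. CLINT \<omega>|M. iexp (t * X k \<omega>)) \<longlonglongrightarrow> (CLINT \<omega>|M. iexp (t * L \<omega>))"
  proof (rule integral_dominated_convergence[where w = "\<lambda>_. 1"])
    show "AE \<omega> in M. (\<lambda>k. iexp (t * X k \<omega>)) \<longlonglongrightarrow> iexp (t * L \<omega>)"
      using lim by eventually_elim (intro tendsto_intros)
  qed auto
  then show ?thesis unfolding char_def by (simp add: integral_distr)
qed

section \<open>Weighted sums of independent increments\<close>

context brownian
begin

lemma increment_char:
  assumes st: "a \<le> s" "s \<le> t"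
  shows "char (distr M borel (\<lambda>\<omega>. c * inner (W t \<omega> - W s \<omega>) h)) u = complex_of_real (exp (- (u\<^sup>2 * (c\<^sup>2 * (t - s) * q h) / 2)))"
proof -
  define X where "X = (\<lambda>\<omega>. inner (W t \<omega> - W s \<omega>) h)"
  have [measurable]: "W s \<in> borel_measurable M" "W t \<in> borel_measurable M"
    using W_measurable st by auto
  have [measurable]: "X \<in> borel_measurable M" unfolding X_def by measurable
  define v where "v = (t - s) * q h"
  have cg: "centred_gaussian M ((t - s) *\<^sub>R C) (\<lambda>\<omega>. W t \<omega> - W s \<omega>)"
    using bm st unfolding brownian_motion_def by blast
  have "inner (blinfun_apply ((t - s) *\<^sub>R C) h) h = v" by (simp add: v_def blinfun.scaleR_left)
  then have X: "if v = 0 then (AE \<omega> in M. X \<omega> = 0) else distributed M lborel X (normal_density 0 (sqrt v))"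
    using cg[unfolded centred_gaussian_def, THEN conjunct2, THEN spec[of _ h]] by (simp only: X_def)
  have "char (distr M borel X) w = complex_of_real (exp (- (w\<^sup>2 * v / 2)))" for w
  proof (cases "v = 0")
    case True
    then show ?thesis using X char_AE_zero[of X w] by simp
  next
    case False
    have "0 \<le> v" unfolding v_def using st q_nonneg by simp
    then show ?thesis using X False char_centred_normal[of v X w] by simp
  qed
  moreover have "char (distr M borel (\<lambda>\<omega>. c * X \<omega>)) u = char (distr M borel X) (u * c)"
    unfolding char_def by (simp add: integral_distr mult_ac)
  ultimately have "char (distr M borel (\<lambda>\<omega>. c * X \<omega>)) u = complex_of_real (exp (- ((u * c)\<^sup>2 * v / 2)))"
    by simp
  also have "(u * c)\<^sup>2 * v = u\<^sup>2 * (c\<^sup>2 * (t - s) * q h)" by (simp add: v_def power_mult_distrib mult_ac)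
  finally show ?thesis unfolding X_def .
qed

text \<open>Independence makes the joint law of the sample point, observed through
  \<open>F s\<close>, and of the increment a product; Fubini's theorem then freezes the
  increment.\<close>

lemma nn_integral_increment:
  assumes st: "a \<le> s" "s \<le> t" and G: "G \<in> borel_measurable (F s \<Otimes>\<^sub>M borel)"
  shows "(\<integral>\<^sup>+ \<omega>. G (\<omega>, W t \<omega> - W s \<omega>) \<partial>M)
    = (\<integral>\<^sup>+ y. (\<integral>\<^sup>+ \<omega>. G (\<omega>, y) \<partial>M) \<partial>distr M borel (\<lambda>\<omega>. W t \<omega> - W s \<omega>))"
proof -
  define Y where "Y \<omega> = W t \<omega> - W s \<omega>" for \<omega>
  have [measurable]: "W s \<in> borel_measurable M" "W t \<in> borel_measurable M"
    using W_measurable st by auto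
  have Ym [measurable]: "Y \<in> borel_measurable M" unfolding Y_def by measurable
  have idm [measurable]: "(\<lambda>\<omega>. \<omega>) \<in> measurable M (F s)"
    by (rule measurable_F_M[OF st(1)]) simp
  interpret P1: prob_space "distr M (F s) (\<lambda>\<omega>. \<omega>)" by (rule prob_space_distr[OF idm])
  interpret P2: prob_space "distr M borel Y" by (rule prob_space_distr[OF Ym])
  interpret P: pair_sigma_finite "distr M (F s) (\<lambda>\<omega>. \<omega>)" "distr M borel Y" ..
  have G': "G \<in> borel_measurable (distr M (F s) (\<lambda>\<omega>. \<omega>) \<Otimes>\<^sub>M distr M borel Y)"
    using G by simp
  have "(\<integral>\<^sup>+ \<omega>. G (\<omega>, Y \<omega>) \<partial>M) = (\<integral>\<^sup>+ z. G z \<partial>distr M (F s \<Otimes>\<^sub>M borel) (\<lambda>\<omega>. (\<omega>, Y \<omega>)))"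
    using G by (subst nn_integral_distr) auto
  also have "distr M (F s \<Otimes>\<^sub>M borel) (\<lambda>\<omega>. (\<omega>, Y \<omega>)) = distr M (F s) (\<lambda>\<omega>. \<omega>) \<Otimes>\<^sub>M distr M borel Y"
  proof (rule pair_measure_eqI[symmetric])
    fix A B assume A: "A \<in> sets (distr M (F s) (\<lambda>\<omega>. \<omega>))" and B: "B \<in> sets (distr M borel Y)"
    have [measurable]: "A \<in> sets (F s)" "B \<in> sets borel" using A B by auto
    have AM: "A \<in> sets M" using A subalgebra_F[OF st(1)] unfolding subalgebra_def by auto
    then have Asp: "A \<inter> space M = A" using sets.sets_into_space by blast
    have "Y -` B \<inter> space M \<in> sets (vimage_algebra (space M) (\<lambda>\<omega>. W t \<omega> - W s \<omega>) borel)"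
      unfolding Y_def by (rule in_vimage_algebra) fact
    moreover have "indep_set (sets (F s)) (sets (vimage_algebra (space M) (\<lambda>\<omega>. W t \<omega> - W s \<omega>) borel))"
      using bm st unfolding brownian_motion_def by blast
    ultimately have "prob (A \<inter> (Y -` B \<inter> space M)) = prob A * prob (Y -` B \<inter> space M)"
      by (intro indep_setD[of "sets (F s)"]) auto
    moreover have "(\<lambda>\<omega>. (\<omega>, Y \<omega>)) -` (A \<times> B) \<inter> space M = A \<inter> (Y -` B \<inter> space M)" by auto
    ultimately show "emeasure (distr M (F s) (\<lambda>\<omega>. \<omega>)) A * emeasure (distr M borel Y) B
        = emeasure (distr M (F s \<Otimes>\<^sub>M borel) (\<lambda>\<omega>. (\<omega>, Y \<omega>))) (A \<times> B)"
      by (simp add: emeasure_distr Asp emeasure_eq_measure ennreal_mult)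
  qed (auto intro: P1.sigma_finite_measure_axioms P2.sigma_finite_measure_axioms)
  also have "(\<integral>\<^sup>+ z. G z \<partial>(distr M (F s) (\<lambda>\<omega>. \<omega>) \<Otimes>\<^sub>M distr M borel Y))
     = (\<integral>\<^sup>+ y. (\<integral>\<^sup>+ \<omega>. G (\<omega>, y) \<partial>distr M (F s) (\<lambda>\<omega>. \<omega>)) \<partial>distr M borel Y)"
    using P.nn_integral_snd[OF G'] by simp
  also have "\<dots> = (\<integral>\<^sup>+ y. (\<integral>\<^sup>+ \<omega>. G (\<omega>, y) \<partial>M) \<partial>distr M borel Y)"
    using G by (intro nn_integral_cong nn_integral_distr) auto
  finally show ?thesis unfolding Y_def .
qed

text \<open>Independence of \<open>F (p 0)\<close> is expressed by factorising the integrals of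
  \<open>g (S k)\<close> for every measurable \<open>g\<close>: the inductive step replaces
  \<open>g\<close> by its shift along a frozen increment, and for continuous \<open>g\<close> the
  identity survives limits.\<close>

lemma weighted_increments:
  fixes p c :: "nat \<Rightarrow> real"
  assumes p: "a \<le> p 0" "\<And>i. i < n \<Longrightarrow> p i \<le> p (Suc i)" and "k \<le> n"
  defines "S \<equiv> \<lambda>k \<omega>. \<Sum>i<k. c i *\<^sub>R (W (p (Suc i)) \<omega> - W (p i) \<omega>)"
  shows "p 0 \<le> p k \<and> S k \<in> borel_measurable (F (p k)) \<and>
    (\<forall>h u. char (distr M borel (\<lambda>\<omega>. inner (S k \<omega>) h)) u
        = complex_of_real (exp (- (u\<^sup>2 * ((\<Sum>i<k. (c i)\<^sup>2 * (p (Suc i) - p i)) * q h) / 2)))) \<and>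
    (\<forall>B\<in>sets (F (p 0)). \<forall>g\<in>borel_measurable borel.
      (\<integral>\<^sup>+ \<omega>. indicator B \<omega> * g (S k \<omega>) \<partial>M) = emeasure M B * (\<integral>\<^sup>+ \<omega>. (g (S k \<omega>) :: ennreal) \<partial>M))"
  using \<open>k \<le> n\<close>
proof (induction k)
  case 0
  have "(\<integral>\<^sup>+ \<omega>. indicator B \<omega> * g 0 \<partial>M) = emeasure M B * g 0" if "B \<in> sets (F (p 0))" for B and g :: "'h \<Rightarrow> ennreal"
  proof -
    have "B \<in> sets M" using that subalgebra_F[OF p(1)] unfolding subalgebra_def by blast
    then show ?thesis by (simp add: nn_integral_multc)
  qed
  moreover have "char (distr M borel (\<lambda>\<omega>. 0)) u = 1" for u
    by (rule char_AE_zero) auto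
  ultimately show ?case by (simp add: S_def emeasure_space_1)
next
  case (Suc k)
  then have k: "k < n" "k \<le> n" by auto
  note IH = Suc.IH[OF k(2)]
  then have pk: "a \<le> p k" "p k \<le> p (Suc k)" using p k by auto
  define Y where "Y \<omega> = W (p (Suc k)) \<omega> - W (p k) \<omega>" for \<omega>
  have S_Suc: "S (Suc k) = (\<lambda>\<omega>. S k \<omega> + c k *\<^sub>R Y \<omega>)" by (simp add: S_def Y_def)
  have Sk: "S k \<in> borel_measurable (F (p k))" using IH by blast
  have [measurable]: "S k \<in> borel_measurable M" by (rule measurable_F_M[OF pk(1) Sk])
  have Ym [measurable]: "Y \<in> borel_measurable M"
    unfolding Y_def using W_measurable pk by (intro borel_measurable_diff) auto
  have 1: "S (Suc k) \<in> borel_measurable (F (p (Suc k)))"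
    unfolding S_Suc Y_def
    by (intro borel_measurable_add borel_measurable_scaleR borel_measurable_const borel_measurable_diff
        measurable_F_mono[OF pk Sk] W_measurable_F) (use pk in auto)
  have 2: "char (distr M borel (\<lambda>\<omega>. inner (S (Suc k) \<omega>) h)) u
      = complex_of_real (exp (- (u\<^sup>2 * ((\<Sum>i<Suc k. (c i)\<^sup>2 * (p (Suc i) - p i)) * q h) / 2)))" for h u
  proof -
    have "(\<lambda>\<omega>. inner (S k \<omega>) h) \<in> borel_measurable (F (p k))"
      by (intro borel_measurable_inner Sk borel_measurable_const)
    from indep_increment[OF pk this, where f = "\<lambda>x. c k * inner x h" and N' = borel]
    have ind: "indep_var borel (\<lambda>\<omega>. inner (S k \<omega>) h) borel (\<lambda>\<omega>. c k * inner (Y \<omega>) h)"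
      unfolding Y_def by simp
    have "(\<lambda>\<omega>. inner (S (Suc k) \<omega>) h) = (\<lambda>\<omega>. inner (S k \<omega>) h + c k * inner (Y \<omega>) h)"
      by (simp add: S_Suc inner_add_left)
    then have "char (distr M borel (\<lambda>\<omega>. inner (S (Suc k) \<omega>) h)) u
      = char (distr M borel (\<lambda>\<omega>. inner (S k \<omega>) h)) u * char (distr M borel (\<lambda>\<omega>. c k * inner (Y \<omega>) h)) u"
      using char_distr_add[OF ind, of u] by simp
    also have "\<dots> = complex_of_real (exp (- (u\<^sup>2 * ((\<Sum>i<k. (c i)\<^sup>2 * (p (Suc i) - p i)) * q h) / 2)) *
       exp (- (u\<^sup>2 * ((c k)\<^sup>2 * (p (Suc k) - p k) * q h) / 2)))"
      using IH increment_char[OF pk, of "c k" h u] unfolding Y_def by simp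
    also have "exp (- (u\<^sup>2 * ((\<Sum>i<k. (c i)\<^sup>2 * (p (Suc i) - p i)) * q h) / 2)) *
       exp (- (u\<^sup>2 * ((c k)\<^sup>2 * (p (Suc k) - p k) * q h) / 2))
      = exp (- (u\<^sup>2 * ((\<Sum>i<Suc k. (c i)\<^sup>2 * (p (Suc i) - p i)) * q h) / 2))"
      unfolding exp_add[symmetric] by (intro arg_cong[where f = exp]) (simp add: field_simps)
    finally show ?thesis .
  qed
  have 3: "(\<integral>\<^sup>+ \<omega>. indicator B \<omega> * g (S (Suc k) \<omega>) \<partial>M) = emeasure M B * (\<integral>\<^sup>+ \<omega>. g (S (Suc k) \<omega>) \<partial>M)"
    if B: "B \<in> sets (F (p 0))" and g [measurable]: "g \<in> borel_measurable borel" for B and g :: "'h \<Rightarrow> ennreal"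
  proof -
    have sub: "B' \<in> sets (F (p k))" if "B' \<in> sets (F (p 0))" for B'
      using that subalgebra_F_mono[OF p(1)] IH unfolding subalgebra_def by blast
    have *: "(\<integral>\<^sup>+ \<omega>. indicator B' \<omega> * g (S (Suc k) \<omega>) \<partial>M)
      = (\<integral>\<^sup>+ y. (\<integral>\<^sup>+ \<omega>. indicator B' \<omega> * g (S k \<omega> + c k *\<^sub>R y) \<partial>M) \<partial>distr M borel Y)"
      if B': "B' \<in> sets (F (p 0))" for B'
    proof -
      note [measurable] = Sk sub[OF B']
      have "(\<lambda>z. indicator B' (fst z) * g (S k (fst z) + c k *\<^sub>R snd z)) \<in> borel_measurable (F (p k) \<Otimes>\<^sub>M borel)"
        by measurable
      from nn_integral_increment[OF pk this] show ?thesis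
        unfolding S_Suc Y_def by simp
    qed
    have gy: "(\<lambda>x. g (x + c k *\<^sub>R y)) \<in> borel_measurable borel" for y
      by (rule measurable_compose[OF _ g]) measurable
    have "(\<integral>\<^sup>+ \<omega>. indicator B' \<omega> * g (S (Suc k) \<omega>) \<partial>M)
      = emeasure M B' * (\<integral>\<^sup>+ y. (\<integral>\<^sup>+ \<omega>. g (S k \<omega> + c k *\<^sub>R y) \<partial>M) \<partial>distr M borel Y)"
      if B': "B' \<in> sets (F (p 0))" for B'
    proof -
      have "(\<integral>\<^sup>+ \<omega>. indicator B' \<omega> * g (S k \<omega> + c k *\<^sub>R y) \<partial>M) = emeasure M B' * (\<integral>\<^sup>+ \<omega>. g (S k \<omega> + c k *\<^sub>R y) \<partial>M)" for y
        by (rule IH[THEN conjunct2, THEN conjunct2, THEN conjunct2, THEN bspec, OF B', THEN bspec, OF gy])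
      then show ?thesis
        unfolding *[OF B'] by (simp add: nn_integral_cmult)
    qed
    \<comment> \<open>Taking the whole space for \<open>B'\<close> identifies the remaining double
      integral as the unconditional one.\<close>
    from this[OF B] this[of "space M"] show ?thesis
      using sets.top[of "F (p 0)"] space_F[OF p(1)] emeasure_space_1
      by (simp add: indicator_def cong: nn_integral_cong_simp)
  qed
  show ?case using 1 2 3 IH pk by (meson order_trans)
qed

end

section \<open>Pathwise integration by parts on a half-line\<close>

lemma continuous_on_halfline:
  fixes f :: "real \<Rightarrow> 'v::topological_space"
  assumes "\<And>b. a \<le> b \<Longrightarrow> continuous_on {a..b} f"
  shows "continuous_on {a..} f"
  unfolding continuous_on_eq_continuous_within
proof
  fix x assume x: "x \<in> {a..}"
  have "continuous (at x within {a..x+1}) f"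
    using assms[of "x + 1"] x unfolding continuous_on_eq_continuous_within by auto
  moreover have "at x within {a..x+1} = at x within {a..}"
    by (rule at_within_nhd[of x "{..<x+1}"]) auto
  ultimately show "continuous (at x within {a..}) f" by simp
qed

lemma continuous_on_integral_halfline:
  fixes f :: "real \<Rightarrow> 'h::{real_inner, complete_space}"
  assumes "continuous_on {a..} f"
  shows "continuous_on {a..} (\<lambda>t. integral {a..t} f)"
proof (rule continuous_on_halfline)
  fix b
  have f: "continuous_on {a..b} f" by (rule continuous_on_subset[OF assms]) auto
  show "continuous_on {a..b} (\<lambda>t. integral {a..t} f)"
    unfolding continuous_on_eq_continuous_within
    using hilbert_integral_has_vector_derivative[OF f] has_vector_derivative_continuous by blast
qed

text \<open>
  If \<open>w a = 0\<close>, this is the integral of \<open>\<phi>\<close> over \<open>[a, t]\<close> against \<open>w\<close>, integrated by parts.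
\<close>

definition by_parts :: "real \<Rightarrow> (real \<Rightarrow> real) \<Rightarrow> (real \<Rightarrow> real) \<Rightarrow> (real \<Rightarrow> 'h::real_normed_vector) \<Rightarrow> real \<Rightarrow> 'h" where
  "by_parts a \<phi> \<phi>' w t = \<phi> t *\<^sub>R w t - integral {a..t} (\<lambda>r. \<phi>' r *\<^sub>R w r)"

lemma continuous_on_by_parts:
  fixes w :: "real \<Rightarrow> 'h::{real_inner, complete_space}"
  assumes "continuous_on {a..} \<phi>" "continuous_on {a..} \<phi>'" "continuous_on {a..} w"
  shows "continuous_on {a..} (by_parts a \<phi> \<phi>' w)"
  unfolding by_parts_def[abs_def]
  by (intro continuous_on_diff continuous_on_scaleR continuous_on_integral_halfline assms)

text \<open>Parametrised by the root \<open>\<phi>\<close> of the clock's speed, because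
  \<open>\<phi>\<close> is what multiplies the noise and is differentiated in integration by parts.
  Its sign identifies it with the \<open>powr\<close> in \<open>driving_integral\<close>.\<close>

locale smooth_clock =
  fixes a :: real and \<phi> \<phi>' \<rho> :: "real \<Rightarrow> real"
  assumes \<phi>: "\<And>t. a \<le> t \<Longrightarrow> (\<phi> has_real_derivative \<phi>' t) (at t)"
    and \<phi>': "continuous_on {a..} \<phi>'"
    and \<phi>_nonneg: "\<And>t. a \<le> t \<Longrightarrow> 0 \<le> \<phi> t"
    and \<rho>: "\<And>t. a \<le> t \<Longrightarrow> (\<rho> has_real_derivative (\<phi> t)\<^sup>2) (at t)"
begin

lemma \<phi>_within: "a \<le> t \<Longrightarrow> (\<phi> has_real_derivative \<phi>' t) (at t within S)"
  using \<phi> has_field_derivative_at_within by blast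

lemma \<phi>_continuous: "continuous_on {a..} \<phi>"
  using \<phi> by (intro continuous_at_imp_continuous_on ballI DERIV_isCont) auto

lemma \<phi>_measurable: "\<phi> \<in> borel_measurable (restrict_space borel {a..})"
  by (rule borel_measurable_continuous_on_restrict[OF \<phi>_continuous])

lemma deriv_powr_half: "a \<le> t \<Longrightarrow> deriv \<rho> t powr (1/2) = \<phi> t"
  using DERIV_imp_deriv[OF \<rho>] \<phi>_nonneg by (simp add: powr_half_sqrt)

end

locale smooth_brownian = brownian M F a C W + smooth_clock a \<phi> \<phi>' \<rho>
  for M :: "'w measure" and F :: "real \<Rightarrow> 'w measure" and a :: real
    and C :: "'h::{real_inner, polish_space} \<Rightarrow>\<^sub>L 'h" and W :: "real \<Rightarrow> 'w \<Rightarrow> 'h"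
    and \<phi> \<phi>' \<rho> :: "real \<Rightarrow> real"
begin

lemma driving_integral_iff:
  "driving_integral M F a C W \<rho> J \<longleftrightarrow> stoch_integral_process M F a C W (\<lambda>r. \<phi> r *\<^sub>R id_blinfun) J"
proof -
  have "has_stoch_integral M C W (\<lambda>r. (deriv \<rho> r powr (1/2)) *\<^sub>R id_blinfun) a t I \<longleftrightarrow>
      has_stoch_integral M C W (\<lambda>r. \<phi> r *\<^sub>R id_blinfun) a t I" if t: "a \<le> t" for t I
    using has_stoch_integral_cong[OF _ order_refl t _ has_stoch_integral_measurable AE_I2[OF refl]]
    by (metis (no_types, lifting) deriv_powr_half)
  then show ?thesis unfolding driving_integral_def stoch_integral_process_def by blast
qed

lemma integrand_\<phi>: "integrand (\<lambda>r. \<phi> r *\<^sub>R A)"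
  by (rule integrand_scaleR[OF \<phi>_measurable]) (simp add: integrand_def)

lemma has_stoch_integral_smooth:
  assumes t: "a \<le> t"
  shows "\<exists>R. has_stoch_integral M C W (\<lambda>r. \<phi> r *\<^sub>R id_blinfun) a t R \<and>
    (AE \<omega> in M. R \<omega> = by_parts a \<phi> \<phi>' (\<lambda>r. W r \<omega>) t)"
  unfolding by_parts_def
\<comment> \<open>The identity integrand is multiplied by \<open>\<phi>\<close>. Its integral is the
  increment from \<open>a\<close>, as \<open>W a\<close> is zero only almost surely, while the
  continuous process is \<open>W\<close> itself.\<close>
proof (rule has_stoch_integral_scale_smooth[where I = "\<lambda>u \<omega>. W u \<omega> - W a \<omega>", OF _ _ t])
  show "has_stoch_integral M C W (\<lambda>r. id_blinfun) a u (\<lambda>\<omega>. W u \<omega> - W a \<omega>)" if u: "a \<le> u" for u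
  proof -
    have "has_stoch_integral M C W (\<lambda>r. indicator {a<..u} r *\<^sub>R id_blinfun) a u (\<lambda>\<omega>. W u \<omega> - W a \<omega>)"
    proof -
      have eq: "sfun [(id_blinfun, a, u)] = (\<lambda>r. indicator {a<..u} r *\<^sub>R id_blinfun)"
        "sint [(id_blinfun, a, u)] W = (\<lambda>\<omega>. W u \<omega> - W a \<omega>)" by (rule ext, simp)+
      have "steps_in a u [(id_blinfun, a, u)]" using u by simp
      from has_stoch_integral_sfun[OF this order_refl u] show ?thesis unfolding eq .
    qed
    then show ?thesis
      unfolding has_stoch_integral_iff[OF order_refl u]
    proof (elim conjE, intro conjI allI impI)
      fix e :: real
      assume *: "\<forall>e>0. \<exists>xs. steps_in a u xs \<and> cov_L2 C a u (\<lambda>r. indicator {a<..u} r *\<^sub>R id_blinfun - sfun xs r) \<le> ennreal e \<and>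
         mean_square M (\<lambda>\<omega>. W u \<omega> - W a \<omega> - sint xs W \<omega>) \<le> ennreal e" and "0 < e"
      \<comment> \<open>The step function omits the left end \<open>a\<close>, a null set.\<close>
      have "cov_L2 C a u (\<lambda>r. id_blinfun - f r) = cov_L2 C a u (\<lambda>r. indicator {a<..u} r *\<^sub>R id_blinfun - f r)" for f
        unfolding cov_L2_def
        by (intro nn_integral_cong_AE eventually_mono[OF AE_lborel_singleton[of a]])
          (auto split: split_indicator)
      then show "\<exists>xs. steps_in a u xs \<and> cov_L2 C a u (\<lambda>r. id_blinfun - sfun xs r) \<le> ennreal e \<and>
         mean_square M (\<lambda>\<omega>. W u \<omega> - W a \<omega> - sint xs W \<omega>) \<le> ennreal e"
        using * \<open>0 < e\<close> by simp
    qed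
  qed
  show "AE \<omega> in M. continuous_on {a..t} (\<lambda>u. W u \<omega>)"
    using W_continuous by eventually_elim (rule continuous_on_subset, auto)
  show "AE \<omega> in M. W u \<omega> = W u \<omega> - W a \<omega>" for u using W_start by eventually_elim simp
  show "(\<phi> has_real_derivative \<phi>' x) (at x within {a..t})" if "x \<in> {a..t}" for x
    using that by (intro \<phi>_within) auto
  show "continuous_on {a..t} \<phi>'" by (rule continuous_on_subset[OF \<phi>']) auto
qed (simp_all add: integrand_def \<phi>_measurable)

lemma has_stoch_integral_smooth_AE:
  assumes "a \<le> t" "has_stoch_integral M C W (\<lambda>r. \<phi> r *\<^sub>R id_blinfun) a t I"
  shows "AE \<omega> in M. I \<omega> = by_parts a \<phi> \<phi>' (\<lambda>r. W r \<omega>) t"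
proof -
  from has_stoch_integral_smooth[OF assms(1)] obtain R where
    R: "has_stoch_integral M C W (\<lambda>r. \<phi> r *\<^sub>R id_blinfun) a t R"
    "AE \<omega> in M. R \<omega> = by_parts a \<phi> \<phi>' (\<lambda>r. W r \<omega>) t" by blast
  from has_stoch_integral_unique[OF assms(2) R(1) order_refl assms(1) integrand_\<phi>] R(2)
  show ?thesis by eventually_elim simp
qed

lemma RS_sum_measurable_F:
  assumes "a \<le> u" "u \<le> v"
  shows "(\<lambda>\<omega>. RS_sum u v f (\<lambda>r. W r \<omega>) k) \<in> borel_measurable (F v)"
  unfolding RS_sum_def
proof (intro borel_measurable_sum borel_measurable_scaleR borel_measurable_const borel_measurable_diff W_measurable_F)
  fix i assume "i \<in> {..<Suc k}"
  then show "a \<le> grid u v k i" "grid u v k i \<le> v" "a \<le> grid u v k (Suc i)" "grid u v k (Suc i) \<le> v"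
    using grid_range[OF assms(2), of i k] grid_range[OF assms(2), of "Suc i" k] assms(1) by auto
qed

text \<open>The values are limits of sums over \<open>[a, t]\<close>, hence measurable for
  \<open>F t\<close> even if that lacks the null sets. Outside a single null set they equal
  \<open>by_parts\<close> at all times, whence continuity.\<close>

lemma smooth_integral_process_exists:
  "\<exists>J. stoch_integral_process M F a C W (\<lambda>r. \<phi> r *\<^sub>R id_blinfun) J"
proof
  define J where "J t \<omega> = clim (RS_sum a t \<phi> (\<lambda>u. W u \<omega>))" for t \<omega>
  have J: "AE \<omega> in M. \<forall>t\<ge>a. J t \<omega> = by_parts a \<phi> \<phi>' (\<lambda>r. W r \<omega>) t"
    using W_continuous W_start
  proof eventually_elim
    case (elim \<omega>)
    show ?case
    proof (intro allI impI)
      fix t assume t: "a \<le> t"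
      have "RS_sum a t \<phi> (\<lambda>u. W u \<omega>) \<longlonglongrightarrow> \<phi> t *\<^sub>R W t \<omega> - \<phi> a *\<^sub>R W a \<omega> - integral {a..t} (\<lambda>r. \<phi>' r *\<^sub>R W r \<omega>)"
        using \<phi>' by (intro RS_sum_tendsto t continuous_on_subset[OF elim(1)] \<phi>_within)
          (auto intro: continuous_on_subset)
      then show "J t \<omega> = by_parts a \<phi> \<phi>' (\<lambda>r. W r \<omega>) t"
        unfolding J_def by_parts_def using elim(2) by (simp add: clim_eq)
    qed
  qed
  have JF: "J t \<in> borel_measurable (F t)" if "a \<le> t" for t
    unfolding J_def[abs_def] by (intro borel_measurable_clim RS_sum_measurable_F that order_refl)
  show "stoch_integral_process M F a C W (\<lambda>r. \<phi> r *\<^sub>R id_blinfun) J"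
    unfolding stoch_integral_process_def
  proof (intro conjI allI impI)
    show "adapted F a J" unfolding adapted_def using JF by blast
    show "continuous_process M a J"
      unfolding continuous_process_def using J W_continuous
    proof eventually_elim
      case (elim \<omega>)
      have "continuous_on {a..} (by_parts a \<phi> \<phi>' (\<lambda>r. W r \<omega>))"
        by (intro continuous_on_by_parts \<phi>_continuous \<phi>' elim)
      then show ?case
        by (rule iffD2[OF continuous_on_cong[OF refl], rotated]) (use elim in auto)
    qed
    fix t assume t: "a \<le> t"
    from has_stoch_integral_smooth[OF t] obtain R where
      R: "has_stoch_integral M C W (\<lambda>r. \<phi> r *\<^sub>R id_blinfun) a t R"
      "AE \<omega> in M. R \<omega> = by_parts a \<phi> \<phi>' (\<lambda>r. W r \<omega>) t" by blast
    have "AE \<omega> in M. R \<omega> = J t \<omega>" using R(2) J by eventually_elim (use t in auto)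
    then show "has_stoch_integral M C W (\<lambda>r. \<phi> r *\<^sub>R id_blinfun) a t (J t)"
      by (rule has_stoch_integral_cong[OF R(1) order_refl t refl measurable_F_M[OF t JF[OF t]]])
  qed
qed

text \<open>The sums use only increments of \<open>W\<close> inside \<open>[u, v]\<close>; this is
  what makes the increment of \<open>J\<close> inherit independence from \<open>F u\<close>.\<close>

lemma RS_sum_tendsto_increment:
  assumes J: "\<And>t. a \<le> t \<Longrightarrow> has_stoch_integral M C W (\<lambda>r. \<phi> r *\<^sub>R id_blinfun) a t (J t)"
    and uv: "a \<le> u" "u \<le> v"
  shows "AE \<omega> in M. RS_sum u v \<phi> (\<lambda>r. W r \<omega>) \<longlonglongrightarrow> J v \<omega> - J u \<omega>"
  using has_stoch_integral_smooth_AE[OF uv(1) J[OF uv(1)]]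
    has_stoch_integral_smooth_AE[OF order_trans[OF uv] J[OF order_trans[OF uv]]] W_continuous
proof eventually_elim
  case (elim \<omega>)
  have c: "continuous_on {a..v} (\<lambda>r. \<phi>' r *\<^sub>R W r \<omega>)"
    by (intro continuous_on_scaleR continuous_on_subset[OF \<phi>'] continuous_on_subset[OF elim(3)]) auto
  have "RS_sum u v \<phi> (\<lambda>r. W r \<omega>) \<longlonglongrightarrow> \<phi> v *\<^sub>R W v \<omega> - \<phi> u *\<^sub>R W u \<omega> - integral {u..v} (\<lambda>r. \<phi>' r *\<^sub>R W r \<omega>)"
    using \<phi>' uv by (intro RS_sum_tendsto uv continuous_on_subset[OF elim(3)] \<phi>_within)
      (auto intro: continuous_on_subset)
  also have "\<phi> v *\<^sub>R W v \<omega> - \<phi> u *\<^sub>R W u \<omega> - integral {u..v} (\<lambda>r. \<phi>' r *\<^sub>R W r \<omega>) = J v \<omega> - J u \<omega>"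
    using hilbert_integral_combine[OF uv c] unfolding elim(1,2) by_parts_def by (simp add: algebra_simps)
  finally show ?case .
qed

text \<open>These are the Riemann-Stieltjes sums of the square of \<open>\<phi>\<close> against the
  path \<open>w r = r\<close>. Their limit comes integrated by parts, and
  \<open>(\<phi> r)\<^sup>2 * r - \<rho> r\<close> is an antiderivative of the correction.\<close>

lemma variance_tendsto:
  assumes uv: "a \<le> u" "u \<le> v"
  shows "(\<lambda>k. \<Sum>i<Suc k. (\<phi> (grid u v k i))\<^sup>2 * (grid u v k (Suc i) - grid u v k i)) \<longlonglongrightarrow> \<rho> v - \<rho> u"
proof -
  have d2: "((\<lambda>r. (\<phi> r)\<^sup>2) has_real_derivative 2 * \<phi> x * \<phi>' x) (at x within S)" if "a \<le> x" for x S
    using \<phi>_within[OF that] by (auto intro!: derivative_eq_intros)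
  have c2: "continuous_on {u..v} (\<lambda>x. 2 * \<phi> x * \<phi>' x)"
    by (intro continuous_intros continuous_on_subset[OF \<phi>_continuous] continuous_on_subset[OF \<phi>']) (use uv in auto)
  have "RS_sum u v (\<lambda>r. (\<phi> r)\<^sup>2) (\<lambda>r. r) \<longlonglongrightarrow>
      (\<phi> v)\<^sup>2 *\<^sub>R v - (\<phi> u)\<^sup>2 *\<^sub>R u - integral {u..v} (\<lambda>r. (2 * \<phi> r * \<phi>' r) *\<^sub>R r)"
    using uv by (intro RS_sum_tendsto c2 d2 continuous_on_id) auto
  also have "integral {u..v} (\<lambda>r. (2 * \<phi> r * \<phi>' r) *\<^sub>R r) = (\<phi> v)\<^sup>2 * v - (\<phi> u)\<^sup>2 * u - (\<rho> v - \<rho> u)"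
  proof (rule integral_unique)
    have "((\<lambda>r. 2 * \<phi> r * \<phi>' r * r) has_integral ((\<phi> v)\<^sup>2 * v - \<rho> v) - ((\<phi> u)\<^sup>2 * u - \<rho> u)) {u..v}"
    proof (rule fundamental_theorem_of_calculus[OF uv(2)])
      fix x assume "x \<in> {u..v}"
      then have x: "a \<le> x" using uv by auto
      show "((\<lambda>r. (\<phi> r)\<^sup>2 * r - \<rho> r) has_vector_derivative 2 * \<phi> x * \<phi>' x * x) (at x within {u..v})"
        unfolding has_real_derivative_iff_has_vector_derivative[symmetric]
        by (rule DERIV_cong[OF DERIV_diff[OF DERIV_mult[OF d2[OF x] DERIV_ident]
                \<rho>[OF x, THEN has_field_derivative_at_within]]]) simp
    qed
    then show "((\<lambda>r. (2 * \<phi> r * \<phi>' r) *\<^sub>R r) has_integral (\<phi> v)\<^sup>2 * v - (\<phi> u)\<^sup>2 * u - (\<rho> v - \<rho> u)) {u..v}"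
      by (simp add: algebra_simps)
  qed
  finally show ?thesis unfolding RS_sum_def[abs_def] by simp
qed

text \<open>Both properties are inherited from the weighted sums. The law passes to the limit
  through characteristic functions. Independence passes first for bounded continuous functions of
  the increment, then for open sets, and then to Borel sets, since preimages of open sets form a
  generator stable under intersection.\<close>

lemma smooth_integral_increment:
  assumes J: "\<And>t. a \<le> t \<Longrightarrow> has_stoch_integral M C W (\<lambda>r. \<phi> r *\<^sub>R id_blinfun) a t (J t)"
    and uv: "a \<le> u" "u \<le> v"
  shows "centred_gaussian M ((\<rho> v - \<rho> u) *\<^sub>R C) (\<lambda>\<omega>. J v \<omega> - J u \<omega>)"
    and "indep_set (sets (F u)) (sets (vimage_algebra (space M) (\<lambda>\<omega>. J v \<omega> - J u \<omega>) borel))"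
proof -
  define D where "D \<omega> = J v \<omega> - J u \<omega>" for \<omega>
  define S where "S k \<omega> = RS_sum u v \<phi> (\<lambda>r. W r \<omega>) k" for k \<omega>
  have [measurable]: "J v \<in> borel_measurable M" "J u \<in> borel_measurable M"
    using J has_stoch_integral_measurable order_trans[OF uv] uv(1) by blast+
  have Dm [measurable]: "D \<in> borel_measurable M" unfolding D_def by measurable
  have Sm [measurable]: "S k \<in> borel_measurable M" for k
    unfolding S_def by (rule measurable_F_M[OF order_trans[OF uv] RS_sum_measurable_F[OF uv]])
  have lim: "AE \<omega> in M. (\<lambda>k. S k \<omega>) \<longlonglongrightarrow> D \<omega>"
    using RS_sum_tendsto_increment[OF J uv] unfolding S_def D_def by simp
  define V where "V k = (\<Sum>i<Suc k. (\<phi> (grid u v k i))\<^sup>2 * (grid u v k (Suc i) - grid u v k i))" for k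
  have V: "V \<longlonglongrightarrow> \<rho> v - \<rho> u" unfolding V_def[abs_def] by (rule variance_tendsto[OF uv])
  have "0 \<le> V k" for k
    unfolding V_def by (intro sum_nonneg mult_nonneg_nonneg) (auto simp: grid_mono[OF uv(2)])
  then have V0: "0 \<le> \<rho> v - \<rho> u" by (intro LIMSEQ_le_const[OF V]) auto
  have step: "(\<forall>h x. char (distr M borel (\<lambda>\<omega>. inner (S k \<omega>) h)) x = complex_of_real (exp (- (x\<^sup>2 * (V k * q h) / 2)))) \<and>
    (\<forall>B\<in>sets (F u). \<forall>g\<in>borel_measurable borel.
      (\<integral>\<^sup>+ \<omega>. indicator B \<omega> * g (S k \<omega>) \<partial>M) = emeasure M B * (\<integral>\<^sup>+ \<omega>. (g (S k \<omega>) :: ennreal) \<partial>M))" for k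
    using weighted_increments[of "grid u v k" "Suc k" "Suc k" "\<lambda>i. \<phi> (grid u v k i)"] uv grid_mono[OF uv(2)]
    unfolding S_def RS_sum_def V_def by simp
  have "if (\<rho> v - \<rho> u) * q h = 0 then (AE \<omega> in M. inner (D \<omega>) h = 0)
      else distributed M lborel (\<lambda>\<omega>. inner (D \<omega>) h) (normal_density 0 (sqrt ((\<rho> v - \<rho> u) * q h)))" for h
  proof (rule centred_normal_if_char)
    show "0 \<le> (\<rho> v - \<rho> u) * q h" using V0 q_nonneg by simp
    fix x
    have "(\<lambda>k. char (distr M borel (\<lambda>\<omega>. inner (S k \<omega>) h)) x) \<longlonglongrightarrow> char (distr M borel (\<lambda>\<omega>. inner (D \<omega>) h)) x"
      by (rule char_tendsto) (measurable, use lim in \<open>eventually_elim, intro tendsto_intros\<close>)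
    moreover have "(\<lambda>k. char (distr M borel (\<lambda>\<omega>. inner (S k \<omega>) h)) x) \<longlonglongrightarrow> complex_of_real (exp (- (x\<^sup>2 * ((\<rho> v - \<rho> u) * q h) / 2)))"
      using step by (simp only:) (intro tendsto_intros V, simp)
    ultimately show "char (distr M borel (\<lambda>\<omega>. inner (D \<omega>) h)) x = complex_of_real (exp (- (x\<^sup>2 * ((\<rho> v - \<rho> u) * q h) / 2)))"
      by (rule LIMSEQ_unique)
  qed measurable
  then show "centred_gaussian M ((\<rho> v - \<rho> u) *\<^sub>R C) (\<lambda>\<omega>. J v \<omega> - J u \<omega>)"
    unfolding centred_gaussian_def D_def[symmetric] by (simp add: blinfun.scaleR_left)
  have cont: "(\<integral>\<^sup>+ \<omega>. indicator B \<omega> * ennreal (g (D \<omega>)) \<partial>M) = emeasure M B * (\<integral>\<^sup>+ \<omega>. ennreal (g (D \<omega>)) \<partial>M)"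
    if B: "B \<in> sets (F u)" and g: "continuous_on UNIV g" "\<And>x. 0 \<le> g x" "\<And>x. g x \<le> 1"
    for B and g :: "'h \<Rightarrow> real"
  proof -
    have BM [measurable]: "B \<in> sets M" using B subalgebra_F[OF uv(1)] unfolding subalgebra_def by blast
    have [measurable]: "g \<in> borel_measurable borel" by (rule borel_measurable_continuous_onI[OF g(1)])
    have gS: "AE \<omega> in M. (\<lambda>k. ennreal (g (S k \<omega>))) \<longlonglongrightarrow> ennreal (g (D \<omega>))"
      using lim by eventually_elim (intro tendsto_ennrealI continuous_on_tendsto_compose[OF g(1)], auto)
    have *: "(\<lambda>k. \<integral>\<^sup>+ \<omega>. indicator B' \<omega> * ennreal (g (S k \<omega>)) \<partial>M) \<longlonglongrightarrow> (\<integral>\<^sup>+ \<omega>. indicator B' \<omega> * ennreal (g (D \<omega>)) \<partial>M)"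
      if [measurable]: "B' \<in> sets M" for B'
    proof (rule nn_integral_dominated_convergence[where w = "\<lambda>_. 1"])
      show "AE \<omega> in M. (\<lambda>k. indicator B' \<omega> * ennreal (g (S k \<omega>))) \<longlonglongrightarrow> indicator B' \<omega> * ennreal (g (D \<omega>))"
        using gS by eventually_elim (auto split: split_indicator)
      have "ennreal (g x) \<le> 1" for x using ennreal_leI[OF g(3)] by simp
      then show "AE \<omega> in M. indicator B' \<omega> * ennreal (g (S k \<omega>)) \<le> 1" for k
        by (auto split: split_indicator)
    qed (auto simp: emeasure_space_1)
    have "(\<integral>\<^sup>+ \<omega>. indicator B \<omega> * ennreal (g (S k \<omega>)) \<partial>M)
       = emeasure M B * (\<integral>\<^sup>+ \<omega>. indicator (space M) \<omega> * ennreal (g (S k \<omega>)) \<partial>M)" for k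
    proof -
      have gm: "(\<lambda>x. ennreal (g x)) \<in> borel_measurable borel" by measurable
      have "(\<integral>\<^sup>+ \<omega>. indicator B \<omega> * ennreal (g (S k \<omega>)) \<partial>M) = emeasure M B * (\<integral>\<^sup>+ \<omega>. ennreal (g (S k \<omega>)) \<partial>M)"
        by (rule step[THEN conjunct2, THEN bspec, OF B, THEN bspec, OF gm])
      also have "(\<integral>\<^sup>+ \<omega>. ennreal (g (S k \<omega>)) \<partial>M) = (\<integral>\<^sup>+ \<omega>. indicator (space M) \<omega> * ennreal (g (S k \<omega>)) \<partial>M)"
        by (rule nn_integral_cong) simp
      finally show ?thesis .
    qed
    with *[OF BM] have "(\<lambda>k. emeasure M B * (\<integral>\<^sup>+ \<omega>. indicator (space M) \<omega> * ennreal (g (S k \<omega>)) \<partial>M))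
        \<longlonglongrightarrow> (\<integral>\<^sup>+ \<omega>. indicator B \<omega> * ennreal (g (D \<omega>)) \<partial>M)" by simp
    moreover have "(\<lambda>k. emeasure M B * (\<integral>\<^sup>+ \<omega>. indicator (space M) \<omega> * ennreal (g (S k \<omega>)) \<partial>M))
        \<longlonglongrightarrow> emeasure M B * (\<integral>\<^sup>+ \<omega>. indicator (space M) \<omega> * ennreal (g (D \<omega>)) \<partial>M)"
      by (intro ennreal_tendsto_cmult *) (auto simp: emeasure_eq_measure)
    ultimately have "(\<integral>\<^sup>+ \<omega>. indicator B \<omega> * ennreal (g (D \<omega>)) \<partial>M)
      = emeasure M B * (\<integral>\<^sup>+ \<omega>. indicator (space M) \<omega> * ennreal (g (D \<omega>)) \<partial>M)"
      by (rule LIMSEQ_unique)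
    also have "(\<integral>\<^sup>+ \<omega>. indicator (space M) \<omega> * ennreal (g (D \<omega>)) \<partial>M) = (\<integral>\<^sup>+ \<omega>. ennreal (g (D \<omega>)) \<partial>M)"
      by (rule nn_integral_cong) simp
    finally show ?thesis .
  qed
  have openU: "prob (B \<inter> (D -` U \<inter> space M)) = prob B * prob (D -` U \<inter> space M)"
    if B: "B \<in> sets (F u)" and U: "open U" for B U
  \<comment> \<open>Separate because the distance to the empty complement is 0 by convention, so
    that the approximating functions below would vanish.\<close>
  proof (cases "U = UNIV")
    case True
    have "B \<in> sets M" using B subalgebra_F[OF uv(1)] unfolding subalgebra_def by blast
    then show ?thesis using True by (simp add: prob_space sets.sets_into_space Int_absorb2)
  next
    case False
    have BM [measurable]: "B \<in> sets M" using B subalgebra_F[OF uv(1)] unfolding subalgebra_def by blast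
    have [measurable]: "U \<in> sets borel" using U by simp
    \<comment> \<open>Continuous functions with values in \<open>[0, 1]\<close> that increase to the
      indicator of \<open>U\<close>.\<close>
    define g where "g m x = min 1 (real m * infdist x (- U))" for m x
    have g: "continuous_on UNIV (g m)" "0 \<le> g m x" "g m x \<le> 1" for m x
      unfolding g_def[abs_def] by (auto intro!: continuous_intros simp: infdist_nonneg)
    have [measurable]: "g m \<in> borel_measurable borel" for m by (rule borel_measurable_continuous_onI[OF g(1)])
    have glim: "(\<lambda>m. ennreal (g m x)) \<longlonglongrightarrow> indicator U x" for x
    proof (cases "x \<in> U")
      case True
      have "- U \<noteq> {}" "closed (- U)" using False U by auto
      then have pos: "0 < infdist x (- U)"
        using True infdist_nonneg[of x "- U"] in_closed_iff_infdist_zero[of "- U" x] by fastforce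
      obtain m0 :: nat where m0: "1 / infdist x (- U) < real m0" using reals_Archimedean2 by blast
      have "g m x = 1" if "m0 \<le> m" for m
      proof -
        have "1 / infdist x (- U) < real m" using m0 that by (simp add: less_le_trans)
        then have "1 < real m * infdist x (- U)" using pos by (simp add: field_simps)
        then show ?thesis by (simp add: g_def)
      qed
      then have "\<forall>\<^sub>F m in sequentially. ennreal (g m x) = indicator U x"
        using True by (intro eventually_sequentiallyI[of m0]) simp
      then show ?thesis by (rule tendsto_eventually)
    next
      case False
      then have "g m x = 0" for m by (simp add: g_def infdist_zero)
      then show ?thesis using False by simp
    qed
    have *: "(\<lambda>m. \<integral>\<^sup>+ \<omega>. indicator B' \<omega> * ennreal (g m (D \<omega>)) \<partial>M) \<longlonglongrightarrow> (\<integral>\<^sup>+ \<omega>. indicator B' \<omega> * indicator U (D \<omega>) \<partial>M)"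
      if [measurable]: "B' \<in> sets M" for B'
    proof (rule nn_integral_dominated_convergence[where w = "\<lambda>_. 1"])
      show "AE \<omega> in M. (\<lambda>k. indicator B' \<omega> * ennreal (g k (D \<omega>))) \<longlonglongrightarrow> indicator B' \<omega> * indicator U (D \<omega>)"
        by (intro AE_I2 ennreal_tendsto_cmult glim) (auto split: split_indicator)
      have "ennreal (g m x) \<le> 1" for m x using ennreal_leI[OF g(3)] by simp
      then show "AE \<omega> in M. indicator B' \<omega> * ennreal (g k (D \<omega>)) \<le> 1" for k
        by (auto split: split_indicator)
    qed (auto simp: emeasure_space_1)
    have em: "(\<integral>\<^sup>+ \<omega>. indicator B' \<omega> * indicator U (D \<omega>) \<partial>M) = emeasure M (B' \<inter> (D -` U \<inter> space M))"
      if [measurable]: "B' \<in> sets M" for B'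
    proof -
      have "(\<integral>\<^sup>+ \<omega>. indicator B' \<omega> * indicator U (D \<omega>) \<partial>M) = (\<integral>\<^sup>+ \<omega>. indicator (B' \<inter> (D -` U \<inter> space M)) \<omega> \<partial>M)"
        by (rule nn_integral_cong) (auto split: split_indicator)
      also have "\<dots> = emeasure M (B' \<inter> (D -` U \<inter> space M))"
        by (rule nn_integral_indicator) measurable
      finally show ?thesis .
    qed
    have "(\<integral>\<^sup>+ \<omega>. indicator B \<omega> * ennreal (g m (D \<omega>)) \<partial>M)
      = emeasure M B * (\<integral>\<^sup>+ \<omega>. indicator (space M) \<omega> * ennreal (g m (D \<omega>)) \<partial>M)" for m
      unfolding cont[OF B g] by (intro arg_cong2[where f = times] refl nn_integral_cong) simp
    with *[OF BM] have "(\<lambda>m. emeasure M B * (\<integral>\<^sup>+ \<omega>. indicator (space M) \<omega> * ennreal (g m (D \<omega>)) \<partial>M))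
        \<longlonglongrightarrow> emeasure M (B \<inter> (D -` U \<inter> space M))" unfolding em[OF BM] by simp
    moreover have "(\<lambda>m. emeasure M B * (\<integral>\<^sup>+ \<omega>. indicator (space M) \<omega> * ennreal (g m (D \<omega>)) \<partial>M))
        \<longlonglongrightarrow> emeasure M B * emeasure M (space M \<inter> (D -` U \<inter> space M))"
      unfolding em[OF sets.top, symmetric]
      by (intro ennreal_tendsto_cmult *) (auto simp: emeasure_eq_measure)
    ultimately have "emeasure M (B \<inter> (D -` U \<inter> space M)) = emeasure M B * emeasure M (space M \<inter> (D -` U \<inter> space M))"
      by (rule LIMSEQ_unique)
    also have "space M \<inter> (D -` U \<inter> space M) = D -` U \<inter> space M" by auto
    finally show ?thesis
      by (simp add: emeasure_eq_measure ennreal_mult[symmetric])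
  qed
  let ?G = "{D -` U \<inter> space M | U. open U}"
  have FM: "sets (F u) \<subseteq> sets M" using subalgebra_F[OF uv(1)] unfolding subalgebra_def by blast
  have "indep_set (sets (F u)) ?G"
    unfolding indep_sets2_eq using openU FM by (auto intro: measurable_sets[OF Dm])
  moreover have "Int_stable ?G"
  proof (rule Int_stableI)
    fix x y assume "x \<in> ?G" "y \<in> ?G"
    then obtain U1 U2 where "open U1" "open U2" "x = D -` U1 \<inter> space M" "y = D -` U2 \<inter> space M" by blast
    then have "x \<inter> y = D -` (U1 \<inter> U2) \<inter> space M" "open (U1 \<inter> U2)" by auto
    then show "x \<inter> y \<in> ?G" by blast
  qed
  ultimately have ind: "indep_set (sigma_sets (space M) (sets (F u))) (sigma_sets (space M) ?G)"
    by (intro indep_set_sigma_sets) (auto intro: sets.Int_stable)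
  have "sigma_sets (space M) ?G = {D -` A \<inter> space M | A. A \<in> sigma_sets UNIV {U. open U}}"
    using sigma_sets_vimage_commute[of D "space M" UNIV "{U. open U}"] by simp
  also have "\<dots> = sets (vimage_algebra (space M) D borel)"
    by (simp add: sets_vimage_algebra2 sets_borel)
  finally have 1: "sigma_sets (space M) ?G = sets (vimage_algebra (space M) D borel)" .
  have 2: "sigma_sets (space M) (sets (F u)) = sets (F u)"
    using sets.sigma_sets_eq[of "F u"] space_F[OF uv(1)] by simp
  show "indep_set (sets (F u)) (sets (vimage_algebra (space M) (\<lambda>\<omega>. J v \<omega> - J u \<omega>) borel))"
    using ind unfolding 1 2 D_def .
qed

end

section \<open>Time change of trajectory solutions\<close>

lemma blinfun_by_parts:
  fixes w :: "real \<Rightarrow> 'h::{real_inner, complete_space}" and A :: "'h \<Rightarrow>\<^sub>L 'h"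
  assumes "continuous_on {a..} \<phi>'" "continuous_on {a..} w"
  shows "blinfun_apply A (by_parts a \<phi> \<phi>' w t) = by_parts a \<phi> \<phi>' (\<lambda>r. blinfun_apply A (w r)) t"
proof -
  have "continuous_on {a..t} (\<lambda>r. \<phi>' r *\<^sub>R w r)"
    by (intro continuous_on_scaleR continuous_on_subset[OF assms(1)] continuous_on_subset[OF assms(2)]) auto
  from integral_linear[OF hilbert_integrable_continuous[OF this] blinfun.bounded_linear_right[of A]]
  show ?thesis unfolding by_parts_def o_def by (simp add: blinfun.bilinear_simps)
qed

text \<open>Besides inverse clocks, two consequences of inversion are assumed: the reciprocity
  \<open>\<psi> s * \<phi> (\<eta> s) = 1\<close> of the rates and its derivative, in which
  \<open>\<eta>' = \<psi>\<^sup>2\<close> produces the cube.\<close>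

locale time_change = smooth_clock a \<phi> \<phi>' \<rho>
  for a :: real and \<phi> \<phi>' \<rho> :: "real \<Rightarrow> real" +
  fixes c :: real and \<psi> \<psi>' \<eta> :: "real \<Rightarrow> real"
  assumes \<psi>: "\<And>s. c \<le> s \<Longrightarrow> (\<psi> has_real_derivative \<psi>' s) (at s)"
    and \<psi>': "continuous_on {c..} \<psi>'"
    and \<eta>: "\<And>s. c \<le> s \<Longrightarrow> (\<eta> has_real_derivative (\<psi> s)\<^sup>2) (at s)"
    and \<eta>_start: "\<eta> c = a"
    and \<rho>_ge: "\<And>t. a \<le> t \<Longrightarrow> c \<le> \<rho> t"
    and \<eta>_mono: "\<And>s s'. c \<le> s \<Longrightarrow> s \<le> s' \<Longrightarrow> \<eta> s \<le> \<eta> s'"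
    and \<rho>_mono: "\<And>t t'. a \<le> t \<Longrightarrow> t \<le> t' \<Longrightarrow> \<rho> t \<le> \<rho> t'"
    and \<rho>_\<eta> [simp]: "\<And>s. c \<le> s \<Longrightarrow> \<rho> (\<eta> s) = s"
    and \<eta>_\<rho> [simp]: "\<And>t. a \<le> t \<Longrightarrow> \<eta> (\<rho> t) = t"
    and \<psi>_\<phi>: "\<And>s. c \<le> s \<Longrightarrow> \<psi> s * \<phi> (\<eta> s) = 1"
    and \<psi>'_\<phi>: "\<And>s. c \<le> s \<Longrightarrow> \<psi>' s * \<phi> (\<eta> s) = - (\<psi> s ^ 3 * \<phi>' (\<eta> s))"

text \<open>\<open>J\<close> is an arbitrary version of the driving integral, since the time-changed
  solution is claimed for each of them.\<close>

locale changed_brownian = smooth_brownian M F a C W \<phi> \<phi>' \<rho> + time_change a \<phi> \<phi>' \<rho> c \<psi> \<psi>' \<eta>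
  for M :: "'w measure" and F :: "real \<Rightarrow> 'w measure" and a :: real
    and C :: "'h::{real_inner, polish_space} \<Rightarrow>\<^sub>L 'h" and W :: "real \<Rightarrow> 'w \<Rightarrow> 'h"
    and \<phi> \<phi>' \<rho> :: "real \<Rightarrow> real" and c :: real and \<psi> \<psi>' \<eta> :: "real \<Rightarrow> real" +
  fixes J :: "real \<Rightarrow> 'w \<Rightarrow> 'h"
  assumes J: "stoch_integral_process M F a C W (\<lambda>r. \<phi> r *\<^sub>R id_blinfun) J"
begin

lemma \<eta>_ge: "c \<le> s \<Longrightarrow> a \<le> \<eta> s"
  using \<eta>_mono[of c s] \<eta>_start by simp

lemma \<eta>_continuous: "continuous_on {c..} \<eta>"
  using \<eta> by (intro continuous_at_imp_continuous_on ballI DERIV_isCont) auto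

lemma \<psi>_continuous: "continuous_on {c..} \<psi>"
  using \<psi> by (intro continuous_at_imp_continuous_on ballI DERIV_isCont) auto

lemma continuous_on_o_\<eta>: "continuous_on {a..} f \<Longrightarrow> continuous_on {c..} (\<lambda>s. f (\<eta> s))"
  by (rule continuous_on_compose2[OF _ \<eta>_continuous]) (auto simp: \<eta>_ge)

lemma J_integral: "a \<le> t \<Longrightarrow> has_stoch_integral M C W (\<lambda>r. \<phi> r *\<^sub>R id_blinfun) a t (J t)"
  using J unfolding stoch_integral_process_def by blast

text \<open>An increment of \<open>J\<close> has variance given by the clock \<open>\<rho>\<close>;
  evaluated along its inverse \<open>\<eta>\<close>, the clock difference is just
  \<open>t - s\<close>.\<close>

lemma brownian_changed: "brownian M (\<lambda>s. F (\<eta> s)) c C (\<lambda>s. J (\<eta> s))"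
proof
  show "filtration_on M (\<lambda>s. F (\<eta> s)) c"
    unfolding filtration_on_def using subalgebra_F subalgebra_F_mono \<eta>_ge \<eta>_mono order_trans by meson
  show "brownian_motion M (\<lambda>s. F (\<eta> s)) c C (\<lambda>s. J (\<eta> s))"
    unfolding brownian_motion_def
  proof (intro conjI allI impI)
    show "covariance_operator C" by (rule covariance)
    show "adapted (\<lambda>s. F (\<eta> s)) c (\<lambda>s. J (\<eta> s))"
      using J \<eta>_ge unfolding stoch_integral_process_def adapted_def by blast
    have "AE \<omega> in M. continuous_on {a..} (\<lambda>t. J t \<omega>)"
      using J unfolding stoch_integral_process_def continuous_process_def by blast
    then show "continuous_process M c (\<lambda>s. J (\<eta> s))"
      unfolding continuous_process_def by eventually_elim (rule continuous_on_o_\<eta>)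
    show "AE \<omega> in M. J (\<eta> c) \<omega> = 0"
      using has_stoch_integral_smooth_AE[OF order_refl J_integral[OF order_refl]] W_start
      unfolding \<eta>_start by eventually_elim (simp add: by_parts_def)
    fix s t assume st: "c \<le> s \<and> s \<le> t"
    then have st': "a \<le> \<eta> s" "\<eta> s \<le> \<eta> t" "\<rho> (\<eta> t) - \<rho> (\<eta> s) = t - s"
      using \<eta>_ge \<eta>_mono by auto
    show "centred_gaussian M ((t - s) *\<^sub>R C) (\<lambda>\<omega>. J (\<eta> t) \<omega> - J (\<eta> s) \<omega>)"
      using smooth_integral_increment(1)[OF J_integral st'(1,2)] st'(3) by simp
    show "indep_set (sets (F (\<eta> s))) (sets (vimage_algebra (space M) (\<lambda>\<omega>. J (\<eta> t) \<omega> - J (\<eta> s) \<omega>) borel))"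
      by (rule smooth_integral_increment(2)[OF J_integral st'(1,2)])
  qed
qed

sublocale B: brownian M "\<lambda>s. F (\<eta> s)" c C "\<lambda>s. J (\<eta> s)"
  by (rule brownian_changed)

lemma integral_o_\<eta>_derivative:
  fixes f :: "real \<Rightarrow> 'v::{real_inner, complete_space}"
  assumes f: "continuous_on {a..} f" and r: "r \<in> {c..s}"
  shows "((\<lambda>r. integral {a..\<eta> r} f) has_vector_derivative (\<psi> r)\<^sup>2 *\<^sub>R f (\<eta> r)) (at r within {c..s})"
proof -
  have "(\<eta> has_vector_derivative (\<psi> r)\<^sup>2) (at r within {c..s})"
    using \<eta>[of r, THEN has_field_derivative_at_within] r
    by (simp add: has_real_derivative_iff_has_vector_derivative)
  moreover have "((\<lambda>t. integral {a..t} f) has_vector_derivative f (\<eta> r)) (at (\<eta> r) within \<eta> ` {c..s})"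
  proof (rule has_vector_derivative_within_subset)
    show "((\<lambda>t. integral {a..t} f) has_vector_derivative f (\<eta> r)) (at (\<eta> r) within {a..\<eta> s})"
      by (rule hilbert_integral_has_vector_derivative[OF continuous_on_subset[OF f]])
        (use r \<eta>_ge \<eta>_mono in auto)
    show "\<eta> ` {c..s} \<subseteq> {a..\<eta> s}" using \<eta>_ge \<eta>_mono by auto
  qed
  ultimately show ?thesis using vector_diff_chain_within by (fastforce simp: o_def)
qed

lemma integral_substitution:
  fixes f :: "real \<Rightarrow> 'v::{real_inner, complete_space}"
  assumes f: "continuous_on {a..} f" and s: "c \<le> s"
  shows "integral {a..\<eta> s} f = integral {c..s} (\<lambda>r. (\<psi> r)\<^sup>2 *\<^sub>R f (\<eta> r))"
  using integral_unique[OF hilbert_FTC[OF s integral_o_\<eta>_derivative[OF f]]] by (simp add: \<eta>_start)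

text \<open>The path form of recovering \<open>W\<close> from the driving integral: integrating
  \<open>\<phi>\<close> and then \<open>\<psi>\<close> along the inverse clock multiplies by
  \<open>\<psi> s * \<phi> (\<eta> s) = 1\<close>, and the two correction integrals cancel.\<close>

lemma by_parts_inverse:
  fixes w :: "real \<Rightarrow> 'h"
  assumes w: "continuous_on {a..} w" and s: "c \<le> s"
  shows "by_parts c \<psi> \<psi>' (\<lambda>r. by_parts a \<phi> \<phi>' w (\<eta> r)) s = w (\<eta> s)"
proof -
  define \<Phi> where "\<Phi> t = integral {a..t} (\<lambda>r. \<phi>' r *\<^sub>R w r)" for t
  have c: "continuous_on {a..} (\<lambda>r. \<phi>' r *\<^sub>R w r)" by (intro continuous_on_scaleR \<phi>' w)
  \<comment> \<open>The antiderivative is \<open>- (\<psi> r *\<^sub>R \<Phi> (\<eta> r))\<close>: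
    the chain rule gives the cube of \<open>\<psi>\<close> times \<open>\<phi>'\<close>, which
    \<open>\<psi>'_\<phi>\<close> trades for \<open>\<psi>' r * \<phi> (\<eta> r)\<close>.\<close>
  have "((\<lambda>r. \<psi>' r *\<^sub>R by_parts a \<phi> \<phi>' w (\<eta> r)) has_integral
      (- (\<psi> s *\<^sub>R \<Phi> (\<eta> s)) - - (\<psi> c *\<^sub>R \<Phi> (\<eta> c)))) {c..s}"
  proof (rule hilbert_FTC[OF s])
    fix r assume r: "r \<in> {c..s}"
    then have cr: "c \<le> r" by simp
    have "((\<lambda>r. \<psi> r *\<^sub>R \<Phi> (\<eta> r)) has_vector_derivative
        \<psi> r *\<^sub>R ((\<psi> r)\<^sup>2 *\<^sub>R (\<phi>' (\<eta> r) *\<^sub>R w (\<eta> r))) + \<psi>' r *\<^sub>R \<Phi> (\<eta> r)) (at r within {c..s})"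
      by (rule has_vector_derivative_scaleR[OF \<psi>[OF cr, THEN has_field_derivative_at_within]
            integral_o_\<eta>_derivative[OF c r, folded \<Phi>_def]])
    then have "((\<lambda>r. - (\<psi> r *\<^sub>R \<Phi> (\<eta> r))) has_vector_derivative
        - (\<psi> r *\<^sub>R ((\<psi> r)\<^sup>2 *\<^sub>R (\<phi>' (\<eta> r) *\<^sub>R w (\<eta> r))) + \<psi>' r *\<^sub>R \<Phi> (\<eta> r))) (at r within {c..s})"
      by (rule has_vector_derivative_minus)
    also have "- (\<psi> r *\<^sub>R ((\<psi> r)\<^sup>2 *\<^sub>R (\<phi>' (\<eta> r) *\<^sub>R w (\<eta> r))) + \<psi>' r *\<^sub>R \<Phi> (\<eta> r))
       = (- (\<psi> r ^ 3 * \<phi>' (\<eta> r))) *\<^sub>R w (\<eta> r) - \<psi>' r *\<^sub>R \<Phi> (\<eta> r)"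
      by (simp add: power2_eq_square power3_eq_cube mult.assoc)
    also have "\<dots> = \<psi>' r *\<^sub>R by_parts a \<phi> \<phi>' w (\<eta> r)"
      unfolding \<psi>'_\<phi>[OF cr, symmetric] by_parts_def \<Phi>_def[symmetric] by (simp add: scaleR_diff_right)
    finally show "((\<lambda>r. - (\<psi> r *\<^sub>R \<Phi> (\<eta> r))) has_vector_derivative \<psi>' r *\<^sub>R by_parts a \<phi> \<phi>' w (\<eta> r)) (at r within {c..s})" .
  qed
  from integral_unique[OF this] have "integral {c..s} (\<lambda>r. \<psi>' r *\<^sub>R by_parts a \<phi> \<phi>' w (\<eta> r)) = - (\<psi> s *\<^sub>R \<Phi> (\<eta> s))"
    by (simp add: \<eta>_start \<Phi>_def)
  then have "by_parts c \<psi> \<psi>' (\<lambda>r. by_parts a \<phi> \<phi>' w (\<eta> r)) s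
      = \<psi> s *\<^sub>R (\<phi> (\<eta> s) *\<^sub>R w (\<eta> s) - \<Phi> (\<eta> s)) + \<psi> s *\<^sub>R \<Phi> (\<eta> s)"
    by (subst by_parts_def) (simp add: by_parts_def \<Phi>_def)
  then show ?thesis using \<psi>_\<phi>[OF s] by (simp add: scaleR_diff_right)
qed

lemma \<psi>_measurable: "\<psi> \<in> borel_measurable (restrict_space borel {c..})"
  by (rule borel_measurable_continuous_on_restrict[OF \<psi>_continuous])

lemma integrand_o_\<eta>: "integrand \<sigma> \<Longrightarrow> B.integrand (\<lambda>s. \<sigma> (\<eta> s))"
proof -
  assume "integrand \<sigma>"
  moreover have "\<eta> \<in> measurable (restrict_space borel {c..}) (restrict_space borel {a..})"
    by (rule measurable_restrict_space2[OF _ borel_measurable_continuous_on_restrict[OF \<eta>_continuous]])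
      (auto simp: space_restrict_space \<eta>_ge)
  ultimately show ?thesis unfolding integrand_def B.integrand_def by (rule measurable_compose[rotated])
qed

lemma has_stoch_integral_changed_const:
  assumes s: "c \<le> s"
  shows "has_stoch_integral M C (\<lambda>s. J (\<eta> s)) (\<lambda>r. \<psi> r *\<^sub>R A) c s (\<lambda>\<omega>. blinfun_apply A (W (\<eta> s) \<omega>))"
proof -
  \<comment> \<open>At each fixed time this is almost surely \<open>A\<close> applied to
    \<open>J (\<eta> r)\<close>; as an explicit functional of the path of \<open>W\<close> it has
    the form that \<open>by_parts_inverse\<close> undoes.\<close>
  define G where "G r \<omega> = by_parts a \<phi> \<phi>' (\<lambda>u. blinfun_apply A (W u \<omega>)) (\<eta> r)" for r \<omega>
  have mA: "B.integrand (\<lambda>r. A)" unfolding B.integrand_def by simp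
  have cW: "AE \<omega> in M. continuous_on {a..} (\<lambda>u. blinfun_apply A (W u \<omega>))"
    using W_continuous by eventually_elim (intro bounded_linear.continuous_on[OF blinfun.bounded_linear_right])
  have "\<exists>R. has_stoch_integral M C (\<lambda>s. J (\<eta> s)) (\<lambda>r. \<psi> r *\<^sub>R A) c s R \<and>
    (AE \<omega> in M. R \<omega> = \<psi> s *\<^sub>R G s \<omega> - integral {c..s} (\<lambda>r. \<psi>' r *\<^sub>R G r \<omega>))"
  proof (rule B.has_stoch_integral_scale_smooth[OF _ mA s, where I = "\<lambda>u. sint [(A, c, u)] (\<lambda>s. J (\<eta> s))"])
    show "has_stoch_integral M C (\<lambda>s. J (\<eta> s)) (\<lambda>r. A) c u (sint [(A, c, u)] (\<lambda>s. J (\<eta> s)))" if u: "c \<le> u" for u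
    proof -
      have st: "steps_in c u [(A, c, u)]" using u by simp
      have "cov_L2 C c u (\<lambda>r. A - sfun [(A, c, u)] r) = cov_L2 C c u (\<lambda>r. 0)"
        unfolding cov_L2_def
        by (intro nn_integral_cong_AE eventually_mono[OF AE_lborel_singleton[of c]])
          (auto split: split_indicator)
      then have "cov_L2 C c u (\<lambda>r. A - sfun [(A, c, u)] r) = 0" by (simp add: cov_L2_def)
      then show ?thesis
        unfolding B.has_stoch_integral_iff[OF order_refl u]
        using st B.sint_measurable[OF st order_refl u]
        by (intro conjI allI impI exI[of _ "[(A, c, u)]"]) (simp_all add: mean_square_def)
    qed
    show "AE \<omega> in M. continuous_on {c..s} (\<lambda>u. G u \<omega>)"
      using cW
    proof eventually_elim
      case (elim \<omega>)
      have "continuous_on {c..} (\<lambda>u. G u \<omega>)"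
        unfolding G_def by (intro continuous_on_o_\<eta> continuous_on_by_parts \<phi>_continuous \<phi>' elim)
      then show ?case by (rule continuous_on_subset) auto
    qed
    show "AE \<omega> in M. G u \<omega> = sint [(A, c, u)] (\<lambda>s. J (\<eta> s)) \<omega>" if u: "c \<le> u" for u
      using has_stoch_integral_smooth_AE[OF \<eta>_ge[OF u] J_integral[OF \<eta>_ge[OF u]]] B.W_start W_continuous
    proof eventually_elim
      case (elim \<omega>)
      then show ?case
        unfolding G_def using blinfun_by_parts[OF \<phi>' elim(3), of A \<phi> "\<eta> u"] by simp
    qed
    show "(\<psi> has_real_derivative \<psi>' x) (at x within {c..s})" if "x \<in> {c..s}" for x
      using that by (intro \<psi>[THEN has_field_derivative_at_within]) auto
    show "continuous_on {c..s} \<psi>'" by (rule continuous_on_subset[OF \<psi>']) auto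
    show "\<psi> \<in> borel_measurable (restrict_space borel {c..})" by (rule \<psi>_measurable)
  qed
  then obtain R where R: "has_stoch_integral M C (\<lambda>s. J (\<eta> s)) (\<lambda>r. \<psi> r *\<^sub>R A) c s R"
    "AE \<omega> in M. R \<omega> = by_parts c \<psi> \<psi>' (\<lambda>r. G r \<omega>) s" unfolding by_parts_def by blast
  have 1: "AE \<omega> in M. R \<omega> = blinfun_apply A (W (\<eta> s) \<omega>)"
    using R(2) cW by eventually_elim (simp add: G_def by_parts_inverse s)
  show ?thesis
    by (rule B.has_stoch_integral_cong[OF R(1) order_refl s refl _ 1])
      (intro borel_measurable_blinfun_apply W_measurable \<eta>_ge s)
qed

text \<open>By linearity a constant operator on one interval suffices, and the increasing clock
  \<open>\<rho>\<close> carries \<open>(u, v]\<close> to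
  \<open>(\<rho> u, \<rho> v]\<close>.\<close>

lemma has_stoch_integral_changed_sfun:
  assumes b: "a \<le> b" and xs: "steps_in a b xs"
  shows "has_stoch_integral M C (\<lambda>s. J (\<eta> s)) (\<lambda>s. \<psi> s *\<^sub>R sfun xs (\<eta> s)) c (\<rho> b) (sint xs W)"
  using xs
proof (induction xs)
  case Nil
  have eq: "sfun [] = (\<lambda>r. 0)" "sint [] (\<lambda>s. J (\<eta> s)) = (\<lambda>\<omega>. 0)" "sint [] W = (\<lambda>\<omega>. 0)" by (rule ext, simp)+
  from B.has_stoch_integral_sfun[OF _ order_refl \<rho>_ge[OF b], of "[]", unfolded eq] show ?case
    unfolding eq by simp
next
  case (Cons x xs)
  obtain A u v where x: "x = (A, u, v)" by (cases x) auto
  have uv: "a \<le> u" "u \<le> v" "v \<le> b" and xs: "steps_in a b xs" using Cons.prems by (auto simp: x)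
  have m1: "B.integrand (\<lambda>r. \<psi> r *\<^sub>R A)" by (rule B.integrand_scaleR[OF \<psi>_measurable]) (simp add: B.integrand_def)
  have m2: "B.integrand (\<lambda>s. \<psi> s *\<^sub>R sfun xs (\<eta> s))"
    by (rule B.integrand_scaleR[OF \<psi>_measurable integrand_o_\<eta>]) simp
  have ord: "c \<le> \<rho> u" "\<rho> u \<le> \<rho> v" "\<rho> v \<le> \<rho> b" using uv \<rho>_ge \<rho>_mono by auto
  have "has_stoch_integral M C (\<lambda>s. J (\<eta> s)) (\<lambda>r. indicator {\<rho> u<..\<rho> v} r *\<^sub>R (\<psi> r *\<^sub>R A)) c (\<rho> b)
      (\<lambda>\<omega>. blinfun_apply A (W (\<eta> (\<rho> v)) \<omega>) - blinfun_apply A (W (\<eta> (\<rho> u)) \<omega>))"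
    by (rule B.has_stoch_integral_interval[OF has_stoch_integral_changed_const has_stoch_integral_changed_const])
      (use ord m1 in auto)
  then have "has_stoch_integral M C (\<lambda>s. J (\<eta> s)) (\<lambda>r. indicator {\<rho> u<..\<rho> v} r *\<^sub>R (\<psi> r *\<^sub>R A) + \<psi> r *\<^sub>R sfun xs (\<eta> r)) c (\<rho> b)
      (\<lambda>\<omega>. blinfun_apply A (W v \<omega>) - blinfun_apply A (W u \<omega>) + sint xs W \<omega>)"
    using uv by (intro B.has_stoch_integral_add Cons.IH xs B.integrand_indicator m1 m2 \<rho>_ge b) auto
  then show ?case
  proof (rule B.has_stoch_integral_cong)
    fix r assume r: "c \<le> r" "r \<le> \<rho> b"
    have 1: "\<rho> u < r \<longleftrightarrow> u < \<eta> r"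
      using \<eta>_mono[of r "\<rho> u"] \<rho>_mono[of "\<eta> r" u] r uv ord \<eta>_ge[of r] by (auto simp: not_le[symmetric])
    have 2: "r \<le> \<rho> v \<longleftrightarrow> \<eta> r \<le> v"
      using \<eta>_mono[of r "\<rho> v"] \<rho>_mono[of "\<eta> r" v] r uv ord \<eta>_ge[of r] by auto
    show "indicator {\<rho> u<..\<rho> v} r *\<^sub>R (\<psi> r *\<^sub>R A) + \<psi> r *\<^sub>R sfun xs (\<eta> r) = \<psi> r *\<^sub>R sfun (x # xs) (\<eta> r)"
      using 1 2 by (auto simp: x scaleR_add_right split: split_indicator)
  next
    show "sint (x # xs) W \<in> borel_measurable M" by (rule sint_measurable[OF Cons.prems order_refl b])
  qed (use b \<rho>_ge in \<open>auto simp: x blinfun.bilinear_simps\<close>)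
qed

text \<open>The factor \<open>\<psi> s\<close> enters squared, and its square is the derivative of
  \<open>\<eta>\<close>, so this is the substitution rule for the time change.\<close>

lemma cov_L2_substitution:
  assumes b: "a \<le> b" and m: "integrand \<sigma>"
  shows "cov_L2 C c (\<rho> b) (\<lambda>s. \<psi> s *\<^sub>R \<sigma> (\<eta> s)) \<le> cov_L2 C a b \<sigma>"
proof (cases "c = \<rho> b")
  case True
  have "cov_L2 C c (\<rho> b) (\<lambda>s. \<psi> s *\<^sub>R \<sigma> (\<eta> s)) = 0"
    unfolding cov_L2_def True using nn_integral_null_set[of "{\<rho> b}" lborel] by (auto simp: null_sets_def)
  then show ?thesis by simp
next
  case False
  then have c: "c < \<rho> b" using \<rho>_ge[OF b] by simp
  define f where "f r = cov_norm2 C (\<sigma> r) * indicator {a..b} r" for r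
  have fm: "f \<in> borel_measurable borel" unfolding f_def[abs_def] by (rule integrand_cov_measurable[OF m order_refl])
  have "cov_L2 C a b \<sigma> = (\<integral>\<^sup>+ r. f r * indicator {\<eta> c..\<eta> (\<rho> b)} r \<partial>lborel)"
    unfolding cov_L2_def f_def using b
    by (intro nn_integral_cong) (auto simp: \<eta>_start split: split_indicator)
  also have "\<dots> = (\<integral>\<^sup>+ s. f (\<eta> s) * ennreal ((\<psi> s)\<^sup>2) * indicator {c..\<rho> b} s \<partial>lborel)"
  proof (rule nn_integral_substitution_aux[OF fm])
    show "continuous_on {c..\<rho> b} (\<lambda>s. (\<psi> s)\<^sup>2)"
      by (intro continuous_on_power continuous_on_subset[OF \<psi>_continuous]) auto
  qed (use \<eta> c in auto)
  also have "\<dots> = cov_L2 C c (\<rho> b) (\<lambda>s. \<psi> s *\<^sub>R \<sigma> (\<eta> s))"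
    unfolding cov_L2_def cov_norm2_scaleR f_def
  proof (rule nn_integral_cong)
    fix s
    have "\<eta> s \<in> {a..b}" if "s \<in> {c..\<rho> b}" using that \<eta>_ge[of s] \<eta>_mono[of s "\<rho> b"] b by auto
    then show "cov_norm2 C (\<sigma> (\<eta> s)) * indicator {a..b} (\<eta> s) * ennreal ((\<psi> s)\<^sup>2) * indicator {c..\<rho> b} s
      = ennreal ((\<psi> s)\<^sup>2) * cov_norm2 C (\<sigma> (\<eta> s)) * indicator {c..\<rho> b} s"
      by (auto simp: mult_ac split: split_indicator)
  qed
  finally show ?thesis by simp
qed

text \<open>The same step list serves both sides: its integral against \<open>W\<close> is also the
  integral of the transformed step function against the changed Brownian motion, and substitution
  does not increase the integrand error. Hence the very same random variable \<open>I\<close>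
  results.\<close>

lemma has_stoch_integral_changed:
  assumes I: "has_stoch_integral M C W \<sigma> a b I" and b: "a \<le> b" and m: "integrand \<sigma>"
  shows "has_stoch_integral M C (\<lambda>s. J (\<eta> s)) (\<lambda>s. \<psi> s *\<^sub>R \<sigma> (\<eta> s)) c (\<rho> b) I"
proof (rule B.has_stoch_integral_closure[OF order_refl \<rho>_ge[OF b] has_stoch_integral_measurable[OF I]])
  fix e :: real assume e: "0 < e"
  obtain xs where xs: "steps_in a b xs" "cov_L2 C a b (\<lambda>r. \<sigma> r - sfun xs r) \<le> ennreal e"
    "mean_square M (\<lambda>\<omega>. I \<omega> - sint xs W \<omega>) \<le> ennreal e"
    by (rule has_stoch_integral_approx[OF I order_refl b e])
  have eq: "(\<lambda>s. \<psi> s *\<^sub>R \<sigma> (\<eta> s) - \<psi> s *\<^sub>R sfun xs (\<eta> s)) = (\<lambda>s. \<psi> s *\<^sub>R (\<sigma> (\<eta> s) - sfun xs (\<eta> s)))"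
    by (simp add: scaleR_diff_right)
  have "cov_L2 C c (\<rho> b) (\<lambda>s. \<psi> s *\<^sub>R (\<sigma> (\<eta> s) - sfun xs (\<eta> s))) \<le> ennreal e"
    using cov_L2_substitution[OF b integrand_diff_sfun[OF m]] xs(2) by (rule order_trans)
  then show "\<exists>\<sigma>' I'. has_stoch_integral M C (\<lambda>s. J (\<eta> s)) \<sigma>' c (\<rho> b) I' \<and> B.integrand \<sigma>' \<and>
      B.integrand (\<lambda>r. \<psi> r *\<^sub>R \<sigma> (\<eta> r) - \<sigma>' r) \<and>
      cov_L2 C c (\<rho> b) (\<lambda>r. \<psi> r *\<^sub>R \<sigma> (\<eta> r) - \<sigma>' r) \<le> ennreal e \<and> mean_square M (\<lambda>\<omega>. I \<omega> - I' \<omega>) \<le> ennreal e"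
    using has_stoch_integral_changed_sfun[OF b xs(1)] xs(3)
      B.integrand_scaleR[OF \<psi>_measurable integrand_o_\<eta>[OF integrand_sfun, of xs]]
      B.integrand_scaleR[OF \<psi>_measurable integrand_o_\<eta>[OF integrand_diff_sfun[OF m, of xs]]]
    unfolding eq[symmetric] by blast
qed

text \<open>The hypotheses are the product rule for \<open>\<psi>\<^sup>2\<close> times
  \<open>X\<close> along \<open>\<eta>\<close>: the drift is \<open>2 * \<psi> * \<psi>'\<close>
  times \<open>X\<close> plus \<open>\<psi>\<^sup>2\<close> times the old drift run at speed
  \<open>\<psi>\<^sup>2\<close>, and the noise coefficient is
  \<open>\<psi>\<^sup>2 * \<psi>\<close>. The new \<open>H\<close> is rescaled like
  \<open>X\<close>. \<open>\<zeta>\<close> allows the explicit form of the factor to be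
  inserted.\<close>

lemma trajectory_solution_changed:
  assumes sol: "trajectory_solution M F a C W \<sigma> V d Y0 X0 Y X"
    and V: "continuous_on UNIV V"
    and d: "\<And>x h v. continuous_on {a..} x \<Longrightarrow> continuous_on {a..} h \<Longrightarrow> continuous_on {a..} v \<Longrightarrow>
        continuous_on {a..} (\<lambda>r. d r (x r) (h r) (v r))"
    and d': "\<And>s x h v. c \<le> s \<Longrightarrow> d' s ((\<psi> s)\<^sup>2 *\<^sub>R x) ((\<psi> s)\<^sup>2 *\<^sub>R h) v =
        (2 * \<psi> s * \<psi>' s) *\<^sub>R x + (\<psi> s ^ 4) *\<^sub>R d (\<eta> s) x h v"
    and \<sigma>': "\<And>s. c \<le> s \<Longrightarrow> \<sigma>' s = (\<psi> s ^ 3) *\<^sub>R \<sigma> (\<eta> s)"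
    and \<zeta>: "\<And>s. c \<le> s \<Longrightarrow> \<zeta> s = (\<psi> s)\<^sup>2"
  shows "trajectory_solution M (\<lambda>s. F (\<eta> s)) c C (\<lambda>s. J (\<eta> s)) \<sigma>' V d' Y0 (\<zeta> c *\<^sub>R X0)
    (\<lambda>s. Y (\<eta> s)) (\<lambda>s \<omega>. \<zeta> s *\<^sub>R X (\<eta> s) \<omega>)"
proof -
  obtain H where H: "adapted F a H" "continuous_process M a H"
    and Yeq: "\<And>t. a \<le> t \<Longrightarrow> AE \<omega> in M. Y t \<omega> = Y0 + integral {a..t} (\<lambda>r. X r \<omega>)"
    and Veq: "\<And>t. a \<le> t \<Longrightarrow> AE \<omega> in M. V (Y t \<omega>) = V Y0 + integral {a..t} (\<lambda>r. H r \<omega>)"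
    and Xeq: "\<And>t. a \<le> t \<Longrightarrow> \<exists>I. has_stoch_integral M C W \<sigma> a t I \<and>
       (AE \<omega> in M. X t \<omega> = X0 + integral {a..t} (\<lambda>r. d r (X r \<omega>) (H r \<omega>) (V (Y r \<omega>))) + I \<omega>)"
    using sol unfolding trajectory_solution_def by blast
  have ad: "adapted F a X" "adapted F a Y" "adapted F a (\<lambda>t \<omega>. V (Y t \<omega>))"
    and m: "integrand \<sigma>" and contYX: "continuous_process M a (\<lambda>t \<omega>. (Y t \<omega>, X t \<omega>))"
    using sol unfolding trajectory_solution_def integrand_def by blast+
  have cont: "AE \<omega> in M. continuous_on {a..} (\<lambda>t. Y t \<omega>) \<and> continuous_on {a..} (\<lambda>t. X t \<omega>) \<and> continuous_on {a..} (\<lambda>t. H t \<omega>)"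
    using contYX H(2) unfolding continuous_process_def
  proof eventually_elim
    case (elim \<omega>)
    then show ?case using continuous_on_fst[OF elim(1)] continuous_on_snd[OF elim(1)] by simp
  qed
  have \<psi>2c: "continuous_on {c..} (\<lambda>s. (\<psi> s)\<^sup>2)" by (intro continuous_on_power \<psi>_continuous)
  then have \<zeta>c: "continuous_on {c..} \<zeta>"
    by (rule iffD2[OF continuous_on_cong[OF refl], rotated]) (simp add: \<zeta>)
  define b where "b \<omega> r = d r (X r \<omega>) (H r \<omega>) (V (Y r \<omega>))" for \<omega> r
  \<comment> \<open>The stochastic integral with continuous paths, solved from the equation for
    \<open>X\<close>; the solution itself provides only a separate version for each time.\<close>
  define N where "N t \<omega> = X t \<omega> - X0 - integral {a..t} (b \<omega>)" for t \<omega>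
  have bc: "AE \<omega> in M. continuous_on {a..} (b \<omega>)"
    using cont
  proof eventually_elim
    case (elim \<omega>)
    then show ?case unfolding b_def[abs_def]
      by (intro d continuous_on_compose2[OF V]) auto
  qed
  have Nc: "AE \<omega> in M. continuous_on {a..} (\<lambda>t. N t \<omega>)"
    using cont bc
  proof eventually_elim
    case (elim \<omega>)
    then show ?case unfolding N_def
      by (intro continuous_on_diff continuous_on_const continuous_on_integral_halfline) auto
  qed
  have "\<forall>t. \<exists>I. a \<le> t \<longrightarrow> has_stoch_integral M C W \<sigma> a t I \<and>
      (AE \<omega> in M. X t \<omega> = X0 + integral {a..t} (b \<omega>) + I \<omega>)"
    using Xeq unfolding b_def[abs_def] by blast
  from choice[OF this] obtain I where I: "\<And>t. a \<le> t \<Longrightarrow> has_stoch_integral M C W \<sigma> a t (I t)"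
    "\<And>t. a \<le> t \<Longrightarrow> AE \<omega> in M. X t \<omega> = X0 + integral {a..t} (b \<omega>) + I t \<omega>"
    by blast
  have NI: "AE \<omega> in M. N t \<omega> = I t \<omega>" if "a \<le> t" for t
    using I(2)[OF that] by eventually_elim (simp add: N_def)
  have d2r: "((\<lambda>s. (\<psi> s)\<^sup>2) has_real_derivative 2 * \<psi> s * \<psi>' s) (at s within S)" if "c \<le> s" for s S
    using \<psi>[OF that, THEN has_field_derivative_at_within] by (auto intro!: derivative_eq_intros)
  have c2: "continuous_on {c..} (\<lambda>s. 2 * \<psi> s * \<psi>' s)"
    by (intro continuous_intros \<psi>_continuous \<psi>')
  have Xeq': "\<exists>R. has_stoch_integral M C (\<lambda>s. J (\<eta> s)) \<sigma>' c s R \<and>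
     (AE \<omega> in M. \<zeta> s *\<^sub>R X (\<eta> s) \<omega> = \<zeta> c *\<^sub>R X0 +
        integral {c..s} (\<lambda>r. d' r (\<zeta> r *\<^sub>R X (\<eta> r) \<omega>) (\<zeta> r *\<^sub>R H (\<eta> r) \<omega>) (V (Y (\<eta> r) \<omega>))) + R \<omega>)"
    if s: "c \<le> s" for s
  proof -
    \<comment> \<open>Smooth multiplication is applied to
      \<open>\<psi> r *\<^sub>R \<sigma> (\<eta> r)\<close>, whose integral up to \<open>u\<close>
      is \<open>I (\<eta> u)\<close>. The multiplier \<open>(\<psi> r)\<^sup>2\<close> is the
      rescaling of \<open>X\<close>.\<close>
    have "\<exists>R. has_stoch_integral M C (\<lambda>s. J (\<eta> s)) (\<lambda>r. (\<psi> r)\<^sup>2 *\<^sub>R (\<psi> r *\<^sub>R \<sigma> (\<eta> r))) c s R \<and>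
      (AE \<omega> in M. R \<omega> = (\<psi> s)\<^sup>2 *\<^sub>R N (\<eta> s) \<omega> - integral {c..s} (\<lambda>r. (2 * \<psi> r * \<psi>' r) *\<^sub>R N (\<eta> r) \<omega>))"
    proof (rule B.has_stoch_integral_scale_smooth[OF _ _ s, where I = "\<lambda>u. I (\<eta> u)"])
      show "has_stoch_integral M C (\<lambda>s. J (\<eta> s)) (\<lambda>r. \<psi> r *\<^sub>R \<sigma> (\<eta> r)) c u (I (\<eta> u))" if "c \<le> u" for u
        using has_stoch_integral_changed[OF I(1)[OF \<eta>_ge[OF that]] \<eta>_ge[OF that] m] that by simp
      show "B.integrand (\<lambda>r. \<psi> r *\<^sub>R \<sigma> (\<eta> r))" by (rule B.integrand_scaleR[OF \<psi>_measurable integrand_o_\<eta>[OF m]])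
      show "AE \<omega> in M. continuous_on {c..s} (\<lambda>u. N (\<eta> u) \<omega>)"
        using Nc by eventually_elim (rule continuous_on_subset[OF continuous_on_o_\<eta>], auto)
      show "AE \<omega> in M. N (\<eta> u) \<omega> = I (\<eta> u) \<omega>" if "c \<le> u" for u by (rule NI[OF \<eta>_ge[OF that]])
      show "((\<lambda>r. (\<psi> r)\<^sup>2) has_real_derivative 2 * \<psi> x * \<psi>' x) (at x within {c..s})" if "x \<in> {c..s}" for x
        using that by (intro d2r) auto
      show "continuous_on {c..s} (\<lambda>s. 2 * \<psi> s * \<psi>' s)" by (rule continuous_on_subset[OF c2]) auto
      show "(\<lambda>r. (\<psi> r)\<^sup>2) \<in> borel_measurable (restrict_space borel {c..})"
        by (rule borel_measurable_continuous_on_restrict[OF \<psi>2c])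
    qed
    then obtain R where R: "has_stoch_integral M C (\<lambda>s. J (\<eta> s)) (\<lambda>r. (\<psi> r)\<^sup>2 *\<^sub>R (\<psi> r *\<^sub>R \<sigma> (\<eta> r))) c s R"
      "AE \<omega> in M. R \<omega> = (\<psi> s)\<^sup>2 *\<^sub>R N (\<eta> s) \<omega> - integral {c..s} (\<lambda>r. (2 * \<psi> r * \<psi>' r) *\<^sub>R N (\<eta> r) \<omega>)"
      by blast
    have R': "has_stoch_integral M C (\<lambda>s. J (\<eta> s)) \<sigma>' c s R"
      by (rule B.has_stoch_integral_cong[OF R(1) order_refl s _ B.has_stoch_integral_measurable[OF R(1)]])
        (auto simp: \<sigma>' power2_eq_square power3_eq_cube mult.assoc)
    have "AE \<omega> in M. \<zeta> s *\<^sub>R X (\<eta> s) \<omega> = \<zeta> c *\<^sub>R X0 +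
        integral {c..s} (\<lambda>r. d' r (\<zeta> r *\<^sub>R X (\<eta> r) \<omega>) (\<zeta> r *\<^sub>R H (\<eta> r) \<omega>) (V (Y (\<eta> r) \<omega>))) + R \<omega>"
      using R(2) bc Nc
    proof eventually_elim
      case (elim \<omega>)
      \<comment> \<open>Splits \<open>X\<close> into a differentiable part \<open>L\<close> and the
        noise \<open>N\<close>. The by-parts correction for \<open>N\<close> joins the derivative of
        \<open>\<psi>\<^sup>2\<close> acting on \<open>L\<close>, so that the new drift contains
        them only through their sum \<open>X\<close>.\<close>
      define L where "L t = X0 + integral {a..t} (b \<omega>)" for t
      have XL: "X t \<omega> = L t + N t \<omega>" for t by (simp add: L_def N_def)
      have "((\<lambda>r. (\<psi> r)\<^sup>2 *\<^sub>R ((\<psi> r)\<^sup>2 *\<^sub>R b \<omega> (\<eta> r)) + (2 * \<psi> r * \<psi>' r) *\<^sub>R L (\<eta> r)) has_integral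
          ((\<psi> s)\<^sup>2 *\<^sub>R L (\<eta> s) - (\<psi> c)\<^sup>2 *\<^sub>R L (\<eta> c))) {c..s}"
      proof (rule hilbert_FTC[OF s])
        fix r assume r: "r \<in> {c..s}"
        have "((\<lambda>r. L (\<eta> r)) has_vector_derivative (\<psi> r)\<^sup>2 *\<^sub>R b \<omega> (\<eta> r)) (at r within {c..s})"
          unfolding L_def using has_vector_derivative_add[OF has_vector_derivative_const integral_o_\<eta>_derivative[OF elim(2) r]]
          by simp
        then show "((\<lambda>r. (\<psi> r)\<^sup>2 *\<^sub>R L (\<eta> r)) has_vector_derivative
            (\<psi> r)\<^sup>2 *\<^sub>R ((\<psi> r)\<^sup>2 *\<^sub>R b \<omega> (\<eta> r)) + (2 * \<psi> r * \<psi>' r) *\<^sub>R L (\<eta> r)) (at r within {c..s})"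
          using r by (intro has_vector_derivative_scaleR d2r) auto
      qed
      moreover have "((\<lambda>r. (2 * \<psi> r * \<psi>' r) *\<^sub>R N (\<eta> r) \<omega>) has_integral
          integral {c..s} (\<lambda>r. (2 * \<psi> r * \<psi>' r) *\<^sub>R N (\<eta> r) \<omega>)) {c..s}"
        by (intro hilbert_has_integral continuous_on_scaleR continuous_on_subset[OF c2]
            continuous_on_subset[OF continuous_on_o_\<eta>[OF elim(3)]]) auto
      ultimately have "((\<lambda>r. (\<psi> r)\<^sup>2 *\<^sub>R ((\<psi> r)\<^sup>2 *\<^sub>R b \<omega> (\<eta> r)) + (2 * \<psi> r * \<psi>' r) *\<^sub>R L (\<eta> r)
            + (2 * \<psi> r * \<psi>' r) *\<^sub>R N (\<eta> r) \<omega>) has_integral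
          ((\<psi> s)\<^sup>2 *\<^sub>R L (\<eta> s) - (\<psi> c)\<^sup>2 *\<^sub>R L (\<eta> c)) + integral {c..s} (\<lambda>r. (2 * \<psi> r * \<psi>' r) *\<^sub>R N (\<eta> r) \<omega>)) {c..s}"
        by (rule has_integral_add)
      then have "((\<lambda>r. d' r (\<zeta> r *\<^sub>R X (\<eta> r) \<omega>) (\<zeta> r *\<^sub>R H (\<eta> r) \<omega>) (V (Y (\<eta> r) \<omega>))) has_integral
          ((\<psi> s)\<^sup>2 *\<^sub>R L (\<eta> s) - (\<psi> c)\<^sup>2 *\<^sub>R L (\<eta> c)) + integral {c..s} (\<lambda>r. (2 * \<psi> r * \<psi>' r) *\<^sub>R N (\<eta> r) \<omega>)) {c..s}"
      proof (rule has_integral_eq[rotated])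
        fix r assume r: "r \<in> {c..s}"
        then have cr: "c \<le> r" by simp
        show "(\<psi> r)\<^sup>2 *\<^sub>R ((\<psi> r)\<^sup>2 *\<^sub>R b \<omega> (\<eta> r)) + (2 * \<psi> r * \<psi>' r) *\<^sub>R L (\<eta> r)
            + (2 * \<psi> r * \<psi>' r) *\<^sub>R N (\<eta> r) \<omega>
          = d' r (\<zeta> r *\<^sub>R X (\<eta> r) \<omega>) (\<zeta> r *\<^sub>R H (\<eta> r) \<omega>) (V (Y (\<eta> r) \<omega>))"
          unfolding \<zeta>[OF cr] d'[OF cr] b_def XL
          by (simp add: scaleR_add_right power2_eq_square power4_eq_xxxx mult.assoc)
      qed
      from integral_unique[OF this] show ?case
        using elim(1) \<zeta>[OF s] \<zeta>[OF order_refl] unfolding XL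
        by (simp add: L_def \<eta>_start scaleR_add_right)
    qed
    then show ?thesis using R' by blast
  qed
  have sub: "integral {a..\<eta> s} f = integral {c..s} (\<lambda>r. \<zeta> r *\<^sub>R f (\<eta> r))"
    if "c \<le> s" "continuous_on {a..} f" for s and f :: "real \<Rightarrow> 'h"
    unfolding integral_substitution[OF that(2,1)] by (rule integral_cong) (simp add: \<zeta>)
  have Yeq': "AE \<omega> in M. Y (\<eta> s) \<omega> = Y0 + integral {c..s} (\<lambda>r. \<zeta> r *\<^sub>R X (\<eta> r) \<omega>)" if "c \<le> s" for s
    using Yeq[OF \<eta>_ge[OF that]] cont by eventually_elim (simp add: sub that)
  have Veq': "AE \<omega> in M. V (Y (\<eta> s) \<omega>) = V Y0 + integral {c..s} (\<lambda>r. \<zeta> r *\<^sub>R H (\<eta> r) \<omega>)" if "c \<le> s" for s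
    using Veq[OF \<eta>_ge[OF that]] cont by eventually_elim (simp add: sub that)
  have ad': "adapted (\<lambda>s. F (\<eta> s)) c (\<lambda>s. G (\<eta> s))" if "adapted F a G" for G :: "real \<Rightarrow> 'w \<Rightarrow> 'h"
    using that \<eta>_ge unfolding adapted_def by blast
  have ad'': "adapted (\<lambda>s. F (\<eta> s)) c (\<lambda>s \<omega>. \<zeta> s *\<^sub>R G (\<eta> s) \<omega>)" if "adapted F a G" for G :: "real \<Rightarrow> 'w \<Rightarrow> 'h"
    using that \<eta>_ge unfolding adapted_def by (auto intro!: borel_measurable_scaleR)
  have m2: "\<sigma>' \<in> borel_measurable (restrict_space borel {c..})"
  proof -
    have "(\<lambda>s. \<psi> s ^ 3) \<in> borel_measurable (restrict_space borel {c..})"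
      by (intro borel_measurable_continuous_on_restrict continuous_on_power \<psi>_continuous)
    from B.integrand_scaleR[OF this integrand_o_\<eta>[OF m]] show ?thesis
      unfolding B.integrand_def by (rule iffD2[OF measurable_cong, rotated]) (simp add: \<sigma>' space_restrict_space)
  qed
  show ?thesis
    unfolding trajectory_solution_def
  proof (intro conjI exI[of _ "\<lambda>s \<omega>. \<zeta> s *\<^sub>R H (\<eta> s) \<omega>"] allI impI)
    show "prob_space M" by (rule prob_space_axioms)
    show "filtration_on M (\<lambda>s. F (\<eta> s)) c" by (rule B.filt)
    show "brownian_motion M (\<lambda>s. F (\<eta> s)) c C (\<lambda>s. J (\<eta> s))" by (rule B.bm)
    show "continuous_process M c (\<lambda>t \<omega>. (Y (\<eta> t) \<omega>, \<zeta> t *\<^sub>R X (\<eta> t) \<omega>))"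
      unfolding continuous_process_def using cont
      by eventually_elim (intro continuous_on_Pair continuous_on_scaleR \<zeta>c continuous_on_o_\<eta>, auto)
    show "continuous_process M c (\<lambda>s \<omega>. \<zeta> s *\<^sub>R H (\<eta> s) \<omega>)"
      unfolding continuous_process_def using cont
      by eventually_elim (intro continuous_on_scaleR \<zeta>c continuous_on_o_\<eta>, auto)
  qed (use ad H m2 Yeq' Veq' Xeq' ad'[of Y] ad'[of "\<lambda>t \<omega>. V (Y t \<omega>)"] ad''[of X] ad''[of H] in auto)
qed

end

lemma (in time_change) trajectory_solution_time_change:
  fixes V :: "'h::{real_inner, polish_space} \<Rightarrow> 'h"
  assumes sol: "trajectory_solution M F a C W \<sigma> V d Y0 X0 Y X"
    and V: "continuous_on UNIV V"
    and d: "\<And>x h v. continuous_on {a..} x \<Longrightarrow> continuous_on {a..} h \<Longrightarrow> continuous_on {a..} v \<Longrightarrow>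
        continuous_on {a..} (\<lambda>r. d r (x r) (h r) (v r))"
    and d': "\<And>s x h v. c \<le> s \<Longrightarrow> d' s ((\<psi> s)\<^sup>2 *\<^sub>R x) ((\<psi> s)\<^sup>2 *\<^sub>R h) v =
        (2 * \<psi> s * \<psi>' s) *\<^sub>R x + (\<psi> s ^ 4) *\<^sub>R d (\<eta> s) x h v"
    and \<sigma>': "\<And>s. c \<le> s \<Longrightarrow> \<sigma>' s = (\<psi> s ^ 3) *\<^sub>R \<sigma> (\<eta> s)"
    and \<zeta>: "\<And>s. c \<le> s \<Longrightarrow> \<zeta> s = (\<psi> s)\<^sup>2"
  shows "(\<exists>J. driving_integral M F a C W \<rho> J) \<and>
    (\<forall>J. driving_integral M F a C W \<rho> J \<longrightarrow>
      trajectory_solution M (\<lambda>s. F (\<eta> s)) c C (\<lambda>s. J (\<eta> s)) \<sigma>' V d' Y0 (\<zeta> c *\<^sub>R X0)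
        (\<lambda>s. Y (\<eta> s)) (\<lambda>s \<omega>. \<zeta> s *\<^sub>R X (\<eta> s) \<omega>))"
proof -
  have sol': "prob_space M" "filtration_on M F a" "brownian_motion M F a C W"
    using sol unfolding trajectory_solution_def by blast+
  then interpret brownian M F a C W
    by (intro brownian.intro brownian_axioms.intro)
  interpret smooth_brownian M F a C W \<phi> \<phi>' \<rho> ..
  show ?thesis
  proof (intro conjI allI impI)
    show "\<exists>J. driving_integral M F a C W \<rho> J"
      unfolding driving_integral_iff by (rule smooth_integral_process_exists)
  next
    fix J assume "driving_integral M F a C W \<rho> J"
    then interpret changed_brownian M F a C W \<phi> \<phi>' \<rho> c \<psi> \<psi>' \<eta> J
      unfolding driving_integral_iff by unfold_locales
    show "trajectory_solution M (\<lambda>s. F (\<eta> s)) c C (\<lambda>s. J (\<eta> s)) \<sigma>' V d' Y0 (\<zeta> c *\<^sub>R X0)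
        (\<lambda>s. Y (\<eta> s)) (\<lambda>s \<omega>. \<zeta> s *\<^sub>R X (\<eta> s) \<omega>)"
      by (rule trajectory_solution_changed[OF sol V d d' \<sigma>' \<zeta>])
  qed
qed

section \<open>The logarithmic time change\<close>

text \<open>The square roots of the derivatives of \<^const>\<open>tau\<close> and \<^const>\<open>kappa\<close>.\<close>

definition tau_rate :: "real \<Rightarrow> real \<Rightarrow> real" where
  "tau_rate \<alpha> s = sqrt (\<alpha> / (2 * s))"

definition kappa_rate :: "real \<Rightarrow> real \<Rightarrow> real \<Rightarrow> real \<Rightarrow> real" where
  "kappa_rate \<alpha> t0 s0 t = sqrt (2 * s0 / \<alpha>) * exp ((t - t0) / \<alpha>)"

context
  fixes \<alpha> t0 s0 :: real
  assumes \<alpha>: "0 < \<alpha>" and s0: "0 < s0"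
begin

lemma tau_rate_pos: "0 < s \<Longrightarrow> 0 < tau_rate \<alpha> s"
  using \<alpha> by (simp add: tau_rate_def)

lemma kappa_rate_pos: "0 < kappa_rate \<alpha> t0 s0 t"
  using \<alpha> s0 by (simp add: kappa_rate_def)

lemma tau_rate_square: "0 < s \<Longrightarrow> (tau_rate \<alpha> s)\<^sup>2 = \<alpha> / (2 * s)"
  using \<alpha> by (simp add: tau_rate_def)

lemma kappa_rate_square: "(kappa_rate \<alpha> t0 s0 t)\<^sup>2 = 2 * s0 / \<alpha> * exp (2 * (t - t0) / \<alpha>)"
proof -
  have "(exp ((t - t0) / \<alpha>))\<^sup>2 = exp (2 * (t - t0) / \<alpha>)"
    by (simp add: exp_double[symmetric])
  then show ?thesis using \<alpha> s0 by (simp add: kappa_rate_def power_mult_distrib)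
qed

lemma kappa_rate_square': "(kappa_rate \<alpha> t0 s0 t)\<^sup>2 = 2 * kappa \<alpha> t0 s0 t / \<alpha>"
  unfolding kappa_rate_square kappa_def by simp

lemma kappa_pos: "0 < kappa \<alpha> t0 s0 t"
  using s0 by (simp add: kappa_def)

lemma kappa_tau: "0 < s \<Longrightarrow> kappa \<alpha> t0 s0 (tau \<alpha> t0 s0 s) = s"
  using \<alpha> s0 by (simp add: kappa_def tau_def)

lemma tau_kappa: "tau \<alpha> t0 s0 (kappa \<alpha> t0 s0 t) = t"
proof -
  have "\<alpha> / 2 * (2 * (t - t0) / \<alpha>) = t - t0" using \<alpha> by simp
  then show ?thesis using s0 by (simp add: kappa_def tau_def)
qed

lemma exp_tau: "0 < s \<Longrightarrow> exp (2 * (tau \<alpha> t0 s0 s - t0) / \<alpha>) = s / s0"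
  using kappa_tau[of s] s0 by (simp add: kappa_def field_simps)

lemma tau_rate_kappa_rate:
  assumes s: "0 < s"
  shows "tau_rate \<alpha> s * kappa_rate \<alpha> t0 s0 (tau \<alpha> t0 s0 s) = 1"
proof -
  have "(tau_rate \<alpha> s * kappa_rate \<alpha> t0 s0 (tau \<alpha> t0 s0 s))\<^sup>2 = 1"
    using \<alpha> s by (simp add: power_mult_distrib tau_rate_square kappa_rate_square' kappa_tau)
  then show ?thesis
    using tau_rate_pos[OF s] kappa_rate_pos[of "tau \<alpha> t0 s0 s"]
    by (metis mult_pos_pos less_imp_le power2_eq_1_iff not_le zero_less_one neg_0_le_iff_le)
qed

lemma kappa_rate_tau_rate: "kappa_rate \<alpha> t0 s0 t * tau_rate \<alpha> (kappa \<alpha> t0 s0 t) = 1"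
  using tau_rate_kappa_rate[OF kappa_pos, of t] by (simp add: tau_kappa mult.commute)

lemma tau_derivative: "0 < s \<Longrightarrow> (tau \<alpha> t0 s0 has_real_derivative (tau_rate \<alpha> s)\<^sup>2) (at s)"
  unfolding tau_def[abs_def] tau_rate_square using s0
  by (auto intro!: derivative_eq_intros simp: field_simps)

lemma kappa_derivative: "(kappa \<alpha> t0 s0 has_real_derivative (kappa_rate \<alpha> t0 s0 t)\<^sup>2) (at t)"
  unfolding kappa_def[abs_def] kappa_rate_square using \<alpha>
  by (auto intro!: derivative_eq_intros)

lemma tau_rate_derivative:
  assumes s: "0 < s"
  shows "(tau_rate \<alpha> has_real_derivative - (tau_rate \<alpha> s / (2 * s))) (at s)"
proof -
  have "0 < \<alpha> / (2 * s)" using \<alpha> s by simp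
  then have "((\<lambda>s. sqrt (\<alpha> / (2 * s))) has_real_derivative - (\<alpha> / (2 * s)) / (2 * s * sqrt (\<alpha> / (2 * s)))) (at s)"
    using s by (auto intro!: derivative_eq_intros simp: field_simps power2_eq_square)
  moreover have "(\<alpha> / (2 * s)) / (2 * s * sqrt (\<alpha> / (2 * s))) = sqrt (\<alpha> / (2 * s)) / (2 * s)"
  proof -
    have "x / (2 * s * sqrt x) = sqrt x / (2 * s)" if "0 < x" for x
      using that s by (simp add: field_simps real_sqrt_mult[symmetric])
    then show ?thesis using \<open>0 < \<alpha> / (2 * s)\<close> by blast
  qed
  ultimately show ?thesis unfolding tau_rate_def[abs_def] by simp
qed

lemma kappa_rate_derivative:
  "(kappa_rate \<alpha> t0 s0 has_real_derivative kappa_rate \<alpha> t0 s0 t / \<alpha>) (at t)"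
  unfolding kappa_rate_def[abs_def] using \<alpha> by (auto intro!: derivative_eq_intros)

lemma tau_rate_continuous: "continuous_on {s0..} (tau_rate \<alpha>)"
  using s0 by (intro continuous_at_imp_continuous_on ballI DERIV_isCont[OF tau_rate_derivative]) auto

lemma kappa_rate_continuous: "continuous_on S (kappa_rate \<alpha> t0 s0)"
  by (intro continuous_at_imp_continuous_on ballI DERIV_isCont[OF kappa_rate_derivative])

lemma tau_mono: "0 < s \<Longrightarrow> s \<le> s' \<Longrightarrow> tau \<alpha> t0 s0 s \<le> tau \<alpha> t0 s0 s'"
  using \<alpha> s0 by (simp add: tau_def divide_right_mono)

lemma kappa_mono: "t \<le> t' \<Longrightarrow> kappa \<alpha> t0 s0 t \<le> kappa \<alpha> t0 s0 t'"
  using \<alpha> s0 by (simp add: kappa_def divide_right_mono)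

lemma tau_start: "tau \<alpha> t0 s0 s0 = t0"
  using s0 by (simp add: tau_def)

lemma kappa_start: "kappa \<alpha> t0 s0 t0 = s0"
  by (simp add: kappa_def)

lemma deriv_tau_powr: "0 < s \<Longrightarrow> deriv (tau \<alpha> t0 s0) s powr (3/2) = tau_rate \<alpha> s ^ 3"
  unfolding DERIV_imp_deriv[OF tau_derivative] using tau_rate_pos[of s]
  by (simp add: powr_numeral[symmetric] powr_powr del: powr_numeral)

lemma deriv_kappa_powr: "deriv (kappa \<alpha> t0 s0) t powr (3/2) = kappa_rate \<alpha> t0 s0 t ^ 3"
  unfolding DERIV_imp_deriv[OF kappa_derivative] using kappa_rate_pos[of t]
  by (simp add: powr_numeral[symmetric] powr_powr del: powr_numeral)

lemma time_change_tau:
  "time_change t0 (kappa_rate \<alpha> t0 s0) (\<lambda>t. kappa_rate \<alpha> t0 s0 t / \<alpha>) (kappa \<alpha> t0 s0)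
    s0 (tau_rate \<alpha>) (\<lambda>s. - (tau_rate \<alpha> s / (2 * s))) (tau \<alpha> t0 s0)"
proof
  show "continuous_on {t0..} (\<lambda>t. kappa_rate \<alpha> t0 s0 t / \<alpha>)"
    by (intro continuous_intros kappa_rate_continuous) (use \<alpha> in auto)
  show "continuous_on {s0..} (\<lambda>s. - (tau_rate \<alpha> s / (2 * s)))"
    by (intro continuous_intros tau_rate_continuous) (use s0 in auto)
  show "s0 \<le> kappa \<alpha> t0 s0 t" if "t0 \<le> t" for t
    using kappa_mono[OF that] by (simp add: kappa_start)
  fix s assume "s0 \<le> s"
  then have s: "0 < s" using s0 by simp
  have "tau_rate \<alpha> s ^ 3 * (kappa_rate \<alpha> t0 s0 (tau \<alpha> t0 s0 s) / \<alpha>)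
    = (tau_rate \<alpha> s)\<^sup>2 * (tau_rate \<alpha> s * kappa_rate \<alpha> t0 s0 (tau \<alpha> t0 s0 s)) / \<alpha>"
    by (simp add: power2_eq_square power3_eq_cube)
  also have "\<dots> = (tau_rate \<alpha> s * kappa_rate \<alpha> t0 s0 (tau \<alpha> t0 s0 s)) / (2 * s)"
    unfolding tau_rate_kappa_rate[OF s] tau_rate_square[OF s] using \<alpha> by simp
  finally show "- (tau_rate \<alpha> s / (2 * s)) * kappa_rate \<alpha> t0 s0 (tau \<alpha> t0 s0 s)
    = - (tau_rate \<alpha> s ^ 3 * (kappa_rate \<alpha> t0 s0 (tau \<alpha> t0 s0 s) / \<alpha>))" by simp
qed (use s0 in \<open>auto intro!: kappa_rate_derivative kappa_derivative tau_rate_derivative tau_derivative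
      tau_mono kappa_mono less_imp_le[OF kappa_rate_pos] simp: tau_start kappa_tau tau_kappa tau_rate_kappa_rate\<close>)

text \<open>The same pair of clocks in the opposite order; the derivative identity is checked anew,
  as it is not literally symmetric in the two roles.\<close>

lemma time_change_kappa:
  "time_change s0 (tau_rate \<alpha>) (\<lambda>s. - (tau_rate \<alpha> s / (2 * s))) (tau \<alpha> t0 s0)
    t0 (kappa_rate \<alpha> t0 s0) (\<lambda>t. kappa_rate \<alpha> t0 s0 t / \<alpha>) (kappa \<alpha> t0 s0)"
proof
  show "continuous_on {t0..} (\<lambda>t. kappa_rate \<alpha> t0 s0 t / \<alpha>)"
    by (intro continuous_intros kappa_rate_continuous) (use \<alpha> in auto)
  show "continuous_on {s0..} (\<lambda>s. - (tau_rate \<alpha> s / (2 * s)))"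
    by (intro continuous_intros tau_rate_continuous) (use s0 in auto)
  show "t0 \<le> tau \<alpha> t0 s0 s" if "s0 \<le> s" for s
    using tau_mono[OF s0 that] by (simp add: tau_start)
  fix t
  have "kappa_rate \<alpha> t0 s0 t ^ 3 * (- (tau_rate \<alpha> (kappa \<alpha> t0 s0 t) / (2 * kappa \<alpha> t0 s0 t)))
    = - ((kappa_rate \<alpha> t0 s0 t)\<^sup>2 * (kappa_rate \<alpha> t0 s0 t * tau_rate \<alpha> (kappa \<alpha> t0 s0 t)) / (2 * kappa \<alpha> t0 s0 t))"
    by (simp add: power2_eq_square power3_eq_cube)
  also have "\<dots> = - ((kappa_rate \<alpha> t0 s0 t * tau_rate \<alpha> (kappa \<alpha> t0 s0 t)) / \<alpha>)"
    unfolding kappa_rate_tau_rate kappa_rate_square' using \<alpha> kappa_pos[of t] by simp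
  finally show "kappa_rate \<alpha> t0 s0 t / \<alpha> * tau_rate \<alpha> (kappa \<alpha> t0 s0 t)
    = - (kappa_rate \<alpha> t0 s0 t ^ 3 * (- (tau_rate \<alpha> (kappa \<alpha> t0 s0 t) / (2 * kappa \<alpha> t0 s0 t))))" by simp
qed (use s0 in \<open>auto intro!: kappa_rate_derivative kappa_derivative tau_rate_derivative tau_derivative
      tau_mono kappa_mono less_imp_le[OF tau_rate_pos] simp: kappa_start kappa_tau tau_kappa kappa_rate_tau_rate\<close>)

section \<open>The drifts under the time change\<close>

lemma drift_B_time_change:
  assumes s: "0 < s"
  shows "drift_B \<alpha> \<beta> s ((tau_rate \<alpha> s)\<^sup>2 *\<^sub>R x) ((tau_rate \<alpha> s)\<^sup>2 *\<^sub>R h) v =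
    (2 * tau_rate \<alpha> s * (- (tau_rate \<alpha> s / (2 * s)))) *\<^sub>R x + (tau_rate \<alpha> s ^ 4) *\<^sub>R drift_A \<alpha> \<beta> t0 s0 (tau \<alpha> t0 s0 s) x h v"
proof -
  define A where "A = \<alpha> / (2 * s)"
  have A2: "(tau_rate \<alpha> s)\<^sup>2 = A" unfolding A_def by (rule tau_rate_square[OF s])
  have A4: "tau_rate \<alpha> s ^ 4 = A\<^sup>2" unfolding A2[symmetric] by simp
  have Ad: "2 * tau_rate \<alpha> s * (- (tau_rate \<alpha> s / (2 * s))) = - A / s"
    unfolding A2[symmetric] by (simp add: power2_eq_square)
  \<comment> \<open>Differentiating the factor \<open>A\<close> contributes \<open>- A / s\<close>,
    which turns the coefficient \<alpha> - 1 of the damping into \<alpha>.\<close>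
  have 1: "- A / s - A\<^sup>2 * (2 * (\<alpha> - 1) / \<alpha>) = - (\<alpha> / s * A)"
    using \<alpha> s unfolding A_def by (simp add: field_simps power2_eq_square)
  \<comment> \<open>One coefficient read in two ways, since
    \<open>A * (2 * s / \<alpha>) = 1\<close>: the \<open>h\<close> term keeps a factor
    \<open>A\<close> for its rescaled argument, whereas \<open>v\<close> is not rescaled.\<close>
  have 2: "A\<^sup>2 * (2 * \<beta> * s0 / \<alpha> * (s / s0)) = \<beta> * A" "A\<^sup>2 * (2 * \<beta> * s0 / \<alpha> * (s / s0)) = \<alpha> * \<beta> / (2 * s)"
    using \<alpha> s s0 unfolding A_def by (simp_all add: field_simps power2_eq_square)
  have "(- A / s) *\<^sub>R x + A\<^sup>2 *\<^sub>R drift_A \<alpha> \<beta> t0 s0 (tau \<alpha> t0 s0 s) x h v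
    = (- A / s - A\<^sup>2 * (2 * (\<alpha> - 1) / \<alpha>)) *\<^sub>R x
      - (A\<^sup>2 * (2 * \<beta> * s0 / \<alpha> * (s / s0))) *\<^sub>R h - (A\<^sup>2 * (2 * \<beta> * s0 / \<alpha> * (s / s0))) *\<^sub>R v"
    unfolding drift_A_def exp_tau[OF s]
    by (simp add: scaleR_diff_right scaleR_diff_left)
  also have "\<dots> = drift_B \<alpha> \<beta> s (A *\<^sub>R x) (A *\<^sub>R h) v"
    unfolding 1 drift_B_def by (subst 2(1), subst 2(2)) simp
  finally show ?thesis unfolding A2 A4 Ad ..
qed

lemma drift_A_time_change:
  "drift_A \<alpha> \<beta> t0 s0 t ((kappa_rate \<alpha> t0 s0 t)\<^sup>2 *\<^sub>R x) ((kappa_rate \<alpha> t0 s0 t)\<^sup>2 *\<^sub>R h) v =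
    (2 * kappa_rate \<alpha> t0 s0 t * (kappa_rate \<alpha> t0 s0 t / \<alpha>)) *\<^sub>R x +
    (kappa_rate \<alpha> t0 s0 t ^ 4) *\<^sub>R drift_B \<alpha> \<beta> (kappa \<alpha> t0 s0 t) x h v"
proof -
  define k where "k = kappa \<alpha> t0 s0 t"
  have k: "0 < k" unfolding k_def by (rule kappa_pos)
  define A where "A = 2 * k / \<alpha>"
  have A2: "(kappa_rate \<alpha> t0 s0 t)\<^sup>2 = A" unfolding A_def k_def by (rule kappa_rate_square')
  have A4: "kappa_rate \<alpha> t0 s0 t ^ 4 = A\<^sup>2" unfolding A2[symmetric] by simp
  have Ad: "2 * kappa_rate \<alpha> t0 s0 t * (kappa_rate \<alpha> t0 s0 t / \<alpha>) = 2 * A / \<alpha>"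
    unfolding A2[symmetric] by (simp add: power2_eq_square)
  have e: "2 * \<beta> * s0 / \<alpha> * exp (2 * (t - t0) / \<alpha>) = \<beta> * A"
    unfolding A_def k_def kappa_def by simp
  \<comment> \<open>Here the factor \<open>A\<close> grows, and its derivative lowers the damping
    from \<alpha> to \<alpha> - 1.\<close>
  have 1: "2 * A / \<alpha> - A\<^sup>2 * (\<alpha> / k) = - (2 * (\<alpha> - 1) / \<alpha> * A)"
    using \<alpha> k unfolding A_def by (simp add: field_simps power2_eq_square)
  have 2: "A\<^sup>2 * \<beta> = \<beta> * A * A" "A\<^sup>2 * (\<alpha> * \<beta> / (2 * k)) = \<beta> * A"
    using \<alpha> k unfolding A_def by (simp_all add: field_simps power2_eq_square)
  have "(2 * A / \<alpha>) *\<^sub>R x + A\<^sup>2 *\<^sub>R drift_B \<alpha> \<beta> k x h v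
    = (2 * A / \<alpha> - A\<^sup>2 * (\<alpha> / k)) *\<^sub>R x - (A\<^sup>2 * \<beta>) *\<^sub>R h - (A\<^sup>2 * (\<alpha> * \<beta> / (2 * k))) *\<^sub>R v"
    unfolding drift_B_def by (simp add: scaleR_diff_right scaleR_diff_left)
  also have "\<dots> = drift_A \<alpha> \<beta> t0 s0 t (A *\<^sub>R x) (A *\<^sub>R h) v"
    unfolding 1 2 drift_A_def e by simp
  finally show ?thesis unfolding A2 A4 Ad k_def ..
qed

end

lemma continuous_on_drift_A:
  fixes x h v :: "real \<Rightarrow> 'h::real_normed_vector"
  assumes "continuous_on S x" "continuous_on S h" "continuous_on S v"
  shows "continuous_on S (\<lambda>r. drift_A \<alpha> \<beta> t0 s0 r (x r) (h r) (v r))"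
  unfolding drift_A_def divide_inverse by (intro continuous_intros assms)

lemma continuous_on_drift_B:
  fixes x h v :: "real \<Rightarrow> 'h::real_normed_vector"
  assumes "continuous_on {s0..} x" "continuous_on {s0..} h" "continuous_on {s0..} v" and "0 < s0"
  shows "continuous_on {s0..} (\<lambda>r. drift_B \<alpha> \<beta> r (x r) (h r) (v r))"
  unfolding drift_B_def by (intro continuous_intros assms(1-3)) (use assms(4) in auto)

theorem theorem3p4:
  fixes V :: "'h::{real_inner, polish_space} \<Rightarrow> 'h"
    and LV \<alpha> \<beta> t0 s0 :: real
    and M :: "'w measure" and F :: "real \<Rightarrow> 'w measure"
    and C :: "'h \<Rightarrow>\<^sub>L 'h" and W :: "real \<Rightarrow> 'w \<Rightarrow> 'h"
  assumes "monotone_operator V" and "LV-lipschitz_on UNIV V" and "zer V \<noteq> {}"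
    and "\<alpha> > 1" and "\<beta> > 0" and "t0 \<ge> 0" and "s0 > 0"
  defines "\<tau> \<equiv> tau \<alpha> t0 s0" and "\<kappa> \<equiv> kappa \<alpha> t0 s0"
  shows
    "(\<forall>\<sigma>Y Y0 X0 Y X. solution_A \<alpha> \<beta> t0 s0 V M F C W \<sigma>Y Y0 X0 Y X \<longrightarrow>
        (\<exists>J. driving_integral M F t0 C W \<kappa> J) \<and>
        (\<forall>J. driving_integral M F t0 C W \<kappa> J \<longrightarrow>
           solution_B \<alpha> \<beta> s0 V M (\<lambda>s. F (\<tau> s)) C (\<lambda>s. J (\<tau> s))
             (\<lambda>s. (deriv \<tau> s powr (3/2)) *\<^sub>R \<sigma>Y (\<tau> s))
             Y0 ((\<alpha> / (2 * s0)) *\<^sub>R X0)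
             (\<lambda>s. Y (\<tau> s)) (\<lambda>s \<omega>. (\<alpha> / (2 * s)) *\<^sub>R X (\<tau> s) \<omega>)) \<and>
        (\<forall>s\<ge>s0. (deriv \<tau> s powr (3/2)) *\<^sub>R \<sigma>Y (\<tau> s) =
           ((\<alpha> / (2 * s)) powr (3/2)) *\<^sub>R \<sigma>Y (\<tau> s)))
     \<and>
     (\<forall>\<sigma>Z Z0 Q0 Z Q. solution_B \<alpha> \<beta> s0 V M F C W \<sigma>Z Z0 Q0 Z Q \<longrightarrow>
        (\<exists>J. driving_integral M F s0 C W \<tau> J) \<and>
        (\<forall>J. driving_integral M F s0 C W \<tau> J \<longrightarrow>
           solution_A \<alpha> \<beta> t0 s0 V M (\<lambda>t. F (\<kappa> t)) C (\<lambda>t. J (\<kappa> t))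
             (\<lambda>t. (deriv \<kappa> t powr (3/2)) *\<^sub>R \<sigma>Z (\<kappa> t))
             Z0 ((2 * s0 / \<alpha>) *\<^sub>R Q0)
             (\<lambda>t. Z (\<kappa> t))
             (\<lambda>t \<omega>. (2 * s0 / \<alpha> * exp (2 * (t - t0) / \<alpha>)) *\<^sub>R Q (\<kappa> t) \<omega>)) \<and>
        (\<forall>t\<ge>t0. (deriv \<kappa> t powr (3/2)) *\<^sub>R \<sigma>Z (\<kappa> t) =
           ((2 * s0 / \<alpha> * exp (2 * (t - t0) / \<alpha>)) powr (3/2)) *\<^sub>R \<sigma>Z (\<kappa> t)))"
proof -
  have \<alpha>: "0 < \<alpha>" using \<open>\<alpha> > 1\<close> by simp
  have V: "continuous_on UNIV V" using assms(2) by (rule lipschitz_on_continuous_on)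
  \<comment> \<open>In (i) the driving integral has the clock \<open>\<kappa>\<close> and is read
    along its inverse \<open>\<tau>\<close>; \<open>K\<close> exchanges the two for (ii).\<close>
  interpret T: time_change t0 "kappa_rate \<alpha> t0 s0" "\<lambda>t. kappa_rate \<alpha> t0 s0 t / \<alpha>" \<kappa>
    s0 "tau_rate \<alpha>" "\<lambda>s. - (tau_rate \<alpha> s / (2 * s))" \<tau>
    unfolding \<tau>_def \<kappa>_def by (rule time_change_tau[OF \<alpha> \<open>s0 > 0\<close>])
  interpret K: time_change s0 "tau_rate \<alpha>" "\<lambda>s. - (tau_rate \<alpha> s / (2 * s))" \<tau>
    t0 "kappa_rate \<alpha> t0 s0" "\<lambda>t. kappa_rate \<alpha> t0 s0 t / \<alpha>" \<kappa>
    unfolding \<tau>_def \<kappa>_def by (rule time_change_kappa[OF \<alpha> \<open>s0 > 0\<close>])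
  have pos: "0 < s" if "s0 \<le> s" for s using that \<open>s0 > 0\<close> by simp
  note tp = deriv_tau_powr[OF \<alpha> \<open>s0 > 0\<close> pos, of _ t0, folded \<tau>_def]
  note kp = deriv_kappa_powr[OF \<alpha> \<open>s0 > 0\<close>, of t0, folded \<kappa>_def]
  have dt: "deriv \<tau> s = \<alpha> / (2 * s)" if "s0 \<le> s" for s
    unfolding \<tau>_def DERIV_imp_deriv[OF tau_derivative[OF \<alpha> \<open>s0 > 0\<close> pos[OF that]]]
    by (rule tau_rate_square[OF \<alpha> \<open>s0 > 0\<close> pos[OF that]])
  have dk: "deriv \<kappa> t = 2 * s0 / \<alpha> * exp (2 * (t - t0) / \<alpha>)" for t
    unfolding \<kappa>_def DERIV_imp_deriv[OF kappa_derivative[OF \<alpha> \<open>s0 > 0\<close>]]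
    by (rule kappa_rate_square[OF \<alpha> \<open>s0 > 0\<close>])
  show ?thesis
  proof (rule conjI; intro allI impI)
    fix \<sigma>Y Y0 X0 Y X
    assume "solution_A \<alpha> \<beta> t0 s0 V M F C W \<sigma>Y Y0 X0 Y X"
    then have sol: "trajectory_solution M F t0 C W \<sigma>Y V (drift_A \<alpha> \<beta> t0 s0) Y0 X0 Y X"
      unfolding solution_A_def .
    have "(\<exists>J. driving_integral M F t0 C W \<kappa> J) \<and>
        (\<forall>J. driving_integral M F t0 C W \<kappa> J \<longrightarrow>
           solution_B \<alpha> \<beta> s0 V M (\<lambda>s. F (\<tau> s)) C (\<lambda>s. J (\<tau> s))
             (\<lambda>s. (deriv \<tau> s powr (3/2)) *\<^sub>R \<sigma>Y (\<tau> s))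
             Y0 ((\<alpha> / (2 * s0)) *\<^sub>R X0)
             (\<lambda>s. Y (\<tau> s)) (\<lambda>s \<omega>. (\<alpha> / (2 * s)) *\<^sub>R X (\<tau> s) \<omega>))"
      unfolding solution_B_def
    proof (rule T.trajectory_solution_time_change[OF sol V continuous_on_drift_A,
          where \<zeta> = "\<lambda>s. \<alpha> / (2 * s)" and \<sigma>' = "\<lambda>s. (deriv \<tau> s powr (3/2)) *\<^sub>R \<sigma>Y (\<tau> s)"])
      fix s assume "s0 \<le> s"
      then have s: "0 < s" by (rule pos)
      show "drift_B \<alpha> \<beta> s ((tau_rate \<alpha> s)\<^sup>2 *\<^sub>R x) ((tau_rate \<alpha> s)\<^sup>2 *\<^sub>R h) v =
          (2 * tau_rate \<alpha> s * (- (tau_rate \<alpha> s / (2 * s)))) *\<^sub>R x + (tau_rate \<alpha> s ^ 4) *\<^sub>R drift_A \<alpha> \<beta> t0 s0 (\<tau> s) x h v"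
        for x h v :: 'h
        unfolding \<tau>_def by (rule drift_B_time_change[OF \<alpha> \<open>s0 > 0\<close> s])
      show "(deriv \<tau> s powr (3/2)) *\<^sub>R \<sigma>Y (\<tau> s) = (tau_rate \<alpha> s ^ 3) *\<^sub>R \<sigma>Y (\<tau> s)"
        by (simp add: tp \<open>s0 \<le> s\<close>)
      show "\<alpha> / (2 * s) = (tau_rate \<alpha> s)\<^sup>2" by (simp add: tau_rate_square[OF \<alpha> \<open>s0 > 0\<close> s])
    qed
    then show "(\<exists>J. driving_integral M F t0 C W \<kappa> J) \<and>
        (\<forall>J. driving_integral M F t0 C W \<kappa> J \<longrightarrow>
           solution_B \<alpha> \<beta> s0 V M (\<lambda>s. F (\<tau> s)) C (\<lambda>s. J (\<tau> s))
             (\<lambda>s. (deriv \<tau> s powr (3/2)) *\<^sub>R \<sigma>Y (\<tau> s))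
             Y0 ((\<alpha> / (2 * s0)) *\<^sub>R X0)
             (\<lambda>s. Y (\<tau> s)) (\<lambda>s \<omega>. (\<alpha> / (2 * s)) *\<^sub>R X (\<tau> s) \<omega>)) \<and>
        (\<forall>s\<ge>s0. (deriv \<tau> s powr (3/2)) *\<^sub>R \<sigma>Y (\<tau> s) =
           ((\<alpha> / (2 * s)) powr (3/2)) *\<^sub>R \<sigma>Y (\<tau> s))"
      using dt by simp
  next
    fix \<sigma>Z Z0 Q0 Z Q
    assume "solution_B \<alpha> \<beta> s0 V M F C W \<sigma>Z Z0 Q0 Z Q"
    then have sol: "trajectory_solution M F s0 C W \<sigma>Z V (drift_B \<alpha> \<beta>) Z0 Q0 Z Q"
      unfolding solution_B_def .
    \<comment> \<open>The initial factor first appears as the general scaling evaluated at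
      \<open>t0\<close>; its exponential is 1 and disappears on simplification.\<close>
    have "(\<exists>J. driving_integral M F s0 C W \<tau> J) \<and>
        (\<forall>J. driving_integral M F s0 C W \<tau> J \<longrightarrow>
           trajectory_solution M (\<lambda>t. F (\<kappa> t)) t0 C (\<lambda>t. J (\<kappa> t))
             (\<lambda>t. (deriv \<kappa> t powr (3/2)) *\<^sub>R \<sigma>Z (\<kappa> t)) V (drift_A \<alpha> \<beta> t0 s0)
             Z0 ((2 * s0 / \<alpha> * exp (2 * (t0 - t0) / \<alpha>)) *\<^sub>R Q0)
             (\<lambda>t. Z (\<kappa> t))
             (\<lambda>t \<omega>. (2 * s0 / \<alpha> * exp (2 * (t - t0) / \<alpha>)) *\<^sub>R Q (\<kappa> t) \<omega>))"
    proof (rule K.trajectory_solution_time_change[OF sol V continuous_on_drift_B[OF _ _ _ \<open>s0 > 0\<close>],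
          where \<zeta> = "\<lambda>t. 2 * s0 / \<alpha> * exp (2 * (t - t0) / \<alpha>)"
            and \<sigma>' = "\<lambda>t. (deriv \<kappa> t powr (3/2)) *\<^sub>R \<sigma>Z (\<kappa> t)"])
      fix t
      show "drift_A \<alpha> \<beta> t0 s0 t ((kappa_rate \<alpha> t0 s0 t)\<^sup>2 *\<^sub>R x) ((kappa_rate \<alpha> t0 s0 t)\<^sup>2 *\<^sub>R h) v =
          (2 * kappa_rate \<alpha> t0 s0 t * (kappa_rate \<alpha> t0 s0 t / \<alpha>)) *\<^sub>R x +
          (kappa_rate \<alpha> t0 s0 t ^ 4) *\<^sub>R drift_B \<alpha> \<beta> (\<kappa> t) x h v"
        for x h v :: 'h
        unfolding \<kappa>_def by (rule drift_A_time_change[OF \<alpha> \<open>s0 > 0\<close>])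
      show "(deriv \<kappa> t powr (3/2)) *\<^sub>R \<sigma>Z (\<kappa> t) = (kappa_rate \<alpha> t0 s0 t ^ 3) *\<^sub>R \<sigma>Z (\<kappa> t)"
        by (simp add: kp)
      show "2 * s0 / \<alpha> * exp (2 * (t - t0) / \<alpha>) = (kappa_rate \<alpha> t0 s0 t)\<^sup>2"
        by (rule kappa_rate_square[OF \<alpha> \<open>s0 > 0\<close>, symmetric])
    qed
    then show "(\<exists>J. driving_integral M F s0 C W \<tau> J) \<and>
        (\<forall>J. driving_integral M F s0 C W \<tau> J \<longrightarrow>
           solution_A \<alpha> \<beta> t0 s0 V M (\<lambda>t. F (\<kappa> t)) C (\<lambda>t. J (\<kappa> t))
             (\<lambda>t. (deriv \<kappa> t powr (3/2)) *\<^sub>R \<sigma>Z (\<kappa> t))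
             Z0 ((2 * s0 / \<alpha>) *\<^sub>R Q0)
             (\<lambda>t. Z (\<kappa> t))
             (\<lambda>t \<omega>. (2 * s0 / \<alpha> * exp (2 * (t - t0) / \<alpha>)) *\<^sub>R Q (\<kappa> t) \<omega>)) \<and>
        (\<forall>t\<ge>t0. (deriv \<kappa> t powr (3/2)) *\<^sub>R \<sigma>Z (\<kappa> t) =
           ((2 * s0 / \<alpha> * exp (2 * (t - t0) / \<alpha>)) powr (3/2)) *\<^sub>R \<sigma>Z (\<kappa> t))"
      unfolding solution_A_def using dk by simp
  qed
qed

end
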